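(* Let $k$ be a field of characteristic zero, let $R=k[x_1,x_2,x_3]$ and let $I\subset R$ be a homogeneous ideal such that $R/I$ is an artinian Gorenstein algebra. If $I$ has initial degree $2$, then $R/I$ has the Weak Lefschetz Property.
   Context: $R=k[x_1,x_2,x_3]$ has the standard grading. The initial degree of a homogeneous ideal $I$ is $\min\{t \mid I_t\neq 0\}$, where $I_t$ is the degree-$t$ homogeneous component. An artinian standard graded algebra $A=\bigoplus_{i\ge 0}A_i$ has the Weak Lefschetz Property (WLP) if for a general linear form $L\in A_1$ (i.e. for all $L$ in some non-empty Zariski-open subset of the space of linear forms) the multiplication map $\times L:A_i\to A_{i+1}$ has maximal rank (is injective or surjective) for every $i$. The algebra is Gorenstein if its socle $\{a\in A\mid x a=0 \text{ for all } x\in A_1\}$ is one-dimensional over $k$. *)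

theory Defs
  imports
    "HOL-Library.Poly_Mapping"
    "HOL-Library.Numeral_Type"
    "HOL-Algebra.QuotRing"
    "HOL-Algebra.Embedded_Algebras"
    "HOL-Algebra.Algebraic_Closure_Type"
begin

section \<open>The standard graded polynomial ring\<close>

text \<open>
  A monomial maps each variable to its exponent, a polynomial maps each monomial to its
  coefficient; multiplication of polynomial mappings is convolution. The variables are the
  elements of the finite type \<open>'v\<close>, so \<open>(3, 'k) mpol\<close> is a polynomial ring in three variables.
\<close>

type_synonym ('v, 'k) mpol = "('v \<Rightarrow>\<^sub>0 nat) \<Rightarrow>\<^sub>0 'k"

abbreviation poly_ring :: "('v, 'k::field) mpol ring"
  where "poly_ring \<equiv> ring_of_type_algebra"

definition const :: "'k \<Rightarrow> ('v, 'k::field) mpol"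
  where "const c = Poly_Mapping.single 0 c"

definition mon_degree :: "('v::finite \<Rightarrow>\<^sub>0 nat) \<Rightarrow> nat"
  where "mon_degree m = (\<Sum>v\<in>UNIV. Poly_Mapping.lookup m v)"

definition forms :: "nat \<Rightarrow> ('v::finite, 'k::field) mpol set"
  where "forms d = {f. \<forall>m\<in>Poly_Mapping.keys f. mon_degree m = d}"

definition component :: "nat \<Rightarrow> ('v::finite, 'k::field) mpol \<Rightarrow> ('v, 'k) mpol"
  where "component d f =
    (\<Sum>m\<in>{m \<in> Poly_Mapping.keys f. mon_degree m = d}.
        Poly_Mapping.single m (Poly_Mapping.lookup f m))"

definition homogeneous_ideal :: "('v::finite, 'k::field) mpol set \<Rightarrow> bool"
  where "homogeneous_ideal I \<longleftrightarrow>
    ideal I poly_ring \<and> (\<forall>f\<in>I. \<forall>d. component d f \<in> I)"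

text \<open>Unspecified for the zero ideal, whose initial degree is undefined.\<close>

definition initial_degree :: "('v::finite, 'k::field) mpol set \<Rightarrow> nat"
  where "initial_degree I = (LEAST t. \<exists>f\<in>I \<inter> forms t. f \<noteq> 0)"


section \<open>Graded quotients\<close>

abbreviation quot :: "('v, 'k::field) mpol set \<Rightarrow> ('v, 'k) mpol set ring"
  where "quot I \<equiv> poly_ring Quot I"

definition residue_class :: "('v, 'k::field) mpol set \<Rightarrow> ('v, 'k) mpol \<Rightarrow> ('v, 'k) mpol set"
  where "residue_class I f = I +>\<^bsub>poly_ring\<^esub> f"

definition graded_piece :: "('v::finite, 'k::field) mpol set \<Rightarrow> nat \<Rightarrow> ('v, 'k) mpol set set"
  where "graded_piece I d = residue_class I ` forms d"

text \<open>
  For a proper ideal this is a subfield of the quotient isomorphic to the ground field, so that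
  \<open>ring.dimension\<close> over it is the dimension over the ground field.
\<close>

definition scalars :: "('v, 'k::field) mpol set \<Rightarrow> ('v, 'k) mpol set set"
  where "scalars I = range (\<lambda>c. residue_class I (const c))"

definition artinian_ring :: "('a, 'b) ring_scheme \<Rightarrow> bool"
  where "artinian_ring A \<longleftrightarrow> ring A \<and>
    (\<forall>J :: nat \<Rightarrow> 'a set. (\<forall>n. ideal (J n) A) \<and> (\<forall>n. J (Suc n) \<subseteq> J n)
        \<longrightarrow> (\<exists>N. \<forall>n\<ge>N. J n = J N))"

definition socle :: "('v::finite, 'k::field) mpol set \<Rightarrow> ('v, 'k) mpol set set"
  where "socle I = {a \<in> carrier (quot I). \<forall>x\<in>graded_piece I 1. x \<otimes>\<^bsub>quot I\<^esub> a = \<zero>\<^bsub>quot I\<^esub>}"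

definition artinian_gorenstein :: "('v::finite, 'k::field) mpol set \<Rightarrow> bool"
  where "artinian_gorenstein I \<longleftrightarrow>
    artinian_ring (quot I) \<and> ring.dimension (quot I) 1 (scalars I) (socle I)"


section \<open>The Weak Lefschetz Property\<close>

definition eval_at :: "('v::finite \<Rightarrow> 'k) \<Rightarrow> ('v, 'k::field) mpol \<Rightarrow> 'k"
  where "eval_at a p =
    (\<Sum>m\<in>Poly_Mapping.keys p.
        Poly_Mapping.lookup p m * (\<Prod>v\<in>UNIV. a v ^ Poly_Mapping.lookup m v))"

definition zariski_open :: "('v::finite \<Rightarrow> 'k::field) set \<Rightarrow> bool"
  where "zariski_open U \<longleftrightarrow> (\<exists>P. U = - {a. \<forall>p\<in>P. eval_at a p = 0})"

definition linear_form :: "('v::finite \<Rightarrow> 'k) \<Rightarrow> ('v, 'k::field) mpol"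
  where "linear_form a = (\<Sum>v\<in>UNIV. Poly_Mapping.single (Poly_Mapping.single v 1) (a v))"

text \<open>
  The coefficient map sending \<open>a\<close> to the class of \<open>linear_form a\<close> is a linear surjection onto
  the degree-one piece \<open>A\<^sub>1\<close> of the quotient (a bijection if the ideal contains no nonzero form
  of degree at most one), and a linear surjection of affine spaces is a topological quotient map
  for the Zariski topologies. Hence a subset of \<open>A\<^sub>1\<close> is open iff its preimage under this map is.
\<close>

definition zariski_open_piece1 ::
    "('v::finite, 'k::field) mpol set \<Rightarrow> ('v, 'k) mpol set set \<Rightarrow> bool"
  where "zariski_open_piece1 I U \<longleftrightarrow>
    U \<subseteq> graded_piece I 1 \<and> zariski_open {a. residue_class I (linear_form a) \<in> U}"

definition max_rank_at :: "('v::finite, 'k::field) mpol set \<Rightarrow> ('v, 'k) mpol set \<Rightarrow> nat \<Rightarrow> bool"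
  where "max_rank_at I L i \<longleftrightarrow>
    inj_on (\<lambda>a. L \<otimes>\<^bsub>quot I\<^esub> a) (graded_piece I i) \<or>
    (\<lambda>a. L \<otimes>\<^bsub>quot I\<^esub> a) ` graded_piece I i = graded_piece I (i + 1)"

definition weak_lefschetz :: "('v::finite, 'k::field) mpol set \<Rightarrow> bool"
  where "weak_lefschetz I \<longleftrightarrow>
    (\<exists>U. zariski_open_piece1 I U \<and> U \<noteq> {} \<and> (\<forall>L\<in>U. \<forall>i. max_rank_at I L i))"

end

theory Submission
  imports Defs "HOL-Library.Product_Plus"
begin

text \<open>
  The proof goes through Macaulay duality. Let \<open>e\<close> be the socle degree of \<open>A = R/I\<close> and
  \<open>\<phi>\<close> the functional on forms of degree \<open>e\<close> with kernel \<open>I\<^sub>e\<close>; a form \<open>f\<close> of degree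
  \<open>m\<close> lies in \<open>I\<close> iff \<open>\<phi>(fg) = 0\<close> for all forms \<open>g\<close> of degree \<open>e - m\<close>. By duality it suffices
  that a general \<open>L\<close> is injective on \<open>A\<^sub>i\<close> for \<open>i = \<lfloor>(e - 1)/2\<rfloor>\<close>. If \<open>e\<close> is even, this follows
  from the odd case applied to the functionals \<open>f \<mapsto> \<phi>(x\<^sub>v f)\<close>, which are killed by the same quadric.

  Let \<open>e = 2t + 1\<close>, and let \<open>q \<in> I\<close> be a quadric, monic in \<open>\<zeta>\<close> for a suitable basis
  \<open>\<xi>, \<eta>, \<zeta>\<close> of the linear forms. Then \<open>R/q\<close> is free over \<open>P = k[\<xi>,\<eta>]\<close> with basis \<open>1, \<zeta>\<close>. Let
  \<open>N\<close> and \<open>T\<close> be the images of \<open>I\<^sub>t\<close> and \<open>I\<^sub>t\<^sub>+\<^sub>1\<close>; as \<open>dim A\<^sub>t = dim A\<^sub>t\<^sub>+\<^sub>1\<close>,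
  \<open>dim T = dim N + 2\<close>. If two elements of \<open>T\<close> have independent values at a point \<open>r\<close> of the
  \<open>\<xi>,\<eta>\<close>-line, then \<open>L = \<xi> - r\<eta>\<close> maps \<open>A\<^sub>t\<close> onto \<open>A\<^sub>t\<^sub>+\<^sub>1\<close>. Otherwise \<open>T\<close> has rank one over \<open>P\<close>,
  so the spaces \<open>P\<^sub>i T\<close> must at some point grow by one dimension only, which forces
  \<open>P\<^sub>i T = P\<^sub>r w\<close> for some \<open>w\<close>. Counting dimensions, either \<open>w \<in> I\<close>, contradicting
  \<open>dim T = dim N + 2\<close>, or \<open>N = 0\<close> and \<open>T\<close> is spanned by two forms in \<open>P\<close>; there a
  perturbation \<open>\<xi> - r\<eta> + c\<zeta>\<close> with small \<open>c\<close> works.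
\<close>

section \<open>Linear algebra\<close>

context vector_space
begin

text \<open>Polynomial rings and \<open>pairs\<close> are infinite-dimensional over the field, so
  finiteness enters through a finite \<open>F\<close> whose span contains the subspace at hand. The
  \<open>_fd\<close> lemmas all follow this pattern.\<close>

lemma finite_basis_exists:
  assumes "V \<subseteq> span F" "finite F"
  obtains B where "B \<subseteq> V" "independent B" "V \<subseteq> span B" "finite B" "card B = dim V"
proof -
  obtain B where B: "B \<subseteq> V" "independent B" "V \<subseteq> span B" "card B = dim V"
    using basis_exists by blast
  then have "finite B"
    using independent_span_bound[OF assms(2) B(2)] assms(1) by auto
  with B that show ?thesis by blast
qed

lemma independent_card_le_dim_fd:
  assumes "W \<subseteq> span F" "finite F" "B \<subseteq> W" "independent B"
  shows "finite B" "card B \<le> dim W"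
proof -
  obtain C where C: "W \<subseteq> span C" "finite C" "card C = dim W"
    using finite_basis_exists[OF assms(1,2)] by metis
  show "finite B" "card B \<le> dim W"
    using independent_span_bound[OF C(2) assms(4)] assms(3) C by auto
qed

lemma dim_mono_fd:
  assumes "V \<subseteq> W" "W \<subseteq> span F" "finite F"
  shows "dim V \<le> dim W"
proof -
  obtain B where B: "B \<subseteq> V" "independent B" "V \<subseteq> span B" "card B = dim V"
    using basis_exists by blast
  show ?thesis
    using independent_card_le_dim_fd(2)[OF assms(2,3), of B] B assms(1) by auto
qed

lemma dim_span_insert_fd:
  assumes "subspace V" "V \<subseteq> span F" "finite F" "x \<notin> V"
  shows "dim (span (insert x V)) = Suc (dim V)"
proof -
  obtain B where B: "B \<subseteq> V" "independent B" "V \<subseteq> span B" "finite B" "card B = dim V"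
    by (rule finite_basis_exists[OF assms(2,3)])
  have spB: "span B = V"
    using B assms(1) span_subspace by blast
  have ind: "independent (insert x B)"
    using assms(4) B(2) spB by (simp add: independent_insertI)
  have "span (insert x V) = span (insert x B)"
    using spB B(1) span_mono[of B "insert x B"]
    by (auto simp: span_eq span_base intro: span_superset[THEN subsetD])
  moreover have "x \<notin> B" using B(1) assms(4) by blast
  ultimately show ?thesis
    using dim_span_eq_card_independent[OF ind] B by simp
qed

lemma dim_less_fd:
  assumes "subspace V" "V \<subseteq> W" "subspace W" "W \<subseteq> span F" "finite F" "x \<in> W" "x \<notin> V"
  shows "dim V < dim W"
proof -
  have "span (insert x V) \<subseteq> W"
    using assms by (simp add: span_minimal)
  then have "dim (span (insert x V)) \<le> dim W"
    using dim_mono_fd assms(4,5) by blast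
  moreover have "dim (span (insert x V)) = Suc (dim V)"
    using dim_span_insert_fd[of V F x] assms by blast
  ultimately show ?thesis by simp
qed

lemma subspace_eq_fd:
  assumes "subspace V" "V \<subseteq> W" "subspace W" "W \<subseteq> span F" "finite F" "dim W \<le> dim V"
  shows "V = W"
proof (rule ccontr)
  assume "V \<noteq> W"
  then obtain x where "x \<in> W" "x \<notin> V" using assms(2) by blast
  then show False using dim_less_fd[OF assms(1-5), of x] assms(6) by simp
qed

lemma dim_span_insert_le_fd:
  assumes "subspace V" "V \<subseteq> span F" "finite F"
  shows "dim (span (insert x V)) \<le> Suc (dim V)"
proof (cases "x \<in> V")
  case True
  then have "insert x V = V" by blast
  then show ?thesis by simp
qed (use dim_span_insert_fd[OF assms, of x] in simp)

text \<open>One linear condition lowers the dimension by at most one: a vector \<open>v\<close>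
  violating it, together with the new kernel, spans the old kernel. Induction on \<open>A\<close>
  adds up the losses.\<close>

lemma dim_common_kernel:
  assumes "subspace V" "V \<subseteq> span F" "finite F" "finite A"
    and add: "\<And>a x y. \<beta> a (x + y) = \<beta> a x + \<beta> a y"
    and scale: "\<And>a c x. \<beta> a (scale c x) = c * \<beta> a x"
  shows "subspace {v \<in> V. \<forall>a\<in>A. \<beta> a v = 0} \<and>
    dim V \<le> dim {v \<in> V. \<forall>a\<in>A. \<beta> a v = 0} + card A"
  using assms(4)
proof (induction A)
  case empty
  then show ?case using assms(1) by simp
next
  case (insert a A)
  let ?K = "{v \<in> V. \<forall>a\<in>A. \<beta> a v = 0}"
  let ?K' = "{v \<in> V. \<forall>b\<in>insert a A. \<beta> b v = 0}"
  have sub: "subspace ?K" using insert by blast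
  have zero: "\<beta> b 0 = 0" for b using scale[of b 0 0] by simp
  have sub': "subspace ?K'"
    using assms(1) by (auto simp: subspace_def add scale zero)
  have fd: "?K' \<subseteq> span F" using assms(2) by auto
  have "dim ?K \<le> Suc (dim ?K')"
  proof (cases "\<exists>v\<in>?K. \<beta> a v \<noteq> 0")
    case False
    then have "?K' = ?K" by auto
    then have "dim ?K' = dim ?K" by (rule arg_cong)
    then show ?thesis by linarith
  next
    case True
    then obtain v where v: "v \<in> ?K" "\<beta> a v \<noteq> 0" by blast
    have "x \<in> span (insert v ?K')" if x: "x \<in> ?K" for x
    proof -
      let ?c = "\<beta> a x / \<beta> a v"
      have "x - scale ?c v \<in> ?K"
        using sub x v subspace_diff subspace_scale by blast
      moreover have "\<beta> a (x - scale ?c v) = 0"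
        using v(2) add[of a "x - scale ?c v" "scale ?c v"] by (simp add: scale)
      ultimately have "x - scale ?c v \<in> ?K'" by blast
      then have "x - scale ?c v \<in> span ?K'" by (rule span_base)
      then show ?thesis unfolding span_breakdown_eq by (rule exI)
    qed
    then have "?K \<subseteq> span (insert v ?K')" by blast
    moreover have "span (insert v ?K') \<subseteq> span F"
      using fd v assms(2) by (intro span_minimal) auto
    ultimately have "dim ?K \<le> dim (span (insert v ?K'))"
      using dim_mono_fd assms(3) by blast
    then show ?thesis
      using dim_span_insert_le_fd[OF sub' fd assms(3), of v] by linarith
  qed
  then show ?case using insert sub' by simp
qed

text \<open>A pairing imposes on \<open>W\<close> only as many conditions as the codimension of its
  left radical in \<open>V\<close>: if a basis \<open>B\<close> of the radical is extended to a
  basis \<open>C\<close> of \<open>V\<close>, only the elements of \<open>C - B\<close> can give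
  nontrivial conditions.\<close>

lemma dim_orthogonal_le:
  assumes V: "subspace V" "V \<subseteq> span F" "finite F" and W: "subspace W" "W \<subseteq> span G" "finite G"
    and add1: "\<And>x y z. \<beta> (x + y) z = \<beta> x z + \<beta> y z"
    and scale1: "\<And>c x z. \<beta> (scale c x) z = c * \<beta> x z"
    and add2: "\<And>x y z. \<beta> z (x + y) = \<beta> z x + \<beta> z y"
    and scale2: "\<And>c x z. \<beta> z (scale c x) = c * \<beta> z x"
  shows "dim W + dim {a \<in> V. \<forall>c\<in>W. \<beta> a c = 0} \<le> dim {c \<in> W. \<forall>a\<in>V. \<beta> a c = 0} + dim V"
proof -
  let ?N = "{a \<in> V. \<forall>c\<in>W. \<beta> a c = 0}"
  have "?N \<subseteq> span F" using V(2) by auto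
  then obtain B where B: "B \<subseteq> ?N" "independent B" "?N \<subseteq> span B" "finite B" "card B = dim ?N"
    by (rule finite_basis_exists[OF _ V(3)])
  have "B \<subseteq> V" using B by blast
  then obtain C where C: "B \<subseteq> C" "C \<subseteq> V" "independent C" "V \<subseteq> span C"
    by (rule maximal_independent_subset_extend[OF _ B(2)])
  have finC: "finite C"
    using independent_card_le_dim_fd(1)[OF V(2,3)] C by blast
  have cardC: "card C = dim V" using C basis_card_eq_dim by blast
  have eq: "{c \<in> W. \<forall>a\<in>C - B. \<beta> a c = 0} = {c \<in> W. \<forall>a\<in>V. \<beta> a c = 0}"
  proof (intro Collect_cong conj_cong refl iffI)
    fix c assume c: "c \<in> W" "\<forall>a\<in>C - B. \<beta> a c = 0"
    have sub: "subspace {a. \<beta> a c = 0}"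
      using scale1[of 0 0 c] by (auto simp: subspace_def add1 scale1)
    have "C \<subseteq> {a. \<beta> a c = 0}" using c B(1) by blast
    then have "span C \<subseteq> {a. \<beta> a c = 0}" using sub span_minimal by blast
    then show "\<forall>a\<in>V. \<beta> a c = 0" using C(4) by blast
  qed (use C in auto)
  have "dim W \<le> dim {c \<in> W. \<forall>a\<in>C - B. \<beta> a c = 0} + card (C - B)"
    using dim_common_kernel[of W G "C - B" \<beta>] W finC add2 scale2 by blast
  moreover have "card (C - B) = dim V - dim ?N" "dim ?N \<le> dim V"
    using card_Diff_subset[OF B(4) C(1)] cardC B(5) card_mono[OF finC C(1)] by auto
  ultimately show ?thesis unfolding eq by linarith
qed

text \<open>Take a dual system of maximal length \<open>n\<close>. If the expansion failed for some
  \<open>f\<close>, \<open>w\<close>, their parts orthogonal to the system would pair to a nonzero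
  value and could be appended to it.\<close>

lemma dual_bases:
  assumes U: "subspace U" "U \<subseteq> span F" "finite F" and W: "subspace W"
    and add1: "\<And>x y z. \<beta> (x + y) z = \<beta> x z + \<beta> y z"
    and scale1: "\<And>c x z. \<beta> (scale c x) z = c * \<beta> x z"
    and add2: "\<And>x y z. \<beta> z (x + y) = \<beta> z x + \<beta> z y"
    and scale2: "\<And>c x z. \<beta> z (scale c x) = c * \<beta> z x"
  obtains n :: nat and a b where "\<And>j. j < n \<Longrightarrow> a j \<in> U" "\<And>j. j < n \<Longrightarrow> b j \<in> W"
    "\<And>j l. j < n \<Longrightarrow> l < n \<Longrightarrow> \<beta> (a j) (b l) = (if j = l then 1 else 0)"
    "\<And>f w. f \<in> U \<Longrightarrow> w \<in> W \<Longrightarrow> \<beta> f w = (\<Sum>j<n. \<beta> f (b j) * \<beta> (a j) w)"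
proof -
  define dual where "dual n a b \<longleftrightarrow> (\<forall>j<n. a j \<in> U \<and> b j \<in> W) \<and>
    (\<forall>j<n. \<forall>l<n. \<beta> (a j) (b l) = (if j = l then 1 else 0))" for n :: nat and a b
  have zero1: "\<beta> 0 z = 0" and zero2: "\<beta> z 0 = 0" for z
    using scale1[of 0 0 z] scale2[of z 0 0] by simp_all
  have sum1: "\<beta> (sum g A) z = (\<Sum>i\<in>A. \<beta> (g i) z)" and
    sum2: "\<beta> z (sum g A) = (\<Sum>i\<in>A. \<beta> z (g i))" for g z and A :: "nat set"
    by (induction A rule: infinite_finite_induct) (simp_all add: zero1 zero2 add1 add2)
  have diff1: "\<beta> (x - y) z = \<beta> x z - \<beta> y z" and diff2: "\<beta> z (x - y) = \<beta> z x - \<beta> z y" for x y z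
    using add1[of "x - y" y z] add2[of z "x - y" y] by simp_all
  have bound: "n \<le> card F" if "dual n a b" for n a b
  proof -
    have inj: "inj_on a {..<n}"
      using that unfolding dual_def inj_on_def by (metis lessThan_iff zero_neq_one)
    have "independent (a ` {..<n})"
    proof (rule independent_if_scalars_zero)
      fix g x assume *: "(\<Sum>x\<in>a ` {..<n}. scale (g x) x) = 0" and "x \<in> a ` {..<n}"
      then obtain l where l: "l < n" "x = a l" by blast
      have "0 = \<beta> (\<Sum>j<n. scale (g (a j)) (a j)) (b l)"
        using * zero1 by (simp add: sum.reindex[OF inj] o_def)
      also have "\<dots> = (\<Sum>j<n. if j = l then g (a j) else 0)"
        unfolding sum1 scale1 using that l by (intro sum.cong) (auto simp: dual_def)
      also have "\<dots> = g x" using l by simp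
      finally show "g x = 0" by simp
    qed simp
    moreover have "a ` {..<n} \<subseteq> span F" using that U(2) by (auto simp: dual_def)
    ultimately have "card (a ` {..<n}) \<le> card F"
      using independent_span_bound[OF U(3)] by blast
    then show ?thesis using card_image[OF inj] by simp
  qed
  define P where "P n \<longleftrightarrow> (\<exists>a b. dual n a b)" for n
  define n where "n = Greatest P"
  have "P 0" by (simp add: P_def dual_def)
  moreover have P_bound: "\<forall>m. P m \<longrightarrow> m \<le> card F" using bound by (auto simp: P_def)
  ultimately have "P n" unfolding n_def using GreatestI_nat by blast
  then obtain a b where ab: "dual n a b" by (auto simp: P_def)
  have maximal: "m \<le> n" if "dual m a b" for m a b
  proof -
    have "P m" using that by (auto simp: P_def)
    then show ?thesis unfolding n_def using P_bound Greatest_le_nat by blast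
  qed
  have expand: "\<beta> f w = (\<Sum>j<n. \<beta> f (b j) * \<beta> (a j) w)" if f: "f \<in> U" "w \<in> W" for f w
  proof (rule ccontr)
    assume neq: "\<beta> f w \<noteq> (\<Sum>j<n. \<beta> f (b j) * \<beta> (a j) w)"
    define f' where "f' = f - (\<Sum>j<n. scale (\<beta> f (b j)) (a j))"
    define w' where "w' = w - (\<Sum>j<n. scale (\<beta> (a j) w) (b j))"
    have f': "f' \<in> U" unfolding f'_def
      using U(1) f ab by (intro subspace_diff subspace_sum subspace_scale) (auto simp: dual_def)
    have w': "w' \<in> W" unfolding w'_def
      using W f ab by (intro subspace_diff subspace_sum subspace_scale) (auto simp: dual_def)
    have fb: "\<beta> f' (b l) = 0" if "l < n" for l
    proof -
      have "(\<Sum>j<n. \<beta> f (b j) * \<beta> (a j) (b l)) = (\<Sum>j<n. if j = l then \<beta> f (b j) else 0)"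
        using ab that by (intro sum.cong) (auto simp: dual_def)
      then show ?thesis using that by (simp add: f'_def diff1 sum1 scale1)
    qed
    have aw: "\<beta> (a l) w' = 0" if "l < n" for l
    proof -
      have "(\<Sum>j<n. \<beta> (a j) w * \<beta> (a l) (b j)) = (\<Sum>j<n. if j = l then \<beta> (a j) w else 0)"
        using ab that by (intro sum.cong) (auto simp: dual_def)
      then show ?thesis using that by (simp add: w'_def diff2 sum2 scale2)
    qed
    have "\<beta> f' w' = \<beta> f' w"
      using fb by (simp add: w'_def diff2 sum2 scale2)
    also have "\<dots> \<noteq> 0" using neq by (simp add: f'_def diff1 sum1 scale1)
    finally have nz: "\<beta> f' w' \<noteq> 0" .
    define a' where "a' = a(n := f')"
    define b' where "b' = b(n := scale (1 / \<beta> f' w') w')"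
    have "scale (1 / \<beta> f' w') w' \<in> W" using W w' subspace_scale by blast
    then have "dual (Suc n) a' b'"
      using ab f' nz fb aw unfolding dual_def a'_def b'_def
      by (auto simp: less_Suc_eq scale2)
    then show False using maximal[of "Suc n"] by fastforce
  qed
  show ?thesis
    by (rule that[of n a b, OF _ _ _ expand]) (use ab in \<open>simp_all add: dual_def\<close>)
qed

end

text \<open>\<open>D\<close> is the product of the successive pivots and stands in for the
  determinant; at \<open>x0\<close> the matrix is the identity and all pivots are 1. The abstract
  \<open>ev\<close> serves both univariate polynomials and polynomials in the coefficients of a
  linear form.\<close>

lemma open_nonsingular:
  fixes ev :: "'x \<Rightarrow> 'c::comm_ring_1 \<Rightarrow> 'k::field" and M :: "nat \<Rightarrow> nat \<Rightarrow> 'c"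
  assumes mult: "\<And>x f g. ev x (f * g) = ev x f * ev x g"
    and diff: "\<And>x f g. ev x (f - g) = ev x f - ev x g" and one: "\<And>x. ev x 1 = 1"
    and "\<And>j l. j < n \<Longrightarrow> l < n \<Longrightarrow> ev x0 (M j l) = (if j = l then 1 else 0)"
  shows "\<exists>D. ev x0 D = 1 \<and> (\<forall>x c. ev x D \<noteq> 0 \<longrightarrow>
    (\<forall>l<n. (\<Sum>j<n. c j * ev x (M j l)) = 0) \<longrightarrow> (\<forall>j<n. c j = 0))"
  using assms(4)
proof (induction n arbitrary: M)
  case 0
  then show ?case by (intro exI[of _ 1]) (simp add: one)
next
  case (Suc n)
  \<comment> \<open>fraction-free elimination of the last row and column\<close>
  define M' where "M' j l = M n n * M j l - M j n * M n l" for j l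
  have "ev x0 (M' j l) = (if j = l then 1 else 0)" if "j < n" "l < n" for j l
    using that Suc.prems by (simp add: M'_def mult diff)
  from Suc.IH[OF this] obtain D where D: "ev x0 D = 1" and
    D': "\<And>x c. ev x D \<noteq> 0 \<Longrightarrow> (\<forall>l<n. (\<Sum>j<n. c j * ev x (M' j l)) = 0) \<Longrightarrow> \<forall>j<n. c j = 0"
    by blast
  show ?case
  proof (intro exI[of _ "M n n * D"] conjI allI impI)
    show "ev x0 (M n n * D) = 1" using D Suc.prems by (simp add: mult)
  next
    fix x c j assume nz: "ev x (M n n * D) \<noteq> 0"
      and c: "\<forall>l<Suc n. (\<Sum>j<Suc n. c j * ev x (M j l)) = 0" and j: "j < Suc n"
    have "(\<Sum>j<n. c j * ev x (M' j l)) = 0" if "l < n" for l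
    proof -
      have e: "(\<Sum>j<n. c j * ev x (M j k)) = - c n * ev x (M n k)" if "k < Suc n" for k
        using c that by (simp add: eq_neg_iff_add_eq_0)
      have "(\<Sum>j<n. c j * ev x (M' j l)) = ev x (M n n) * (\<Sum>j<n. c j * ev x (M j l))
          - ev x (M n l) * (\<Sum>j<n. c j * ev x (M j n))"
        by (simp add: M'_def mult diff sum_distrib_left sum_subtractf algebra_simps)
      then show ?thesis using e[of l] e[of n] that by simp
    qed
    then have z: "\<forall>j<n. c j = 0" using D'[of x c] nz by (auto simp: mult)
    then have "c n * ev x (M n n) = 0" using c by simp
    then have "c n = 0" using nz by (simp add: mult)
    then show "c j = 0" using z j by (auto simp: less_Suc_eq)
  qed
qed

text \<open>The rank of a bilinear form depending algebraically on a parameter can drop only on a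
  closed set. By \<open>rad\<close> the left radical at \<open>x0\<close> stays inside the one at
  every \<open>s\<close>, so where the rank does not drop the two radicals agree.\<close>

lemma (in vector_space) open_nondegenerate:
  fixes ev :: "'x \<Rightarrow> 'c::comm_ring_1 \<Rightarrow> 'a" and B :: "'b \<Rightarrow> 'b \<Rightarrow> 'c"
  assumes U: "subspace U" "U \<subseteq> span F" "finite F" and W: "subspace W"
    and mult: "\<And>x f g. ev x (f * g) = ev x f * ev x g"
    and diff: "\<And>x f g. ev x (f - g) = ev x f - ev x g" and one: "\<And>x. ev x 1 = 1"
    and add1: "\<And>s x y z. ev s (B (x + y) z) = ev s (B x z) + ev s (B y z)"
    and scale1: "\<And>s c x z. ev s (B (scale c x) z) = c * ev s (B x z)"
    and add2: "\<And>s x y z. ev s (B z (x + y)) = ev s (B z x) + ev s (B z y)"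
    and scale2: "\<And>s c x z. ev s (B z (scale c x)) = c * ev s (B z x)"
    and rad: "\<And>s f w. f \<in> U \<Longrightarrow> (\<And>w. w \<in> W \<Longrightarrow> ev x0 (B f w) = 0) \<Longrightarrow> w \<in> W \<Longrightarrow> ev s (B f w) = 0"
  obtains D where "ev x0 D = 1" "\<And>s f w. ev s D \<noteq> 0 \<Longrightarrow> f \<in> U \<Longrightarrow>
    (\<And>w. w \<in> W \<Longrightarrow> ev s (B f w) = 0) \<Longrightarrow> w \<in> W \<Longrightarrow> ev x0 (B f w) = 0"
proof -
  let ?\<beta> = "\<lambda>s f w. ev s (B f w)"
  have zero1: "?\<beta> s 0 z = 0" for s z using scale1[of s 0 0 z] by simp
  have sum1: "?\<beta> s (sum g A) z = (\<Sum>i\<in>A. ?\<beta> s (g i) z)" for s g z and A :: "nat set"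
    by (induction A rule: infinite_finite_induct) (simp_all add: zero1 add1)
  have diff1: "?\<beta> s (x - y) z = ?\<beta> s x z - ?\<beta> s y z" for s x y z
    using add1[of s "x - y" y z] by simp
  obtain n :: nat and a b where ab: "\<And>j. j < n \<Longrightarrow> a j \<in> U" "\<And>j. j < n \<Longrightarrow> b j \<in> W"
    "\<And>j l. j < n \<Longrightarrow> l < n \<Longrightarrow> ?\<beta> x0 (a j) (b l) = (if j = l then 1 else 0)"
    "\<And>f w. f \<in> U \<Longrightarrow> w \<in> W \<Longrightarrow> ?\<beta> x0 f w = (\<Sum>j<n. ?\<beta> x0 f (b j) * ?\<beta> x0 (a j) w)"
    by (rule dual_bases[of U F W "?\<beta> x0", OF U W add1 scale1 add2 scale2]) (rule that)
  have "\<exists>D. ev x0 D = 1 \<and> (\<forall>x c. ev x D \<noteq> 0 \<longrightarrow>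
      (\<forall>l<n. (\<Sum>j<n. c j * ?\<beta> x (a j) (b l)) = 0) \<longrightarrow> (\<forall>j<n. c j = 0))"
    by (rule open_nonsingular[OF mult diff one]) (rule ab(3))
  then obtain D where D: "ev x0 D = 1" "\<forall>x c. ev x D \<noteq> 0 \<longrightarrow>
      (\<forall>l<n. (\<Sum>j<n. c j * ?\<beta> x (a j) (b l)) = 0) \<longrightarrow> (\<forall>j<n. c j = 0)"
    by (elim exE conjE) (rule that)
  show ?thesis
  proof (rule that[OF D(1)])
    fix s f w assume s: "ev s D \<noteq> 0" "f \<in> U" "\<And>w. w \<in> W \<Longrightarrow> ?\<beta> s f w = 0" and w: "w \<in> W"
    \<comment> \<open>\<open>g\<close> is the part of \<open>f\<close> along the dual system. The
      difference \<open>f - g\<close> is in the radical at \<open>x0\<close>, hence by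
      \<open>rad\<close> at \<open>s\<close>, so \<open>g\<close> is in the radical at
      \<open>s\<close> and its coefficients vanish.\<close>
    define g where "g = (\<Sum>j<n. scale (?\<beta> x0 f (b j)) (a j))"
    have g: "g \<in> U" unfolding g_def
      by (intro subspace_sum subspace_scale U(1) ab(1)) simp
    have 0: "?\<beta> x0 (f - g) w = 0" if "w \<in> W" for w
      using ab(4)[OF s(2) that] by (simp add: diff1 g_def sum1 scale1)
    have "?\<beta> s (f - g) w = 0" if "w \<in> W" for w
      by (rule rad[OF subspace_diff[OF U(1) s(2) g] 0 that])
    then have 1: "?\<beta> s g w = 0" if "w \<in> W" for w
      using that s(3)[OF that] by (simp add: diff1)
    have "\<forall>l<n. (\<Sum>j<n. ?\<beta> x0 f (b j) * ?\<beta> s (a j) (b l)) = 0"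
      using 1[OF ab(2)] by (simp add: g_def sum1 scale1)
    then have "\<forall>j<n. ?\<beta> x0 f (b j) = 0"
      by (rule D(2)[THEN spec, THEN spec, THEN mp, THEN mp, OF s(1)])
    then show "?\<beta> x0 f w = 0" using ab(4)[OF s(2) w] by simp
  qed
qed

section \<open>Free modules of rank two over the polynomial ring in two variables\<close>

text \<open>For \<open>n > 0\<close> these are the binary forms of degree \<open>n - 1\<close> with
  one variable set to 1. The strict bound makes \<open>n\<close> the dimension and lets
  \<open>lowdeg 0\<close> be zero.\<close>

definition lowdeg :: "nat \<Rightarrow> 'k::field poly set"
  where "lowdeg n = {p. \<forall>i\<ge>n. poly.coeff p i = 0}"

lemma lowdeg_zero [simp]: "0 \<in> lowdeg n"
  and lowdeg_add: "p \<in> lowdeg n \<Longrightarrow> q \<in> lowdeg n \<Longrightarrow> p + q \<in> lowdeg n"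
  and lowdeg_diff: "p \<in> lowdeg n \<Longrightarrow> q \<in> lowdeg n \<Longrightarrow> p - q \<in> lowdeg n"
  and lowdeg_uminus: "p \<in> lowdeg n \<Longrightarrow> - p \<in> lowdeg n"
  and lowdeg_smult: "p \<in> lowdeg n \<Longrightarrow> smult c p \<in> lowdeg n"
  and lowdeg_mono: "m \<le> n \<Longrightarrow> p \<in> lowdeg m \<Longrightarrow> p \<in> lowdeg n"
  and lowdeg_0 [simp]: "p \<in> lowdeg 0 \<longleftrightarrow> p = 0"
  by (auto simp: lowdeg_def poly_eq_iff)

lemma lowdeg_pCons [simp]: "pCons a p \<in> lowdeg (Suc n) \<longleftrightarrow> p \<in> lowdeg n"
  unfolding lowdeg_def
  by (auto simp: coeff_pCons split: nat.splits)

lemma lowdeg_Suc: "p \<in> lowdeg n \<Longrightarrow> p \<in> lowdeg (Suc n)"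
  by (rule lowdeg_mono[of n]) simp_all

lemma monom_lowdeg [simp]: "Polynomial.monom 1 i \<in> lowdeg n \<longleftrightarrow> i < n"
  by (auto simp: lowdeg_def not_le[symmetric])

lemma lowdeg_monom_mult: "Polynomial.monom 1 i * p \<in> lowdeg n \<longleftrightarrow> p \<in> lowdeg (n - i)"
proof -
  have *: "poly.coeff (Polynomial.monom 1 i * p) (i + j) = poly.coeff p j" for j
    by (simp add: coeff_monom_mult)
  show ?thesis
  proof
    assume l: "Polynomial.monom 1 i * p \<in> lowdeg n"
    show "p \<in> lowdeg (n - i)"
      unfolding lowdeg_def
    proof (intro CollectI allI impI)
      fix j assume "n - i \<le> j"
      then have "n \<le> i + j" by simp
      then have "poly.coeff (Polynomial.monom 1 i * p) (i + j) = 0" using l by (simp add: lowdeg_def)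
      then show "poly.coeff p j = 0" using * by simp
    qed
  qed (auto simp: lowdeg_def coeff_monom_mult)
qed

section \<open>The free module of rank two and its graded pieces\<close>

definition pmul :: "'k::field poly \<Rightarrow> 'k poly \<times> 'k poly \<Rightarrow> 'k poly \<times> 'k poly"
  where "pmul p u = (p * fst u, p * snd u)"

lemma pmul_simps [simp]:
  "fst (pmul p u) = p * fst u" "snd (pmul p u) = p * snd u"
  "pmul 0 u = 0" "pmul p 0 = 0" "pmul 1 u = u"
  by (simp_all add: pmul_def prod_eq_iff)

lemma pmul_add: "pmul p (u + v) = pmul p u + pmul p v" "pmul (p + q) u = pmul p u + pmul q u"
  and pmul_diff: "pmul p (u - v) = pmul p u - pmul p v" "pmul (p - q) u = pmul p u - pmul q u"
  and pmul_pmul: "pmul p (pmul q u) = pmul (p * q) u"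
  by (simp_all add: prod_eq_iff algebra_simps)

lemma pmul_left_commute: "pmul p (pmul q u) = pmul q (pmul p u)"
  by (simp add: prod_eq_iff)

lemma pmul_eq_0: "pmul p u = 0 \<longleftrightarrow> p = 0 \<or> u = 0"
  by (auto simp: prod_eq_iff)

lemma pmul_cancel: "u \<noteq> 0 \<Longrightarrow> pmul p u = pmul q u \<longleftrightarrow> p = q"
  using pmul_eq_0[of "p - q" u] by (simp add: pmul_diff)

interpretation pairs: vector_space "\<lambda>c. pmul [:c:]"
  by unfold_locales (simp_all add: prod_eq_iff algebra_simps smult_add_left)

abbreviation indet :: "'k::field poly" where "indet \<equiv> Polynomial.monom 1 (Suc 0)"

text \<open>The generators have degrees 0 and 1, so the second coordinate has one coefficient fewer
  than the first.\<close>

definition free_piece :: "nat \<Rightarrow> ('k::field poly \<times> 'k poly) set"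
  where "free_piece m = lowdeg (Suc m) \<times> lowdeg m"

definition multiples :: "nat \<Rightarrow> 'k::field poly \<times> 'k poly \<Rightarrow> ('k poly \<times> 'k poly) set"
  where "multiples d w = (\<lambda>p. pmul p w) ` lowdeg d"

lemma subspace_free: "pairs.subspace (lowdeg m \<times> lowdeg n)"
  by (auto simp: pairs.subspace_def pmul_def zero_prod_def lowdeg_add lowdeg_smult)

lemma subspace_free_piece: "pairs.subspace (free_piece m)"
  unfolding free_piece_def by (rule subspace_free)

lemmas free_piece_zero = pairs.subspace_0[OF subspace_free_piece]
  and free_piece_add = pairs.subspace_add[OF subspace_free_piece]
  and free_piece_diff = pairs.subspace_diff[OF subspace_free_piece]
  and free_piece_scale = pairs.subspace_scale[OF subspace_free_piece]

lemma free_piece_Suc: "s \<in> free_piece m \<Longrightarrow> s \<in> free_piece (Suc m)"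
  and free_piece_indet: "s \<in> free_piece m \<Longrightarrow> pmul indet s \<in> free_piece (Suc m)"
  by (auto simp: free_piece_def mem_Times_iff lowdeg_Suc lowdeg_monom_mult)

lemma subspace_multiples: "pairs.subspace (multiples d w)"
  unfolding pairs.subspace_def multiples_def
proof (intro conjI ballI allI)
  show "0 \<in> (\<lambda>p. pmul p w) ` lowdeg d" by (intro image_eqI[of _ _ 0]) simp_all
next
  fix x y assume "x \<in> (\<lambda>p. pmul p w) ` lowdeg d" "y \<in> (\<lambda>p. pmul p w) ` lowdeg d"
  then show "x + y \<in> (\<lambda>p. pmul p w) ` lowdeg d"
    by (auto simp: pmul_add[symmetric] intro!: imageI lowdeg_add)
next
  fix c x assume "x \<in> (\<lambda>p. pmul p w) ` lowdeg d"
  then show "pmul [:c:] x \<in> (\<lambda>p. pmul p w) ` lowdeg d"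
    by (auto simp: pmul_pmul intro!: imageI lowdeg_smult)
qed

lemma lowdeg_Suc_decomp: "p \<in> lowdeg (Suc d) \<Longrightarrow> p - smult (poly.coeff p d) (Polynomial.monom 1 d) \<in> lowdeg d"
  by (simp add: lowdeg_def Suc_le_eq)

lemma multiplesI: "p \<in> lowdeg d \<Longrightarrow> pmul p w \<in> multiples d w"
  by (simp add: multiples_def)

lemma multiples_0 [simp]: "multiples 0 w = {0}"
  by (auto simp: multiples_def)

lemma multiples_Suc: "multiples (Suc d) w = pairs.span (insert (pmul (Polynomial.monom 1 d) w) (multiples d w))"
proof
  show "multiples (Suc d) w \<subseteq> pairs.span (insert (pmul (Polynomial.monom 1 d) w) (multiples d w))"
  proof
    fix u assume "u \<in> multiples (Suc d) w"
    then obtain p where p: "p \<in> lowdeg (Suc d)" "u = pmul p w" by (auto simp: multiples_def)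
    have "u - pmul [:poly.coeff p d:] (pmul (Polynomial.monom 1 d) w) \<in> multiples d w"
      using lowdeg_Suc_decomp[OF p(1)] p(2)
      by (auto simp: multiples_def pmul_pmul pmul_diff[symmetric])
    then have "u - pmul [:poly.coeff p d:] (pmul (Polynomial.monom 1 d) w) \<in> pairs.span (multiples d w)"
      by (rule pairs.span_base)
    then show "u \<in> pairs.span (insert (pmul (Polynomial.monom 1 d) w) (multiples d w))"
      unfolding pairs.span_breakdown_eq by (rule exI)
  qed
next
  have "insert (pmul (Polynomial.monom 1 d) w) (multiples d w) \<subseteq> multiples (Suc d) w"
    using multiplesI[of "Polynomial.monom 1 d" "Suc d" w] by (auto simp: multiples_def lowdeg_Suc)
  then show "pairs.span (insert (pmul (Polynomial.monom 1 d) w) (multiples d w)) \<subseteq> multiples (Suc d) w"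
    by (rule pairs.span_minimal[OF _ subspace_multiples])
qed

lemma multiples_fd: "\<exists>F. finite F \<and> multiples d w \<subseteq> pairs.span F"
proof (induction d)
  case 0
  then show ?case by (intro exI[of _ "{}"]) (auto simp: multiples_def)
next
  case (Suc d)
  then obtain F where F: "finite F" "multiples d w \<subseteq> pairs.span F" by blast
  have "insert (pmul (Polynomial.monom 1 d) w) (multiples d w) \<subseteq> pairs.span (insert (pmul (Polynomial.monom 1 d) w) F)"
    using F(2) pairs.span_mono[of F "insert (pmul (Polynomial.monom 1 d) w) F"] by (auto intro: pairs.span_base)
  then have "multiples (Suc d) w \<subseteq> pairs.span (insert (pmul (Polynomial.monom 1 d) w) F)"
    unfolding multiples_Suc by (rule pairs.span_minimal) simp
  with F(1) show ?case by blast
qed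

lemma dim_multiples:
  assumes "w \<noteq> 0"
  shows "pairs.dim (multiples d w) = d"
proof (induction d)
  case 0
  have "multiples 0 w \<subseteq> pairs.span {}" by (auto simp: multiples_def)
  then have "pairs.dim (multiples 0 w) \<le> card ({} :: ('a poly \<times> 'a poly) set)"
    by (rule pairs.dim_le_card) simp
  then show ?case by simp
next
  case (Suc d)
  obtain F where F: "finite F" "multiples d w \<subseteq> pairs.span F" using multiples_fd by blast
  have "pmul (Polynomial.monom 1 d) w \<notin> multiples d w"
    using pmul_cancel[OF assms] by (auto simp: multiples_def)
  then show ?case
    using pairs.dim_span_insert_fd[OF subspace_multiples F(2,1)] Suc unfolding multiples_Suc by simp
qed

lemma free_fd: "\<exists>F. finite F \<and> lowdeg m \<times> lowdeg n \<subseteq> pairs.span (F :: ('k::field poly \<times> 'k poly) set)"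
proof -
  obtain F G :: "('k poly \<times> 'k poly) set" where F: "finite F" "multiples m (1, 0) \<subseteq> pairs.span F"
    and G: "finite G" "multiples n (0, 1) \<subseteq> pairs.span G"
    using multiples_fd by metis
  have "lowdeg m \<times> lowdeg n \<subseteq> pairs.span (F \<union> G)"
  proof
    fix u :: "'k poly \<times> 'k poly" assume "u \<in> lowdeg m \<times> lowdeg n"
    then have "pmul (fst u) (1, 0) \<in> pairs.span F" "pmul (snd u) (0, 1) \<in> pairs.span G"
      using F(2) G(2) by (auto simp: multiples_def)
    then have "pmul (fst u) (1, 0) + pmul (snd u) (0, 1) \<in> pairs.span (F \<union> G)"
      using pairs.span_mono[of F "F \<union> G"] pairs.span_mono[of G "F \<union> G"]
      by (intro pairs.span_add) auto
    then show "u \<in> pairs.span (F \<union> G)" by (simp add: pmul_def)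
  qed
  then show ?thesis using F(1) G(1) by blast
qed

lemma free_piece_fd:
  obtains F where "finite F" "free_piece m \<subseteq> pairs.span F"
  using free_fd unfolding free_piece_def by metis

lemma dim_free_piece_Suc:
  "pairs.dim (free_piece m :: ('a::field poly \<times> 'a poly) set) + 2
    \<le> pairs.dim (free_piece (Suc m) :: ('a poly \<times> 'a poly) set)"
proof -
  let ?V = "lowdeg (Suc (Suc m)) \<times> lowdeg m :: ('a poly \<times> 'a poly) set"
  obtain F :: "('a poly \<times> 'a poly) set" where F: "finite F" "free_piece (Suc m) \<subseteq> pairs.span F"
    by (rule free_piece_fd)
  have sub: "free_piece m \<subseteq> ?V" "?V \<subseteq> free_piece (Suc m)"
    by (auto simp: free_piece_def lowdeg_Suc)
  have VF: "?V \<subseteq> pairs.span F" using sub(2) F(2) by blast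
  have "pairs.dim (free_piece m :: ('a poly \<times> 'a poly) set) < pairs.dim ?V"
    using pairs.dim_less_fd[OF subspace_free_piece sub(1) subspace_free VF F(1),
        of "(Polynomial.monom 1 (Suc m), 0)"] by (simp add: free_piece_def)
  moreover have "pairs.dim ?V < pairs.dim (free_piece (Suc m) :: ('a poly \<times> 'a poly) set)"
    using pairs.dim_less_fd[OF subspace_free sub(2) subspace_free_piece F(2,1),
        of "(0, Polynomial.monom 1 m)"] by (simp add: free_piece_def)
  ultimately show ?thesis by linarith
qed

text \<open>
  Graded pieces of the free module over \<open>k[x,y]\<close> are dehomogenised at \<open>y = 1\<close>, so that
  multiplication by \<open>y\<close> becomes an inclusion. If the piece \<open>T\<close> and the next piece
  \<open>T + xT\<close> differ by one dimension, \<open>T\<close> is cyclic; the induction passes to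
  \<open>{c. c \<in> T \<and> xc \<in> T}\<close>.
\<close>

lemma slow_growth_imp_cyclic:
  assumes "pairs.subspace T" "T \<subseteq> free_piece m" "T \<noteq> {0}"
    and "\<forall>c\<in>T. pmul indet c \<in> pairs.span (insert y T)"
  shows "\<exists>w. w \<noteq> 0 \<and> T = multiples (pairs.dim T) w"
  using assms
proof (induction "pairs.dim T" arbitrary: T y rule: less_induct)
  case less
  obtain F :: "('a poly \<times> 'a poly) set" where F: "finite F" "free_piece m \<subseteq> pairs.span F"
    by (rule free_piece_fd)
  have TF: "T \<subseteq> pairs.span F" using less.prems(2) F(2) by simp
  define T1 where "T1 = {c \<in> T. pmul indet c \<in> T}"
  have sub1: "pairs.subspace T1"
    using less.prems(1) unfolding T1_def pairs.subspace_def
    by (simp add: pmul_add pmul_left_commute[of indet])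
  have zero: "0 \<in> T" using less.prems(1) pairs.subspace_0 by blast
  \<comment> \<open>Otherwise \<open>T\<close> would be stable under multiplication by the
    indeterminate, and high powers would push a nonzero element out of
    \<open>free_piece m\<close>.\<close>
  have "T1 \<noteq> T"
  proof
    assume eq: "T1 = T"
    obtain u where u: "u \<in> T" "u \<noteq> 0" using less.prems(3) zero by blast
    have "pmul (Polynomial.monom 1 n) u \<in> T" for n
    proof (induction n)
      case (Suc n)
      then have "pmul indet (pmul (Polynomial.monom 1 n) u) \<in> T" using eq T1_def by blast
      then show ?case by (simp add: pmul_pmul mult_monom)
    qed (use u in simp)
    then have "Polynomial.monom 1 (Suc m) * fst u \<in> lowdeg (Suc m)" "Polynomial.monom 1 (Suc m) * snd u \<in> lowdeg m"
      using less.prems(2) by (auto simp: free_piece_def pmul_def)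
    then show False using u(2) by (simp add: lowdeg_monom_mult prod_eq_iff)
  qed
  then obtain c0 where c0: "c0 \<in> T" "pmul indet c0 \<notin> T" by (auto simp: T1_def)
  \<comment> \<open>Modulo \<open>T\<close> all products with the indeterminate lie on the line of
    \<open>y\<close>, and that of \<open>c0\<close> spans this line. Subtracting a multiple of
    \<open>c0\<close> therefore moves \<open>c\<close> into \<open>T1\<close>, which has codimension
    one in \<open>T\<close>.\<close>
  have step: "\<exists>a. c - pmul [:a:] c0 \<in> T1" if c: "c \<in> T" for c
  proof -
    obtain a where a: "pmul indet c0 - pmul [:a:] y \<in> T"
      using less.prems(1,4) c0(1) pairs.span_eq_iff unfolding pairs.span_breakdown_eq by metis
    have a0: "a \<noteq> 0" using a c0(2) by auto
    obtain b where b: "pmul indet c - pmul [:b:] y \<in> T"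
      using less.prems(1,4) c pairs.span_eq_iff unfolding pairs.span_breakdown_eq by metis
    have "pmul indet c - pmul [:b:] y - pmul [:b / a:] (pmul indet c0 - pmul [:a:] y) \<in> T"
      using a b less.prems(1) pairs.subspace_diff pairs.subspace_scale by blast
    also have "pmul indet c - pmul [:b:] y - pmul [:b / a:] (pmul indet c0 - pmul [:a:] y)
        = pmul indet (c - pmul [:b / a:] c0)"
      using a0 by (simp add: prod_eq_iff algebra_simps)
    finally have "pmul indet (c - pmul [:b / a:] c0) \<in> T" .
    moreover have "c - pmul [:b / a:] c0 \<in> T"
      using c c0(1) less.prems(1) pairs.subspace_diff pairs.subspace_scale by blast
    ultimately show ?thesis by (auto simp: T1_def)
  qed
  have T1T: "T1 \<subseteq> T" by (auto simp: T1_def)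
  have c0T1: "c0 \<notin> T1" using c0(2) by (auto simp: T1_def)
  have T: "T = pairs.span (insert c0 T1)"
  proof
    show "T \<subseteq> pairs.span (insert c0 T1)"
      using step pairs.span_base[of _ T1] unfolding pairs.span_breakdown_eq subset_iff by blast
    show "pairs.span (insert c0 T1) \<subseteq> T"
      using T1T c0(1) less.prems(1) by (intro pairs.span_minimal) auto
  qed
  have T1F: "T1 \<subseteq> pairs.span F" using T1T TF by blast
  have dim: "pairs.dim T = Suc (pairs.dim T1)"
    using pairs.dim_span_insert_fd[OF sub1 T1F F(1) c0T1] T by simp
  show ?case
  proof (cases "T1 = {0}")
    case True
    have c0n0: "c0 \<noteq> 0" using c0T1 True by simp
    have "pairs.dim T1 \<le> card ({} :: ('a poly \<times> 'a poly) set)"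
      using True by (intro pairs.dim_le_card) auto
    then have d: "pairs.dim T = Suc 0" using dim by simp
    have "pairs.span (insert c0 T1) = multiples (Suc 0) c0"
      unfolding multiples_Suc True by simp
    then have "T = multiples (pairs.dim T) c0" unfolding d T[symmetric] .
    with c0n0 show ?thesis by blast
  next
    case False
    \<comment> \<open>In the induction \<open>c0\<close> takes over the role of \<open>y\<close>:
      products of elements of \<open>T1\<close> with the indeterminate lie in \<open>T\<close>,
      which is \<open>T1\<close> extended by \<open>c0\<close>.\<close>
    have "\<forall>c\<in>T1. pmul indet c \<in> pairs.span (insert c0 T1)"
      unfolding T[symmetric] by (auto simp: T1_def)
    then have "\<exists>w. w \<noteq> 0 \<and> T1 = multiples (pairs.dim T1) w"
      by (intro less.hyps[OF _ sub1 order_trans[OF T1T less.prems(2)] False]) (simp add: dim)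
    then obtain w where w: "w \<noteq> 0" "T1 = multiples (pairs.dim T1) w" by blast
    let ?d = "pairs.dim T1"
    have T1: "multiples ?d w = T1" using w(2) by (rule sym)
    have "?d \<noteq> 0"
    proof
      assume "?d = 0"
      then show False using T1 False by simp
    qed
    then obtain d where d: "?d = Suc d" using not0_implies_Suc by blast
    \<comment> \<open>The last of the multiples in \<open>T1\<close> may be multiplied once more by
      the indeterminate without leaving \<open>T\<close>. This gives one more multiple of
      \<open>w\<close> than \<open>T1\<close> has, which fills the dimension of
      \<open>T\<close>.\<close>
    have "pmul (Polynomial.monom 1 d) w \<in> multiples ?d w"
      unfolding d by (rule multiplesI) simp
    then have "pmul (Polynomial.monom 1 d) w \<in> T1" unfolding T1 .
    then have "pmul indet (pmul (Polynomial.monom 1 d) w) \<in> T" by (simp add: T1_def)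
    then have "pmul (Polynomial.monom 1 ?d) w \<in> T" by (simp add: pmul_pmul mult_monom d)
    then have sub: "multiples (Suc ?d) w \<subseteq> T"
      unfolding multiples_Suc T1 using T1T less.prems(1) by (intro pairs.span_minimal) auto
    have "pairs.dim T \<le> pairs.dim (multiples (Suc ?d) w)"
      unfolding dim dim_multiples[OF w(1)] ..
    then have "multiples (Suc ?d) w = T"
      by (rule pairs.subspace_eq_fd[OF subspace_multiples sub less.prems(1) TF F(1)])
    then have "T = multiples (pairs.dim T) w" unfolding dim by (rule sym)
    with w(1) show ?thesis by blast
  qed
qed

text \<open>Vanishing of all 2 by 2 minors: the submodule generated by \<open>T\<close> has rank at
  most one.\<close>

definition rank_one :: "('k::field poly \<times> 'k poly) set \<Rightarrow> bool"
  where "rank_one T \<longleftrightarrow> (\<forall>u\<in>T. \<forall>v\<in>T. fst u * snd v = fst v * snd u)"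

text \<open>Given some \<open>u\<close> in \<open>T\<close> with nonzero first coordinate,
  proportionality makes first coordinates determine the elements of \<open>T\<close>; otherwise
  second coordinates do. The bound then counts coefficients.\<close>

lemma dim_rank_one_le:
  assumes T: "pairs.subspace T" "T \<subseteq> free_piece m" "rank_one T"
  shows "pairs.dim T \<le> Suc m"
proof -
  obtain F :: "('a poly \<times> 'a poly) set" where F: "finite F" "free_piece m \<subseteq> pairs.span F"
    by (rule free_piece_fd)
  have TF: "T \<subseteq> pairs.span F" using T(2) F(2) by simp
  have dim0: "pairs.dim {0 :: 'a poly \<times> 'a poly} = 0"
    using pairs.dim_le_card[of "{0}" "{}"] by simp
  show ?thesis
  proof (cases "\<exists>u\<in>T. fst u \<noteq> 0")
    case True
    then obtain u where u: "u \<in> T" "fst u \<noteq> 0" by blast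
    have "v = 0" if "v \<in> T" "\<forall>i\<in>{..m}. poly.coeff (fst v) i = 0" for v
    proof -
      have "fst v = 0"
        using that T(2) by (force simp: poly_eq_iff free_piece_def lowdeg_def Suc_le_eq not_le[symmetric])
      moreover have "fst u * snd v = fst v * snd u"
        using T(3) u(1) that(1) by (auto simp: rank_one_def)
      ultimately show ?thesis using u(2) by (simp add: prod_eq_iff)
    qed
    then have "{v \<in> T. \<forall>i\<in>{..m}. poly.coeff (fst v) i = 0} = {0}"
      using pairs.subspace_0[OF T(1)] by auto
    then show ?thesis
      using pairs.dim_common_kernel[OF T(1) TF F(1), of "{..m}" "\<lambda>i v. poly.coeff (fst v) i"] dim0
      by simp
  next
    case False
    have "v = 0" if "v \<in> T" "\<forall>i\<in>{..<m}. poly.coeff (snd v) i = 0" for v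
    proof -
      have "snd v = 0"
        using that T(2) by (force simp: poly_eq_iff free_piece_def lowdeg_def not_le[symmetric])
      then show ?thesis using False that(1) by (simp add: prod_eq_iff)
    qed
    then have "{v \<in> T. \<forall>i\<in>{..<m}. poly.coeff (snd v) i = 0} = {0}"
      using pairs.subspace_0[OF T(1)] by auto
    then show ?thesis
      using pairs.dim_common_kernel[OF T(1) TF F(1), of "{..<m}" "\<lambda>i v. poly.coeff (snd v) i"] dim0
      by simp
  qed
qed

text \<open>With \<open>\<eta>\<close> set to 1 and \<open>T\<close> a subspace, this is the space
  of sums of products of \<open>T\<close> with linear forms in \<open>\<xi>\<close> and
  \<open>\<eta>\<close>; iterating it \<open>i\<close> times gives \<open>P\<^sub>i T\<close> of the
  overview.\<close>

definition shift :: "('k::field poly \<times> 'k poly) set \<Rightarrow> ('k poly \<times> 'k poly) set"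
  where "shift T = {a + pmul indet b | a b. a \<in> T \<and> b \<in> T}"

lemma subspace_shift:
  assumes "pairs.subspace T"
  shows "pairs.subspace (shift T)"
proof -
  have "pairs.subspace (pmul indet ` T)"
    unfolding pairs.subspace_def
  proof (intro conjI ballI allI)
    show "0 \<in> pmul indet ` T" using pairs.subspace_0[OF assms] by (intro image_eqI[of _ _ 0]) simp_all
  next
    fix x y assume "x \<in> pmul indet ` T" "y \<in> pmul indet ` T"
    then show "x + y \<in> pmul indet ` T"
      using pairs.subspace_add[OF assms] by (auto simp: pmul_add[symmetric])
  next
    fix c x assume "x \<in> pmul indet ` T"
    then obtain z where z: "z \<in> T" "x = pmul indet z" by blast
    then have "pmul [:c:] x = pmul indet (pmul [:c:] z)" by (simp add: pmul_pmul mult.commute)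
    then show "pmul [:c:] x \<in> pmul indet ` T" using pairs.subspace_scale[OF assms] z by blast
  qed
  from pairs.subspace_sums[OF assms this] show ?thesis
    unfolding shift_def by (rule back_subst[of pairs.subspace]) blast
qed

lemma subset_shift: "pairs.subspace T \<Longrightarrow> T \<subseteq> shift T"
proof
  fix a assume "pairs.subspace T" "a \<in> T"
  then have "a = a + pmul indet 0" "0 \<in> T" by (simp_all add: pairs.subspace_0)
  then show "a \<in> shift T" using \<open>a \<in> T\<close> unfolding shift_def by blast
qed

lemma indet_shift:
  assumes "pairs.subspace T" "b \<in> T"
  shows "pmul indet b \<in> shift T"
proof -
  have "pmul indet b = 0 + pmul indet b" "0 \<in> T" using assms by (simp_all add: pairs.subspace_0)
  then show ?thesis using assms(2) unfolding shift_def by blast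
qed

lemma shift_free_piece:
  assumes "T \<subseteq> free_piece m"
  shows "shift T \<subseteq> free_piece (Suc m)"
proof
  fix u assume "u \<in> shift T"
  then obtain a b where ab: "a \<in> T" "b \<in> T" "u = a + pmul indet b" by (auto simp: shift_def)
  then have "a \<in> free_piece m" "b \<in> free_piece m" using assms by auto
  then show "u \<in> free_piece (Suc m)"
    by (simp add: ab(3) free_piece_def mem_Times_iff lowdeg_add lowdeg_Suc lowdeg_monom_mult)
qed

lemma rank_one_shift:
  assumes "rank_one T"
  shows "rank_one (shift T)"
proof -
  have swap: "fst (a + pmul indet b) * snd (c + pmul indet d) = fst (c + pmul indet d) * snd (a + pmul indet b)"
    if "a \<in> T" "b \<in> T" "c \<in> T" "d \<in> T" for a b c d
  proof -
    have *: "fst a * snd c = fst c * snd a" "fst a * snd d = fst d * snd a"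
      "fst b * snd c = fst c * snd b" "fst b * snd d = fst d * snd b"
      using assms that by (simp_all add: rank_one_def)
    have "fst (a + pmul indet b) * snd (c + pmul indet d) = fst a * snd c
        + indet * (fst a * snd d + fst b * snd c) + indet * indet * (fst b * snd d)"
      by (simp add: algebra_simps)
    also have "\<dots> = fst (c + pmul indet d) * snd (a + pmul indet b)"
      unfolding * by (simp add: algebra_simps)
    finally show ?thesis .
  qed
  show ?thesis
    unfolding rank_one_def
  proof (intro ballI)
    fix u v assume "u \<in> shift T" "v \<in> shift T"
    then obtain a b c d where "a \<in> T" "b \<in> T" "u = a + pmul indet b"
      "c \<in> T" "d \<in> T" "v = c + pmul indet d" by (auto simp: shift_def)
    then show "fst u * snd v = fst v * snd u" using swap by blast
  qed
qed

text \<open>No single \<open>y\<close> suffices: trying \<open>y = 0\<close> yields a product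
  outside \<open>T\<close>, and trying that product as \<open>y\<close> yields a second one,
  independent of it modulo \<open>T\<close>.\<close>

lemma dim_shift:
  assumes T: "pairs.subspace T" "T \<subseteq> free_piece m"
    and fast: "\<nexists>y. \<forall>c\<in>T. pmul indet c \<in> pairs.span (insert y T)"
  shows "pairs.dim T + 2 \<le> pairs.dim (shift T)"
proof -
  obtain F :: "('a poly \<times> 'a poly) set" where F: "finite F" "free_piece (Suc m) \<subseteq> pairs.span F"
    by (rule free_piece_fd)
  have sF: "shift T \<subseteq> pairs.span F" using shift_free_piece[OF T(2)] F(2) by blast
  obtain c where c: "c \<in> T" "pmul indet c \<notin> T"
  proof -
    have "\<exists>c\<in>T. pmul indet c \<notin> pairs.span (insert 0 T)" using fast by blast
    then obtain c where "c \<in> T" "pmul indet c \<notin> pairs.span T" by auto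
    then show ?thesis by (intro that[of c]) (auto intro: pairs.span_base)
  qed
  obtain c' where c': "c' \<in> T" "pmul indet c' \<notin> pairs.span (insert (pmul indet c) T)"
    using fast by blast
  let ?V = "pairs.span (insert (pmul indet c) T)"
  have V: "?V \<subseteq> shift T"
    using subset_shift[OF T(1)] indet_shift[OF T(1) c(1)] subspace_shift[OF T(1)]
    by (intro pairs.span_minimal) auto
  have "pairs.dim ?V < pairs.dim (shift T)"
    by (rule pairs.dim_less_fd[OF _ V subspace_shift[OF T(1)] sF F(1) indet_shift[OF T(1) c'(1)] c'(2)]) simp
  moreover have "pairs.dim ?V = Suc (pairs.dim T)"
    by (rule pairs.dim_span_insert_fd[OF T(1) _ F(1) c(2)]) (use subset_shift[OF T(1)] sF in blast)
  ultimately show ?thesis by linarith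
qed

text \<open>As long as growth is fast, each shift adds at least two dimensions, whereas rank one
  allows at most \<open>t + 2 + i\<close> dimensions after \<open>i\<close> shifts. So growth is
  slow at some first \<open>i\<close>, and \<open>slow_growth_imp_cyclic\<close> supplies the
  generator \<open>w\<close>.\<close>

lemma rank_one_structure:
  assumes T: "pairs.subspace T" "T \<subseteq> free_piece (Suc t)" "rank_one T" "n + 2 \<le> pairs.dim T"
  obtains i w j where "w \<noteq> 0" "w \<in> free_piece j" "j + n + i \<le> t"
    "(shift ^^ i) T = multiples (t + 2 + i - j) w" "T \<subseteq> multiples (t + 2 - j) w"
    "pairs.dim T + 2 * i \<le> t + 2 + i - j"
proof -
  let ?T = "\<lambda>i. (shift ^^ i) T"
  have sub: "pairs.subspace (?T i)" for i by (induction i) (auto simp: T subspace_shift)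
  have piece: "?T i \<subseteq> free_piece (Suc t + i)" for i
    by (induction i) (auto simp: T dest: shift_free_piece)
  have rank: "rank_one (?T i)" for i by (induction i) (auto simp: T rank_one_shift)
  have bound: "pairs.dim (?T i) \<le> t + 2 + i" for i
    using dim_rank_one_le[OF sub piece rank, of i] by simp
  define slow where "slow i \<longleftrightarrow> (\<exists>y. \<forall>c\<in>?T i. pmul indet c \<in> pairs.span (insert y (?T i)))" for i
  have fast: "pairs.dim T + 2 * i \<le> pairs.dim (?T i)" if "\<forall>k<i. \<not> slow k" for i
    using that
  proof (induction i)
    case (Suc i)
    have "pairs.dim (?T i) + 2 \<le> pairs.dim (?T (Suc i))"
      using dim_shift[OF sub piece, of i] Suc.prems by (auto simp: slow_def)
    then show ?case using Suc by simp
  qed simp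
  have "\<exists>i. slow i"
  proof (rule ccontr)
    assume "\<nexists>i. slow i"
    then show False using fast[of "t + 3"] bound[of "t + 3"] by simp
  qed
  then obtain i where i: "slow i" "\<forall>k<i. \<not> slow k"
    using exists_least_iff[of slow] by blast
  let ?d = "pairs.dim (?T i)"
  have d: "pairs.dim T + 2 * i \<le> ?d" "?d \<le> t + 2 + i" using fast i(2) bound by auto
  have "?T i \<noteq> {0}"
  proof
    assume *: "?T i = {0}"
    have "pairs.dim (?T i) = 0" unfolding * using pairs.dim_le_card[of "{0}" "{}"] by simp
    then show False using d T(4) by simp
  qed
  then obtain w where w: "w \<noteq> 0" "?T i = multiples ?d w"
    using slow_growth_imp_cyclic[OF sub piece, of i] i(1) unfolding slow_def by blast
  \<comment> \<open>\<open>j\<close> is the degree of \<open>w\<close>: the piece has degree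
    \<open>Suc t + i\<close> and its multipliers go up to degree \<open>?d - 1\<close>.\<close>
  define j where "j = t + 2 + i - ?d"
  have j: "?d = t + 2 + i - j" "j + n + i \<le> t" using d T(4) by (auto simp: j_def)
  have "pmul (Polynomial.monom 1 (?d - 1)) w \<in> ?T i"
    using d T(4) by (subst w(2)) (auto simp: multiples_def)
  then have "pmul (Polynomial.monom 1 (?d - 1)) w \<in> free_piece (Suc t + i)" using piece by blast
  then have "fst w \<in> lowdeg (Suc (Suc t + i) - (?d - 1))" "snd w \<in> lowdeg (Suc t + i - (?d - 1))"
    by (simp_all only: free_piece_def lowdeg_monom_mult mem_Times_iff pmul_simps)
  moreover have "Suc (Suc t + i) - (?d - 1) = Suc j" "Suc t + i - (?d - 1) = j"
    using d T(4) by (simp_all add: j_def)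
  ultimately have wj: "w \<in> free_piece j" by (simp add: free_piece_def mem_Times_iff)
  have "T \<subseteq> multiples (t + 2 - j) w"
  proof
    fix s assume s: "s \<in> T"
    have mono: "T \<subseteq> ?T k" for k 
    proof (induction k)
      case (Suc k)
      then show ?case using subset_shift[OF sub, of k] by simp
    qed simp
    have "s \<in> multiples ?d w" using mono[of i] s unfolding w(2)[symmetric] by blast
    then obtain p where p: "s = pmul p w" by (auto simp: multiples_def)
    \<comment> \<open>Multiplying \<open>s = pmul p w\<close> by the \<open>i\<close>-th power of
      the indeterminate lands in the same cyclic piece, so the degree bound on \<open>p\<close>
      improves by \<open>i\<close>.\<close>
    have "pmul (Polynomial.monom 1 k) s \<in> ?T k" for k
    proof (induction k)
      case (Suc k)
      have "pmul indet (pmul (Polynomial.monom 1 k) s) \<in> ?T (Suc k)" using indet_shift[OF sub Suc] by simp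
      then show ?case by (simp add: pmul_pmul mult_monom)
    qed (use s in simp)
    then have "pmul (Polynomial.monom 1 i) s \<in> multiples ?d w" unfolding w(2)[symmetric] .
    then obtain p' where p': "p' \<in> lowdeg ?d" "pmul (Polynomial.monom 1 i) s = pmul p' w"
      by (auto simp: multiples_def)
    have "Polynomial.monom 1 i * p = p'" using p p'(2) pmul_cancel[OF w(1)] by (simp add: pmul_pmul)
    then have "p \<in> lowdeg (?d - i)" using p'(1) lowdeg_monom_mult by blast
    moreover have "?d - i = t + 2 - j" using j by linarith
    ultimately show "s \<in> multiples (t + 2 - j) w" using p by (auto simp: multiples_def)
  qed
  then show ?thesis
    by (rule that[OF w(1) wj j(2) w(2)[unfolded j(1)] _ d(1)[unfolded j(1)]])
qed

section \<open>Forms\<close>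

declare lookup_eq_zero_in_keys_contradict [rule del]

abbreviation "lookup \<equiv> Poly_Mapping.lookup"
abbreviation "keys \<equiv> Poly_Mapping.keys"

abbreviation var :: "'v \<Rightarrow> ('v, 'k::field) mpol"
  where "var v \<equiv> Poly_Mapping.single (Poly_Mapping.single v 1) 1"

lemma const_add: "const (a + b) = const a + const b"
  and const_mult: "const (a * b) = const a * const b"
  and const_diff: "const (a - b) = const a - const b"
  and const_uminus: "const (- a) = - const a"
  and const_0 [simp]: "const 0 = 0"
  and const_1 [simp]: "const 1 = 1"
  by (simp_all add: const_def single_add mult_single single_diff single_uminus)

lemma lookup_const_mult: "lookup (const c * f) m = c * lookup f m"
  unfolding const_def mult_map_scale_conv_mult[symmetric] by (simp add: map.rep_eq when_def)

interpretation mpol: vector_space "\<lambda>c f :: ('v, 'k::field) mpol. const c * f"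
  by unfold_locales (simp_all add: algebra_simps const_add const_mult)

lemma sum_single_lookup: "(\<Sum>m\<in>keys f. Poly_Mapping.single m (lookup f m)) = f"
proof (rule poly_mapping_eqI)
  fix m
  have "(\<Sum>k\<in>keys f. lookup (Poly_Mapping.single k (lookup f k)) m)
      = (\<Sum>k\<in>keys f. if k = m then lookup f m else 0)"
    by (intro sum.cong) (auto simp: lookup_single when_def)
  then show "lookup (\<Sum>m\<in>keys f. Poly_Mapping.single m (lookup f m)) m = lookup f m"
    by (simp add: lookup_sum in_keys_iff)
qed

text \<open>Restricting \<open>single\<close> to monomials occurring in \<open>f\<close> lets
  homogeneity of \<open>f\<close> be used in that case.\<close>

lemma mpol_induct [case_names zero single add]:
  fixes f :: "'a \<Rightarrow>\<^sub>0 'b::comm_monoid_add"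
  assumes "P 0" "\<And>m c. m \<in> keys f \<Longrightarrow> P (Poly_Mapping.single m c)" "\<And>f g. P f \<Longrightarrow> P g \<Longrightarrow> P (f + g)"
  shows "P f"
proof -
  have "P (\<Sum>m\<in>A. Poly_Mapping.single m (lookup f m))" if "A \<subseteq> keys f" for A
    using finite_subset[OF that finite_keys] that
    by (induction A rule: finite_induct) (auto intro: assms)
  from this[OF order_refl] show ?thesis by (simp add: sum_single_lookup)
qed

section \<open>Degrees of monomials and spaces of forms\<close>

lemma mon_degree_add: "mon_degree (m + n) = mon_degree m + mon_degree n"
  by (simp add: mon_degree_def lookup_add sum.distrib)

lemma mon_degree_single [simp]: "mon_degree (Poly_Mapping.single v n) = n"
  by (simp add: mon_degree_def lookup_single when_def)

lemma mon_degree_0 [simp]: "mon_degree 0 = 0"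
  by (simp add: mon_degree_def)

lemma mon_degree_eq_0: "mon_degree m = 0 \<longleftrightarrow> m = 0"
  by (auto simp: mon_degree_def poly_mapping_eq_iff fun_eq_iff)

lemma forms_0 [simp]: "0 \<in> forms d"
  and forms_add: "f \<in> forms d \<Longrightarrow> g \<in> forms d \<Longrightarrow> f + g \<in> forms d"
  and forms_const_mult: "f \<in> forms d \<Longrightarrow> const c * f \<in> forms d"
  and forms_uminus: "f \<in> forms d \<Longrightarrow> - f \<in> forms d"
  using keys_add[of f g] by (auto simp: forms_def in_keys_iff lookup_const_mult)

lemma forms_diff: "f \<in> forms d \<Longrightarrow> g \<in> forms d \<Longrightarrow> f - g \<in> forms d"
  using forms_add[of f d "- g"] forms_uminus[of g d] by simp

lemma forms_mult:
  assumes "f \<in> forms d" "g \<in> forms e"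
  shows "f * g \<in> forms (d + e)"
  unfolding forms_def
proof (intro CollectI ballI)
  fix m assume "m \<in> keys (f * g)"
  then obtain a b where "a \<in> keys f" "b \<in> keys g" "m = a + b" using keys_mult[of f g] by blast
  then show "mon_degree m = d + e" using assms by (simp add: forms_def mon_degree_add)
qed

lemma forms_single: "mon_degree m = d \<Longrightarrow> Poly_Mapping.single m c \<in> forms d"
  by (auto simp: forms_def)

lemma forms_const: "const c \<in> forms 0"
  unfolding const_def by (rule forms_single) simp

lemma forms_1: "1 \<in> forms 0"
  using forms_const[of 1] by simp

lemma forms_var: "var v \<in> forms 1"
  by (rule forms_single) simp

lemma forms_var_mult: "f \<in> forms d \<Longrightarrow> var v * f \<in> forms (Suc d)"
  using forms_mult[OF forms_var, of f d v] by simp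

lemma forms_0_const: "f \<in> forms 0 \<Longrightarrow> f = const (lookup f 0)"
  by (rule poly_mapping_eqI)
    (auto simp: forms_def const_def lookup_single when_def mon_degree_eq_0 in_keys_iff)

text \<open>A monomial of positive degree contains some variable \<open>v\<close>, which can be
  split off. Claims about forms of degree \<open>Suc d\<close> thereby reduce to products with a
  variable.\<close>

lemma forms_Suc_induct [consumes 1, case_names zero var_mult add]:
  assumes "f \<in> forms (Suc d)" "P 0" "\<And>v g. g \<in> forms d \<Longrightarrow> P (var v * g)"
    "\<And>f g. P f \<Longrightarrow> P g \<Longrightarrow> P (f + g)"
  shows "P f"
proof (induction f rule: mpol_induct)
  case (single m c)
  then have deg: "mon_degree m = Suc d" using assms(1) by (auto simp: forms_def)
  then have "m \<noteq> 0" by auto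
  then obtain v where v: "lookup m v \<noteq> 0" by (auto simp: poly_mapping_eq_iff fun_eq_iff)
  define n where "n = m - Poly_Mapping.single v 1"
  have m: "m = Poly_Mapping.single v 1 + n"
    by (rule poly_mapping_eqI) (use v in \<open>auto simp: n_def lookup_add lookup_minus lookup_single when_def\<close>)
  have "mon_degree n = d" using deg by (simp add: m mon_degree_add)
  then have "P (var v * Poly_Mapping.single n c)" by (intro assms(3) forms_single)
  then show ?case by (simp add: m mult_single)
qed (use assms in auto)

lemma subspace_forms: "mpol.subspace (forms d)"
  by (auto simp: mpol.subspace_def forms_add forms_const_mult)

lemma forms_fd:
  obtains F :: "('v::finite, 'k::field) mpol set" where "finite F" "forms d \<subseteq> mpol.span F"
proof -
  have "\<exists>F :: ('v, 'k) mpol set. finite F \<and> forms d \<subseteq> mpol.span F"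
  proof (induction d)
    case 0
    have "f \<in> mpol.span {1}" if "f \<in> forms 0" for f :: "('v, 'k) mpol"
    proof -
      have "const (lookup f 0) * 1 \<in> mpol.span {1 :: ('v, 'k) mpol}"
        by (intro mpol.span_scale mpol.span_base) simp
      then show ?thesis unfolding mult_1_right forms_0_const[OF that, symmetric] .
    qed
    then show ?case by blast
  next
    case (Suc d)
    then obtain F :: "('v, 'k) mpol set" where F: "finite F" "forms d \<subseteq> mpol.span F" by blast
    let ?F = "\<Union>v. (*) (var v) ` F"
    have "f \<in> mpol.span ?F" if "f \<in> forms (Suc d)" for f
      using that
    proof (induction rule: forms_Suc_induct)
      case (var_mult v g)
      then have "g \<in> mpol.span F" using F by blast
      then show ?case
      proof (induction rule: mpol.span_induct_alt)
        case (step c x y)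
        have "const c * (var v * x) + var v * y \<in> mpol.span ?F"
          by (rule mpol.span_add[OF mpol.span_scale[OF mpol.span_base] step(2)]) (use step(1) in blast)
        then show ?case by (simp add: algebra_simps)
      qed (simp add: mpol.span_zero)
    qed (auto intro: mpol.span_zero mpol.span_add)
    then show ?case using F(1) by (intro exI[of _ ?F]) auto
  qed
  then show ?thesis using that by blast
qed

lemma lookup_component: "lookup (component d f) m = (if mon_degree m = d then lookup f m else 0)"
proof -
  have "lookup (component d f) m
      = (\<Sum>n\<in>{n \<in> keys f. mon_degree n = d}. if n = m then lookup f m else 0)"
    unfolding component_def lookup_sum by (intro sum.cong) (auto simp: lookup_single when_def)
  also have "\<dots> = (if m \<in> {n \<in> keys f. mon_degree n = d} then lookup f m else 0)"
    by (rule sum.delta) simp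
  finally show ?thesis by (auto simp: in_keys_iff)
qed

lemma component_forms: "component d f \<in> forms d"
  by (auto simp: forms_def in_keys_iff lookup_component split: if_splits)

lemma component_add: "component d (f + g) = component d f + component d g"
  and component_diff: "component d (f - g) = component d f - component d g"
  and component_const_mult: "component d (const c * f) = const c * component d f"
  by (rule poly_mapping_eqI; simp add: lookup_component lookup_add lookup_minus lookup_const_mult)+

lemma component_of_form: "f \<in> forms d \<Longrightarrow> component e f = (if e = d then f else 0)"
  by (rule poly_mapping_eqI) (auto simp: lookup_component forms_def in_keys_iff)

section \<open>Linear forms and their coefficient vectors\<close>

lemma linear_form_eq: "linear_form a = (\<Sum>v\<in>UNIV. const (a v) * var v)"
  unfolding linear_form_def const_def by (simp add: mult_single)

lemma forms_sum: "(\<And>i. i \<in> A \<Longrightarrow> g i \<in> forms d) \<Longrightarrow> sum g A \<in> forms d"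
  using mpol.subspace_sum[OF subspace_forms] by blast

lemma linear_form_forms: "linear_form a \<in> forms 1"
  unfolding linear_form_eq by (intro forms_sum forms_const_mult forms_var)

lemma linear_form_add: "linear_form (\<lambda>v. a v + b v) = linear_form a + linear_form b"
  unfolding linear_form_eq const_add distrib_right sum.distrib ..

lemma linear_form_scale: "linear_form (\<lambda>v. c * a v) = const c * linear_form a"
  unfolding linear_form_eq const_mult sum_distrib_left mult.assoc ..

lemma linear_form_delta: "linear_form (\<lambda>w. if w = v then 1 else 0) = var v"
proof -
  have "linear_form (\<lambda>w. if w = v then 1 else 0)
      = (\<Sum>w\<in>UNIV. if w = v then (var v :: ('a, 'b) mpol) else 0)"
    unfolding linear_form_eq by (intro sum.cong) auto
  then show ?thesis by simp
qed

lemma linear_form_0: "linear_form (\<lambda>v. 0) = 0"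
  by (simp add: linear_form_eq)

lemma forms_1_linear_form: "f \<in> forms 1 \<Longrightarrow> \<exists>a. f = linear_form a"
  unfolding One_nat_def
proof (induction rule: forms_Suc_induct)
  case zero
  show ?case using linear_form_0[symmetric] by blast
next
  case (var_mult v g)
  have "var v * g = linear_form (\<lambda>w. lookup g 0 * (if w = v then 1 else 0))"
    unfolding linear_form_scale linear_form_delta using forms_0_const[OF var_mult] by (simp add: mult.commute)
  then show ?case by blast
next
  case (add f g)
  then obtain a b where "f = linear_form a" "g = linear_form b" by blast
  then have "f + g = linear_form (\<lambda>v. a v + b v)" by (simp add: linear_form_add)
  then show ?case by blast
qed

lemma single_key_inject: "Poly_Mapping.single w (1::nat) = Poly_Mapping.single v 1 \<longleftrightarrow> w = v"
proof
  assume "Poly_Mapping.single w (1::nat) = Poly_Mapping.single v 1"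
  then have "lookup (Poly_Mapping.single w (1::nat)) w = lookup (Poly_Mapping.single v 1) w"
    by (rule arg_cong)
  then show "w = v" by (simp add: lookup_single when_def split: if_splits)
qed simp

lemma linear_form_inj:
  fixes a b :: "'a::finite \<Rightarrow> 'b::field"
  assumes "linear_form a = linear_form b"
  shows "a = b"
proof
  fix v
  have key: "lookup (linear_form c) (Poly_Mapping.single v 1) = c v" for c :: "'a \<Rightarrow> 'b"
  proof -
    have "lookup (linear_form c) (Poly_Mapping.single v 1) = (\<Sum>w\<in>UNIV. if w = v then c v else 0)"
      unfolding linear_form_def lookup_sum lookup_single single_key_inject when_def
      by (intro sum.cong) auto
    then show ?thesis by simp
  qed
  show "a v = b v" using key[of a] key[of b] unfolding assms by (rule trans[OF sym])
qed

section \<open>Evaluation at a point\<close>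

lemma eval_at_superset:
  assumes "finite A" "keys p \<subseteq> A"
  shows "eval_at a p = (\<Sum>m\<in>A. lookup p m * (\<Prod>v\<in>UNIV. a v ^ lookup m v))"
  unfolding eval_at_def using assms by (intro sum.mono_neutral_left) (auto simp: in_keys_iff)

lemma eval_at_add: "eval_at a (p + q) = eval_at a p + eval_at a q"
proof -
  let ?A = "keys p \<union> keys q"
  have "keys (p + q) \<subseteq> ?A" by (rule keys_add)
  then show ?thesis
    by (subst (1 2 3) eval_at_superset[of ?A]) (auto simp: lookup_add algebra_simps sum.distrib)
qed

lemma eval_at_single: "eval_at a (Poly_Mapping.single m c) = c * (\<Prod>v\<in>UNIV. a v ^ lookup m v)"
  by (subst eval_at_superset[of "{m}"]) auto

lemma eval_at_0 [simp]: "eval_at a 0 = 0"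
  by (simp add: eval_at_def)

lemma eval_at_mult: "eval_at a (p * q) = eval_at a p * eval_at a q"
proof (induction p rule: mpol_induct)
  case (single m c)
  show ?case
  proof (induction q rule: mpol_induct)
    case (single n d)
    then show ?case
      by (simp add: mult_single eval_at_single lookup_add power_add prod.distrib algebra_simps)
  qed (simp_all add: distrib_left eval_at_add)
qed (simp_all add: distrib_right eval_at_add)

lemma eval_at_diff: "eval_at a (p - q) = eval_at a p - eval_at a q"
  using eval_at_add[of a "p - q" q] by simp

lemma eval_at_1 [simp]: "eval_at a 1 = 1"
  using eval_at_single[of a 0 1] by simp

lemma eval_at_linear_form: "eval_at a (linear_form b) = (\<Sum>v\<in>UNIV. b v * a v)"
proof -
  have "(\<Prod>w\<in>UNIV. a w ^ lookup (Poly_Mapping.single v 1) w) = a v" for v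
  proof -
    have "(\<Prod>w\<in>UNIV. a w ^ lookup (Poly_Mapping.single v 1) w) = (\<Prod>w\<in>UNIV. if w = v then a w else 1)"
      by (intro prod.cong) (auto simp: lookup_single when_def)
    then show ?thesis by simp
  qed
  moreover have "eval_at a (sum g A) = (\<Sum>i\<in>A. eval_at a (g i))" if "finite A" for g :: "'b \<Rightarrow> _" and A
    using that by (induction A rule: finite_induct) (simp_all add: eval_at_add)
  ultimately show ?thesis by (simp add: linear_form_def eval_at_single)
qed

lemma eval_at_line: "\<exists>P. \<forall>s. eval_at (\<lambda>v. a v + s * b v) p = poly P s"
proof (induction p rule: mpol_induct)
  case zero
  then show ?case by (intro exI[of _ 0]) simp
next
  case (single m c)
  show ?case
    by (intro exI[of _ "[:c:] * (\<Prod>v\<in>UNIV. [:a v, b v:] ^ lookup m v)"])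
      (simp add: eval_at_single poly_prod mult.commute)
next
  case (add f g)
  then obtain P Q where "\<forall>s. eval_at (\<lambda>v. a v + s * b v) f = poly P s"
    "\<forall>s. eval_at (\<lambda>v. a v + s * b v) g = poly Q s" by blast
  then show ?case by (intro exI[of _ "P + Q"]) (simp add: eval_at_add)
qed

text \<open>Along the line from \<open>a\<close> to \<open>b\<close> both polynomials restrict to
  nonzero univariate polynomials, and their product has a nonroot because the field is infinite.
  Hence two nonempty principal open sets meet.\<close>

lemma eval_at_mult_nonzero:
  fixes D E :: "('v::finite, 'k::field_char_0) mpol"
  assumes "eval_at a D \<noteq> 0" "eval_at b E \<noteq> 0"
  obtains c where "eval_at c (D * E) \<noteq> 0"
proof -
  obtain P Q where P: "\<And>s. eval_at (\<lambda>v. a v + s * (b v - a v)) D = poly P s"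
    and Q: "\<And>s. eval_at (\<lambda>v. a v + s * (b v - a v)) E = poly Q s"
    using eval_at_line[where a = a and b = "\<lambda>v. b v - a v"] by metis
  have "P \<noteq> 0" using P[of 0] assms(1) by auto
  moreover have "Q \<noteq> 0" using Q[of 1] assms(2) by auto
  ultimately have "P * Q \<noteq> 0" by simp
  then have "\<not> (\<forall>s. poly (P * Q) s = 0)" using poly_all_0_iff_0 by blast
  then obtain s where "poly (P * Q) s \<noteq> 0" by blast
  then have "eval_at (\<lambda>v. a v + s * (b v - a v)) (D * E) \<noteq> 0" by (simp add: eval_at_mult P Q)
  then show ?thesis by (rule that)
qed

section \<open>Algebras of odd socle degree killed by a quadric\<close>

lemma lowdeg_mult:
  assumes "p \<in> lowdeg (Suc d)" "q \<in> lowdeg n"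
  shows "p * q \<in> lowdeg (d + n)"
proof -
  have "poly.coeff p k * poly.coeff q (i - k) = 0" if "d + n \<le> i" "k \<le> i" for i k
    using assms that by (cases "k \<le> d") (auto simp: lowdeg_def)
  then show ?thesis by (auto simp: lowdeg_def coeff_mult intro!: sum.neutral)
qed

lemma lowdeg_linear_factor:
  assumes "[:- r, 1:] * p \<in> lowdeg (Suc n)"
  shows "p \<in> lowdeg n"
proof (cases "p = 0")
  case False
  have "poly.coeff ([:- r, 1:] * p) (Suc (Polynomial.degree p)) = poly.coeff p (Polynomial.degree p)"
    by (simp add: coeff_eq_0)
  also have "\<dots> \<noteq> 0" using False by simp
  finally have "Suc (Polynomial.degree p) < Suc n" using assms by (auto simp: lowdeg_def not_le[symmetric])
  then show ?thesis by (auto simp: lowdeg_def intro!: coeff_eq_0)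
qed simp

lemma pmul_free_piece: "p \<in> lowdeg (Suc d) \<Longrightarrow> w \<in> free_piece j \<Longrightarrow> pmul p w \<in> free_piece (j + d)"
  using lowdeg_mult[of p d "fst w" "Suc j"] lowdeg_mult[of p d "snd w" j]
  by (simp add: free_piece_def mem_Times_iff add.commute)

lemma multiples_subset_shift: "multiples (Suc (Suc d)) w \<subseteq> shift (multiples (Suc d) w)"
proof
  fix u assume "u \<in> multiples (Suc (Suc d)) w"
  then obtain p where p: "p \<in> lowdeg (Suc (Suc d))" "u = pmul p w" by (auto simp: multiples_def)
  obtain a p' where a: "p = pCons a p'" by (cases p)
  have "[:a:] \<in> lowdeg (Suc d)" "p' \<in> lowdeg (Suc d)" using p(1) a by auto
  moreover have "u = pmul [:a:] w + pmul indet (pmul p' w)"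
    unfolding p(2) a pmul_pmul pmul_add(2)[symmetric] by (simp add: monom_Suc monom_0)
  ultimately show "u \<in> shift (multiples (Suc d) w)"
    unfolding shift_def using multiplesI[of _ "Suc d" w] by blast
qed

lemma shift_mono: "S \<subseteq> T \<Longrightarrow> shift S \<subseteq> shift T"
  unfolding shift_def by blast

lemma multiples_subset_shift_power:
  "multiples (Suc d + k) w \<subseteq> (shift ^^ k) (multiples (Suc d) w)"
proof (induction k)
  case (Suc k)
  have "multiples (Suc d + Suc k) w \<subseteq> shift (multiples (Suc d + k) w)"
    using multiples_subset_shift[of "d + k" w] by simp
  also have "\<dots> \<subseteq> (shift ^^ Suc k) (multiples (Suc d) w)" using shift_mono[OF Suc] by simp
  finally show ?case .
qed simp

lemma lead_coeff_pderiv: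
  "lead_coeff (pderiv p) = of_nat (Polynomial.degree p) * lead_coeff (p :: 'k::field_char_0 poly)"
proof (cases "Polynomial.degree p")
  case 0
  then have "pderiv p = 0" by (simp add: pderiv_eq_0_iff)
  then show ?thesis using 0 by simp
qed (simp add: degree_pderiv coeff_pderiv)

text \<open>The leading coefficients of the two products differ by the factors
  \<open>degree v\<close> and \<open>degree u\<close>, which remain distinct in characteristic
  zero.\<close>

lemma wronskian_nonzero_aux:
  fixes u v :: "'k::field_char_0 poly"
  assumes "u \<noteq> 0" "Polynomial.degree u < Polynomial.degree v"
  shows "u * pderiv v \<noteq> v * pderiv u"
proof
  assume eq: "u * pderiv v = v * pderiv u"
  have v: "v \<noteq> 0" "pderiv v \<noteq> 0" using assms(2) by (auto simp: pderiv_eq_0_iff)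
  have "lead_coeff (u * pderiv v) = lead_coeff (v * pderiv u)" using eq by simp
  then have "lead_coeff u * lead_coeff v * of_nat (Polynomial.degree v)
      = lead_coeff u * lead_coeff v * of_nat (Polynomial.degree u)"
    unfolding lead_coeff_mult lead_coeff_pderiv by (simp add: algebra_simps)
  then have "Polynomial.degree v = Polynomial.degree u" using assms(1) v(1) by simp
  then show False using assms(2) by simp
qed

text \<open>Subtracting a multiple of \<open>v\<close> from \<open>u\<close> does not change the
  Wronskian, so equal degrees reduce to unequal ones.\<close>

lemma wronskian_nonzero:
  fixes u v :: "'k::field_char_0 poly"
  assumes "v \<noteq> 0" "\<And>c. u \<noteq> smult c v"
  shows "u * pderiv v \<noteq> v * pderiv u"
proof
  assume eq: "u * pderiv v = v * pderiv u"
  have u: "u \<noteq> 0" using assms(2)[of 0] by simp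
  consider "Polynomial.degree u < Polynomial.degree v" | "Polynomial.degree v < Polynomial.degree u"
    | "Polynomial.degree u = Polynomial.degree v" by linarith
  then show False
  proof cases
    case 3
    define c where "c = lead_coeff u / lead_coeff v"
    define w where "w = u - smult c v"
    have "w \<noteq> 0" using assms(2)[of c] by (simp add: w_def)
    moreover have "poly.coeff w (Polynomial.degree v) = 0"
      using assms(1) 3 by (simp add: w_def c_def)
    moreover have "Polynomial.degree w \<le> Polynomial.degree v"
      unfolding w_def using 3 by (intro degree_diff_le) (auto intro: degree_smult_le)
    ultimately have "Polynomial.degree w < Polynomial.degree v"
      by (metis le_neq_implies_less leading_coeff_0_iff)
    then have "w * pderiv v \<noteq> v * pderiv w" by (rule wronskian_nonzero_aux[OF \<open>w \<noteq> 0\<close>])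
    then show False using eq by (simp add: w_def pderiv_diff pderiv_smult algebra_simps)
  qed (use wronskian_nonzero_aux[of u v] wronskian_nonzero_aux[of v u] u assms(1) eq in auto)
qed

text \<open>
  A pair \<open>s\<close> stands for \<open>fst s + \<zeta> * snd s\<close> dehomogenised at \<open>\<eta> = 1\<close>; the function \<open>H m\<close>
  below homogenises it to a form of degree \<open>m\<close>.
\<close>

locale conic =
  fixes \<xi> \<eta> \<zeta> q :: "('v::finite, 'k::field_char_0) mpol" and b0 b1 g0 g1 g2 \<kappa> :: 'k
    and \<phi> :: "('v, 'k) mpol \<Rightarrow> 'k" and t :: nat
  assumes linear: "\<xi> \<in> forms 1" "\<eta> \<in> forms 1" "\<zeta> \<in> forms 1"
    and spanning: "\<And>v. \<exists>x y z. var v = const x * \<xi> + const y * \<eta> + const z * \<zeta>"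
    and relation: "\<zeta> * \<zeta> + (const b0 * \<eta> + const b1 * \<xi>) * \<zeta>
      + (const g0 * \<eta> * \<eta> + const g1 * \<xi> * \<eta> + const g2 * \<xi> * \<xi>) = const \<kappa> * q"
    and \<phi>_add: "\<And>f g. \<phi> (f + g) = \<phi> f + \<phi> g"
    and \<phi>_scale: "\<And>c f. \<phi> (const c * f) = c * \<phi> f"
    and \<phi>_q: "\<And>r. \<phi> (q * r) = 0"
begin

section \<open>Coordinates for forms modulo the quadric\<close>

lemma \<phi>_0: "\<phi> 0 = 0"
  using \<phi>_scale[of 0 0] by simp

lemma \<phi>_q': "\<phi> (f * (q * r)) = 0" "\<phi> (q * r * f) = 0"
  using \<phi>_q[of "f * r"] \<phi>_q[of "r * f"] by (simp_all add: algebra_simps)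

text \<open>The index is that of \<open>lowdeg\<close>: for \<open>n > 0\<close> the result is a
  form of degree \<open>n - 1\<close>, and \<open>hom 0\<close> is zero, so \<open>H 0\<close> sees
  only the first coordinate.\<close>

definition hom :: "nat \<Rightarrow> 'k poly \<Rightarrow> ('v, 'k) mpol"
  where "hom n p = (\<Sum>i<n. const (poly.coeff p i) * (\<xi> ^ i * \<eta> ^ (n - 1 - i)))"

definition H :: "nat \<Rightarrow> 'k poly \<times> 'k poly \<Rightarrow> ('v, 'k) mpol"
  where "H m s = hom (Suc m) (fst s) + \<zeta> * hom m (snd s)"

lemma hom_0 [simp]: "hom n 0 = 0" "hom 0 p = 0"
  by (simp_all add: hom_def)

lemma hom_add: "hom n (p + p') = hom n p + hom n p'"
  by (simp add: hom_def const_add distrib_right sum.distrib)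

lemma hom_smult: "hom n (smult c p) = const c * hom n p"
  unfolding hom_def coeff_smult const_mult sum_distrib_left mult.assoc ..

lemma hom_uminus: "hom n (- p) = - hom n p"
  by (simp add: hom_def const_uminus sum_negf)

lemma hom_diff: "hom n (p - p') = hom n p - hom n p'"
  using hom_add[of n p "- p'"] by (simp add: hom_uminus)

lemma hom_pCons: "hom (Suc n) (pCons a p) = const a * \<eta> ^ n + \<xi> * hom n p"
proof -
  have "hom (Suc n) (pCons a p)
      = const a * \<eta> ^ n + (\<Sum>i<n. const (poly.coeff p i) * (\<xi> ^ Suc i * \<eta> ^ (n - Suc i)))"
    unfolding hom_def sum.lessThan_Suc_shift by simp
  also have "(\<Sum>i<n. const (poly.coeff p i) * (\<xi> ^ Suc i * \<eta> ^ (n - Suc i))) = \<xi> * hom n p"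
    unfolding hom_def sum_distrib_left by (intro sum.cong) (simp_all add: algebra_simps)
  finally show ?thesis .
qed

lemma hom_indet: "hom (Suc n) (indet * p) = \<xi> * hom n p"
  using hom_pCons[of n 0 p] by (simp add: monom_Suc monom_0)

lemma hom_Suc: "p \<in> lowdeg n \<Longrightarrow> hom (Suc n) p = \<eta> * hom n p"
proof -
  assume "p \<in> lowdeg n"
  then have "poly.coeff p n = 0" by (simp add: lowdeg_def)
  then have "hom (Suc n) p = (\<Sum>i<n. const (poly.coeff p i) * (\<xi> ^ i * \<eta> ^ (n - i)))"
    by (simp add: hom_def)
  also have "\<dots> = \<eta> * hom n p"
    unfolding hom_def sum_distrib_left
  proof (intro sum.cong refl)
    fix i assume "i \<in> {..<n}"
    then have "n - i = Suc (n - 1 - i)" by auto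
    then show "const (poly.coeff p i) * (\<xi> ^ i * \<eta> ^ (n - i))
        = \<eta> * (const (poly.coeff p i) * (\<xi> ^ i * \<eta> ^ (n - 1 - i)))" by (simp add: algebra_simps)
  qed
  finally show ?thesis .
qed

lemma hom_linear_mult:
  assumes "p \<in> lowdeg n"
  shows "hom (Suc n) ([:a, b:] * p) = (const a * \<eta> + const b * \<xi>) * hom n p"
proof -
  have *: "[:a, b:] * p = smult a p + indet * smult b p" by (simp add: monom_Suc monom_0)
  show ?thesis
    unfolding * hom_add hom_smult hom_indet hom_Suc[OF assms] by (simp add: algebra_simps)
qed

lemma hom_quadratic_mult:
  assumes "p \<in> lowdeg n"
  shows "hom (Suc (Suc n)) ([:a, b, c:] * p)
    = (const a * \<eta> * \<eta> + const b * \<xi> * \<eta> + const c * \<xi> * \<xi>) * hom n p"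
proof -
  have *: "[:a, b, c:] * p = smult a p + indet * ([:b, c:] * p)" by (simp add: monom_Suc monom_0)
  have **: "hom (Suc (Suc n)) p = \<eta> * (\<eta> * hom n p)"
    using hom_Suc[OF assms] hom_Suc[OF lowdeg_Suc[OF assms]] by simp
  show ?thesis
    unfolding * hom_add hom_smult hom_indet ** hom_linear_mult[OF assms] by (simp add: algebra_simps)
qed

lemma H_0 [simp]: "H m 0 = 0"
  by (simp add: H_def)

lemma H_add: "H m (s + s') = H m s + H m s'"
  by (simp add: H_def hom_add algebra_simps)

lemma H_scale: "H m (pmul [:c:] s) = const c * H m s"
  by (simp add: H_def hom_smult algebra_simps)

lemma H_indet: "H (Suc m) (pmul indet s) = \<xi> * H m s"
  unfolding H_def pmul_simps hom_indet by (simp add: algebra_simps)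

lemma H_Suc: "s \<in> free_piece m \<Longrightarrow> H (Suc m) s = \<eta> * H m s"
  by (auto simp: H_def hom_Suc free_piece_def algebra_simps)

lemma H_linear_mult:
  assumes "s \<in> free_piece m"
  shows "H (Suc m) (pmul [:a, b:] s) = (const a * \<eta> + const b * \<xi>) * H m s"
proof -
  have "fst s \<in> lowdeg (Suc m)" "snd s \<in> lowdeg m" using assms by (auto simp: free_piece_def)
  then show ?thesis
    unfolding H_def pmul_simps by (simp only: hom_linear_mult) (simp add: algebra_simps)
qed

text \<open>Multiplication by \<open>\<zeta>\<close> modulo \<open>q\<close> in coordinates, with
  the square of \<open>\<zeta>\<close> eliminated by \<open>relation\<close>.\<close>

definition zmul :: "'k poly \<times> 'k poly \<Rightarrow> 'k poly \<times> 'k poly"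
  where "zmul s = (- ([:g0, g1, g2:] * snd s), fst s - [:b0, b1:] * snd s)"

lemma zmul_free_piece:
  assumes "s \<in> free_piece m"
  shows "zmul s \<in> free_piece (Suc m)"
proof -
  have s: "fst s \<in> lowdeg (Suc m)" "snd s \<in> lowdeg m" using assms by (auto simp: free_piece_def)
  have "[:g0, g1, g2:] * snd s \<in> lowdeg (Suc (Suc 0) + m)" "[:b0, b1:] * snd s \<in> lowdeg (Suc 0 + m)"
    by (intro lowdeg_mult s(2); simp)+
  then show ?thesis
    using s(1) unfolding zmul_def free_piece_def mem_Times_iff fst_conv snd_conv add_Suc add_0
    by (intro conjI lowdeg_uminus lowdeg_diff)
qed

lemma H_zmul:
  assumes "s \<in> free_piece m"
  shows "\<zeta> * H m s = H (Suc m) (zmul s) + q * (const \<kappa> * hom m (snd s))"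
proof -
  have s: "fst s \<in> lowdeg (Suc m)" "snd s \<in> lowdeg m" using assms by (auto simp: free_piece_def)
  have "q * (const \<kappa> * hom m (snd s)) = (\<zeta> * \<zeta> + (const b0 * \<eta> + const b1 * \<xi>) * \<zeta>
      + (const g0 * \<eta> * \<eta> + const g1 * \<xi> * \<eta> + const g2 * \<xi> * \<xi>)) * hom m (snd s)"
    unfolding relation by (simp add: algebra_simps)
  then show ?thesis
    unfolding H_def zmul_def fst_conv snd_conv hom_uminus hom_diff hom_quadratic_mult[OF s(2)]
      hom_linear_mult[OF s(2)] by (simp add: algebra_simps)
qed

lemma hom_forms: "hom (Suc n) p \<in> forms n"
proof (induction n arbitrary: p)
  case 0
  show ?case by (simp add: hom_def forms_const)
next
  case (Suc n)
  obtain a p' where p: "p = pCons a p'" by (cases p)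
  have "\<eta> ^ k \<in> forms k" for k
    by (induction k) (use forms_mult[OF linear(2)] in \<open>auto intro: forms_1\<close>)
  moreover have "\<xi> * hom (Suc n) p' \<in> forms (Suc n)"
    using forms_mult[OF linear(1) Suc] by simp
  ultimately show ?case unfolding p hom_pCons by (intro forms_add forms_const_mult)
qed

lemma H_forms: "H m s \<in> forms m"
proof (cases m)
  case (Suc n)
  then show ?thesis
    unfolding H_def using hom_forms[of m "fst s"] forms_mult[OF linear(3) hom_forms[of n "snd s"]]
    by (intro forms_add) simp_all
qed (use hom_forms[of 0] in \<open>simp add: H_def\<close>)

text \<open>Modulo \<open>q\<close> all powers of \<open>\<zeta>\<close> above the first can be
  eliminated. In the induction a variable acts on coordinates as a linear polynomial through
  \<open>pmul\<close> plus a multiple of \<open>zmul\<close>.\<close>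

lemma H_surj: "f \<in> forms m \<Longrightarrow> \<exists>s\<in>free_piece m. \<exists>r. f = H m s + q * r"
proof (induction m arbitrary: f)
  case 0
  have "f = H 0 ([:lookup f 0:], 0) + q * 0"
    using forms_0_const[OF 0] by (simp add: H_def hom_def)
  then show ?case by (intro bexI[of _ "([:lookup f 0:], 0)"] exI[of _ 0]) (auto simp: free_piece_def)
next
  case (Suc m)
  from Suc.prems show ?case
  proof (induction rule: forms_Suc_induct)
    case zero
    then show ?case
      by (intro bexI[of _ 0] exI[of _ 0]) (use pairs.subspace_0[OF subspace_free_piece] in auto)
  next
    case (add f g)
    then obtain s r s' r' where *: "s \<in> free_piece (Suc m)" "f = H (Suc m) s + q * r"
      "s' \<in> free_piece (Suc m)" "g = H (Suc m) s' + q * r'" by blast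
    have "f + g = H (Suc m) (s + s') + q * (r + r')" by (simp add: * H_add algebra_simps)
    then show ?case using * pairs.subspace_add[OF subspace_free_piece] by blast
  next
    case (var_mult v g)
    obtain s r where s: "s \<in> free_piece m" "g = H m s + q * r" using Suc.IH[OF var_mult] by blast
    obtain x y z where v: "var v = const x * \<xi> + const y * \<eta> + const z * \<zeta>" using spanning by blast
    let ?s = "pmul [:y, x:] s + pmul [:z:] (zmul s)"
    have "[:y, x:] \<in> lowdeg (Suc 1)" by simp
    then have "?s \<in> free_piece (Suc m)"
      using pmul_free_piece[of "[:y, x:]" 1 s m] s(1) zmul_free_piece[OF s(1)]
      by (intro pairs.subspace_add[OF subspace_free_piece] pairs.subspace_scale[OF subspace_free_piece]) simp_all
    moreover have "var v * g = H (Suc m) ?s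
        + q * (const z * const \<kappa> * hom m (snd s) + var v * r)"
    proof -
      have "var v * g = (const y * \<eta> + const x * \<xi>) * H m s + const z * (\<zeta> * H m s) + q * (var v * r)"
        unfolding s(2) v by (simp add: algebra_simps)
      then show ?thesis unfolding H_add H_scale H_linear_mult[OF s(1)] H_zmul[OF s(1)]
        by (simp add: algebra_simps)
    qed
    ultimately show ?case by blast
  qed
qed

lemma H_hom_mult: "w \<in> free_piece j \<Longrightarrow> p \<in> lowdeg (Suc d) \<Longrightarrow> H j w * hom (Suc d) p = H (j + d) (pmul p w)"
proof (induction d arbitrary: p)
  case 0
  obtain a p' where p: "p = pCons a p'" by (cases p)
  then have "p = [:a:]" using 0 by simp
  then show ?case using H_scale[of j a w] by (simp add: hom_def mult.commute)
next
  case (Suc d)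
  obtain a p' where p: "p = pCons a p'" by (cases p)
  then have p': "p' \<in> lowdeg (Suc d)" using Suc.prems by simp
  have raise: "w' \<in> free_piece j \<Longrightarrow> H (j + k) w' = \<eta> ^ k * H j w' \<and> w' \<in> free_piece (j + k)" for k w'
  proof (induction k)
    case (Suc k)
    then have "w' \<in> free_piece (j + k)" by blast
    then show ?case using Suc H_Suc[of w' "j + k"] by (auto simp: free_piece_def lowdeg_Suc algebra_simps)
  qed simp
  have "pmul [:a:] w \<in> free_piece j"
    by (rule pairs.subspace_scale[OF subspace_free_piece Suc.prems(1)])
  from raise[OF this, of "Suc d"]
  have "H (j + Suc d) (pmul [:a:] w) = \<eta> ^ Suc d * (const a * H j w)" by (simp add: H_scale)
  moreover have "H (j + Suc d) (pmul indet (pmul p' w)) = \<xi> * (H j w * hom (Suc d) p')"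
    using Suc.IH[OF Suc.prems(1) p'] H_indet[of "j + d"] by simp
  moreover have "pmul p w = pmul [:a:] w + pmul indet (pmul p' w)"
    unfolding p pmul_pmul pmul_add(2)[symmetric] by (simp add: monom_Suc monom_0)
  ultimately show ?case unfolding p hom_pCons by (simp add: H_add algebra_simps)
qed

text \<open>For the Gorenstein algebra of socle degree \<open>2 * t + 1\<close> dual to
  \<open>\<phi>\<close>, this is injectivity of \<open>linear_form a\<close> from degree
  \<open>t\<close> to degree \<open>t + 1\<close>, phrased through the pairing.\<close>

definition good :: "('v \<Rightarrow> 'k) \<Rightarrow> bool"
  where "good a \<longleftrightarrow> (\<forall>f\<in>forms t. (\<forall>b\<in>forms t. \<phi> (linear_form a * f * b) = 0) \<longrightarrow>
    (\<forall>c\<in>forms (Suc t). \<phi> (f * c) = 0))"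

text \<open>In coordinates modulo \<open>q\<close>, this is the degree \<open>m\<close> part of the
  ideal dual to \<open>\<phi>\<close>; \<open>ann t\<close> and \<open>ann (Suc t)\<close> are
  \<open>N\<close> and \<open>T\<close> of the overview.\<close>

definition ann :: "nat \<Rightarrow> ('k poly \<times> 'k poly) set"
  where "ann m = {s \<in> free_piece m. \<forall>f\<in>forms (2 * t + 1 - m). \<phi> (H m s * f) = 0}"

lemma subspace_ann: "pairs.subspace (ann m)"
  unfolding pairs.subspace_def
proof (intro conjI ballI allI)
  show "0 \<in> ann m" by (simp add: ann_def \<phi>_0 free_piece_zero)
next
  fix x y assume "x \<in> ann m" "y \<in> ann m"
  then show "x + y \<in> ann m"
    by (simp add: ann_def H_add distrib_right \<phi>_add free_piece_add)
next
  fix c x assume "x \<in> ann m"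
  then show "pmul [:c:] x \<in> ann m"
    by (simp only: ann_def mem_Collect_eq H_scale mult.assoc \<phi>_scale free_piece_scale) simp
qed

lemma ann_free_piece: "ann m \<subseteq> free_piece m"
  by (auto simp: ann_def)

lemma shift_ann:
  assumes "m \<le> 2 * t"
  shows "shift (ann m) \<subseteq> ann (Suc m)"
proof -
  have deg: "2 * t + 1 - m = Suc (2 * t + 1 - Suc m)" using assms by simp
  have "s \<in> ann (Suc m) \<and> pmul indet s \<in> ann (Suc m)" if s: "s \<in> ann m" for s
  proof -
    have sm: "s \<in> free_piece m" using s by (simp add: ann_def)
    have "s \<in> free_piece (Suc m)" "pmul indet s \<in> free_piece (Suc m)"
      using sm by (rule free_piece_Suc, rule free_piece_indet)
    moreover have "\<phi> (H m s * (l * f)) = 0" if "l \<in> forms 1" "f \<in> forms (2 * t + 1 - Suc m)" for l f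
      using s forms_mult[OF that] unfolding ann_def deg by simp
    moreover have "H (Suc m) s * f = H m s * (\<eta> * f)" "H (Suc m) (pmul indet s) * f = H m s * (\<xi> * f)" for f
      unfolding H_Suc[OF sm] H_indet by (simp_all only: ac_simps)
    ultimately show ?thesis
      using linear unfolding ann_def by simp
  qed
  then show ?thesis using pairs.subspace_add[OF subspace_ann] unfolding shift_def by blast
qed

lemma shift_power_ann: "m + k \<le> Suc (2 * t) \<Longrightarrow> (shift ^^ k) (ann m) \<subseteq> ann (m + k)"
proof (induction k)
  case (Suc k)
  then have "shift ((shift ^^ k) (ann m)) \<subseteq> shift (ann (m + k))" by (intro shift_mono) simp
  also have "\<dots> \<subseteq> ann (Suc (m + k))" using Suc.prems by (intro shift_ann) simp
  finally show ?case by simp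
qed simp

lemma \<phi>_mod_q: "\<phi> ((f + q * r) * g) = \<phi> (f * g)" "\<phi> (g * (f + q * r)) = \<phi> (g * f)"
  by (simp_all add: distrib_right distrib_left \<phi>_add \<phi>_q')

lemma annI:
  assumes "s \<in> free_piece m" "\<And>b. b \<in> free_piece (2 * t + 1 - m) \<Longrightarrow> \<phi> (H m s * H (2 * t + 1 - m) b) = 0"
  shows "s \<in> ann m"
  unfolding ann_def
proof (intro CollectI conjI ballI assms(1))
  fix f :: "('v, 'k) mpol" assume "f \<in> forms (2 * t + 1 - m)"
  then obtain b r where "b \<in> free_piece (2 * t + 1 - m)" "f = H (2 * t + 1 - m) b + q * r"
    using H_surj by blast
  then show "\<phi> (H m s * f) = 0" using assms(2) by (simp add: \<phi>_mod_q)
qed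

lemma annD: "s \<in> ann m \<Longrightarrow> f \<in> forms (2 * t + 1 - m) \<Longrightarrow> \<phi> (H m s * f) = 0"
  by (simp add: ann_def)

text \<open>By \<open>dim_orthogonal_le\<close> for the pairing of degrees \<open>t\<close> and
  \<open>t + 1\<close>, the annihilators differ in dimension at least as much as the ambient pieces,
  hence by at least two.\<close>

lemma dim_ann: "pairs.dim (ann t) + 2 \<le> pairs.dim (ann (Suc t))"
proof -
  obtain F :: "('k poly \<times> 'k poly) set" where F: "finite F" "free_piece t \<subseteq> pairs.span F"
    by (rule free_piece_fd)
  obtain G :: "('k poly \<times> 'k poly) set" where G: "finite G" "free_piece (Suc t) \<subseteq> pairs.span G"
    by (rule free_piece_fd)
  let ?\<beta> = "\<lambda>s r. \<phi> (H t s * H (Suc t) r)"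
  have deg: "2 * t + 1 - t = Suc t" "2 * t + 1 - Suc t = t" by simp_all
  have N: "{a \<in> free_piece t. \<forall>c\<in>free_piece (Suc t). ?\<beta> a c = 0} = ann t"
  proof (intro equalityI subsetI)
    fix a assume "a \<in> {a \<in> free_piece t. \<forall>c\<in>free_piece (Suc t). ?\<beta> a c = 0}"
    then show "a \<in> ann t" by (intro annI) (auto simp: deg)
  next
    fix a assume a: "a \<in> ann t"
    have "?\<beta> a c = 0" for c
      using annD[OF a, of "H (Suc t) c"] H_forms[of "Suc t" c] by (simp add: deg)
    then show "a \<in> {a \<in> free_piece t. \<forall>c\<in>free_piece (Suc t). ?\<beta> a c = 0}"
      using a by (simp add: ann_def)
  qed
  have T: "{c \<in> free_piece (Suc t). \<forall>a\<in>free_piece t. ?\<beta> a c = 0} = ann (Suc t)"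
  proof (intro equalityI subsetI)
    fix c assume "c \<in> {c \<in> free_piece (Suc t). \<forall>a\<in>free_piece t. ?\<beta> a c = 0}"
    then show "c \<in> ann (Suc t)" by (intro annI) (auto simp: deg mult.commute[of "H (Suc t) c"])
  next
    fix c assume c: "c \<in> ann (Suc t)"
    have "?\<beta> a c = 0" for a
      using annD[OF c, of "H t a"] H_forms[of t a] by (simp add: deg mult.commute)
    then show "c \<in> {c \<in> free_piece (Suc t). \<forall>a\<in>free_piece t. ?\<beta> a c = 0}"
      using c by (simp add: ann_def)
  qed
  have "pairs.dim (free_piece (Suc t) :: ('k poly \<times> 'k poly) set) + pairs.dim (ann t)
      \<le> pairs.dim (ann (Suc t)) + pairs.dim (free_piece t :: ('k poly \<times> 'k poly) set)"
    unfolding N[symmetric] T[symmetric]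
    by (rule pairs.dim_orthogonal_le[OF subspace_free_piece F(2,1) subspace_free_piece G(2,1)])
      (simp_all add: H_add H_scale distrib_left distrib_right \<phi>_add \<phi>_scale mult.assoc mult.left_commute[of _ "const _"])
  then show ?thesis using dim_free_piece_Suc[where 'a = 'k, of t] by linarith
qed

lemma linear_form_exists: "\<exists>a. linear_form a = const x * \<xi> + const y * \<eta> + const z * \<zeta>"
proof -
  have "const x * \<xi> + const y * \<eta> + const z * \<zeta> \<in> forms 1"
    by (intro forms_add forms_const_mult linear)
  from forms_1_linear_form[OF this] show ?thesis by (elim exE) (rule exI, rule sym)
qed

text \<open>
  If the values at a point \<open>r\<close> of two elements of the next annihilator are independent, then
  multiplication by \<open>\<xi> - r\<eta>\<close> is onto in the middle degree.
\<close>

lemma good_of_independent_values: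
  assumes u: "u \<in> ann (Suc t)" and v: "v \<in> ann (Suc t)"
    and nz: "poly (fst u * snd v - fst v * snd u) r \<noteq> 0"
  shows "\<exists>a. good a"
proof -
  obtain a0 where a0: "linear_form a0 = const 1 * \<xi> + const (- r) * \<eta> + const 0 * \<zeta>"
    using linear_form_exists by blast
  then have L: "linear_form a0 = const (- r) * \<eta> + const 1 * \<xi>" by simp
  have "good a0"
    unfolding good_def
  proof (intro ballI impI)
    fix f c :: "('v, 'k) mpol" assume f: "f \<in> forms t" "\<forall>b\<in>forms t. \<phi> (linear_form a0 * f * b) = 0"
      and "c \<in> forms (Suc t)"
    then obtain s x where s: "s \<in> free_piece (Suc t)" "c = H (Suc t) s + q * x" using H_surj by blast
    \<comment> \<open>Cramer's rule: \<open>\<alpha>\<close> and \<open>\<beta>\<close> make the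
      combination \<open>y\<close> vanish at \<open>r\<close>, hence divisible by
      \<open>[:- r, 1:]\<close>. So \<open>c\<close> is a multiple of the linear form up to elements
      of the annihilator and multiples of \<open>q\<close>.\<close>
    define d where "d = poly (fst u) r * poly (snd v) r - poly (fst v) r * poly (snd u) r"
    define \<alpha> where "\<alpha> = (poly (fst s) r * poly (snd v) r - poly (fst v) r * poly (snd s) r) / d"
    define \<beta> where "\<beta> = (poly (fst u) r * poly (snd s) r - poly (fst s) r * poly (snd u) r) / d"
    have d: "d \<noteq> 0" using nz by (simp add: d_def)
    define y where "y = s - pmul [:\<alpha>:] u - pmul [:\<beta>:] v"
    have "poly (fst y) r = 0" "poly (snd y) r = 0"
      using d unfolding y_def \<alpha>_def \<beta>_def
      by (simp_all add: field_simps) (simp_all add: d_def algebra_simps)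
    then obtain p p' where p: "fst y = [:- r, 1:] * p" "snd y = [:- r, 1:] * p'"
      unfolding poly_eq_0_iff_dvd dvd_def by blast
    have y: "y \<in> free_piece (Suc t)"
      unfolding y_def using s(1) u v ann_free_piece[of "Suc t"]
      by (intro pairs.subspace_diff[OF subspace_free_piece] pairs.subspace_scale[OF subspace_free_piece]) auto
    have z: "(p, p') \<in> free_piece t"
    proof (cases t)
      case 0
      then show ?thesis using y p lowdeg_linear_factor[of r p 1] lowdeg_linear_factor[of r p' 0]
        by (auto simp: free_piece_def mem_Times_iff simp del: mult_pCons_left)
    next
      case (Suc t')
      then show ?thesis using y p lowdeg_linear_factor[of r p "Suc t"] lowdeg_linear_factor[of r p' t]
        by (auto simp: free_piece_def mem_Times_iff simp del: mult_pCons_left)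
    qed
    have "y = pmul [:- r, 1:] (p, p')" using p by (simp add: prod_eq_iff)
    then have Hy: "H (Suc t) y = linear_form a0 * H t (p, p')"
      using H_linear_mult[OF z, of "- r" 1] by (simp add: L)
    have "s = y + (pmul [:\<alpha>:] u + pmul [:\<beta>:] v)" by (simp add: y_def)
    then have "\<phi> (f * H (Suc t) s) = \<phi> (linear_form a0 * f * H t (p, p'))
        + (\<alpha> * \<phi> (H (Suc t) u * f) + \<beta> * \<phi> (H (Suc t) v * f))"
      by (simp add: H_add H_scale Hy distrib_left \<phi>_add \<phi>_scale mult.left_commute[of f] mult.commute[of f]
          mult.assoc)
    also have "\<dots> = 0"
      using f H_forms[of t] annD[OF u] annD[OF v] by simp
    finally show "\<phi> (f * c) = 0" by (simp add: s(2) \<phi>_mod_q)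
  qed
  then show ?thesis by blast
qed

lemma rank_one_ann:
  assumes "\<nexists>a. good a"
  shows "rank_one (ann (Suc t))"
  unfolding rank_one_def
proof (intro ballI)
  fix u v assume "u \<in> ann (Suc t)" "v \<in> ann (Suc t)"
  then have "\<forall>r. poly (fst u * snd v - fst v * snd u) r = 0"
    using good_of_independent_values assms by blast
  then have "fst u * snd v - fst v * snd u = 0" by (simp only: poly_all_0_iff_0)
  then show "fst u * snd v = fst v * snd u" by simp
qed

lemma multiples_subset_ann:
  assumes "w \<in> ann j" "j \<le> t"
  shows "multiples (Suc (t - j)) w \<subseteq> ann t"
proof
  fix u assume "u \<in> multiples (Suc (t - j)) w"
  then obtain p where p: "p \<in> lowdeg (Suc (t - j))" "u = pmul p w" by (auto simp: multiples_def)
  have w: "w \<in> free_piece j" using assms(1) by (simp add: ann_def)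
  have tj: "j + (t - j) = t" "t - j + (2 * t + 1 - t) = 2 * t + 1 - j" using assms(2) by simp_all
  have H: "H t u = H j w * hom (Suc (t - j)) p" using H_hom_mult[OF w p(1)] tj p(2) by simp
  have "u \<in> free_piece t" using pmul_free_piece[OF p(1) w] tj p(2) by simp
  moreover have "\<phi> (H t u * f) = 0" if "f \<in> forms (2 * t + 1 - t)" for f
    using annD[OF assms(1), of "hom (Suc (t - j)) p * f"] forms_mult[OF hom_forms that, of "t - j" p]
    unfolding H tj by (simp add: mult.assoc)
  ultimately show "u \<in> ann t" by (simp add: ann_def)
qed

text \<open>A test form in normal form splits into \<open>\<xi>\<close>, \<open>\<eta>\<close> and
  \<open>\<zeta>\<close> times binary forms of degree \<open>2 * t - j\<close>. Its product with
  \<open>w\<close> is then a sum of multiples of \<open>w\<close> of degree \<open>2 * t\<close>,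
  each times a linear form.\<close>

lemma ann_of_multiples:
  assumes w: "w \<in> free_piece j" and j: "j \<le> 2 * t" and sub: "multiples (2 * t + 1 - j) w \<subseteq> ann (2 * t)"
  shows "w \<in> ann j"
proof (rule annI[OF w])
  define n where "n = 2 * t - j"
  have n: "2 * t + 1 - j = Suc n" "j + n = 2 * t" "2 * t + 1 - 2 * t = 1" using j by (simp_all add: n_def)
  have zero: "\<phi> (H j w * hom (Suc n) p * l) = 0" if "p \<in> lowdeg (Suc n)" "l \<in> forms 1" for p l
  proof -
    have "pmul p w \<in> ann (2 * t)" using sub that(1) unfolding n by (auto simp: multiples_def)
    then show ?thesis using annD[of "pmul p w" "2 * t" l] that H_hom_mult[OF w that(1)] by (simp add: n)
  qed
  fix b :: "'k poly \<times> 'k poly" assume b: "b \<in> free_piece (2 * t + 1 - j)"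
  obtain a p where p: "fst b = pCons a p" by (cases "fst b")
  have lp: "p \<in> lowdeg (Suc n)" "snd b \<in> lowdeg (Suc n)" 
    using b unfolding n(1) free_piece_def mem_Times_iff p lowdeg_pCons by simp_all
  have "hom (Suc (Suc n)) (fst b) = \<eta> * hom (Suc n) [:a:] + \<xi> * hom (Suc n) p"
  proof -
    have "hom (Suc n) [:a:] = const a * \<eta> ^ n" using hom_pCons[of n a 0] by simp
    then show ?thesis unfolding p hom_pCons[of "Suc n"] by (simp add: algebra_simps)
  qed
  then have "H j w * H (2 * t + 1 - j) b = H j w * hom (Suc n) [:a:] * \<eta>
      + H j w * hom (Suc n) p * \<xi> + H j w * hom (Suc n) (snd b) * \<zeta>"
    unfolding n H_def[of "Suc n"] by (simp add: algebra_simps)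
  then show "\<phi> (H j w * H (2 * t + 1 - j) b) = 0"
    using zero[OF _ linear(2), of "[:a:]"] zero[OF lp(1) linear(1)] zero[OF lp(2) linear(3)]
    by (simp add: \<phi>_add)
qed

text \<open>The structure lemma gives a generator \<open>w\<close> of degree \<open>j\<close> with
  \<open>j + ?n + i \<le> t\<close>. The case \<open>i < t\<close> contradicts
  \<open>dim_ann\<close>; in the case \<open>i = t\<close> this bound forces \<open>j\<close> and
  the dimension \<open>?n\<close> of \<open>ann t\<close> to vanish.\<close>

lemma not_good_structure:
  assumes "\<nexists>a. good a"
  obtains "ann t = {0}" "pairs.dim (ann (Suc t)) = 2" "\<And>s. s \<in> ann (Suc t) \<Longrightarrow> snd s = 0"
proof -
  let ?n = "pairs.dim (ann t)" and ?T = "ann (Suc t)"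
  obtain i w j where w: "w \<noteq> 0" "w \<in> free_piece j" "j + ?n + i \<le> t"
    "(shift ^^ i) ?T = multiples (t + 2 + i - j) w" "?T \<subseteq> multiples (t + 2 - j) w"
    "pairs.dim ?T + 2 * i \<le> t + 2 + i - j"
    by (rule rank_one_structure[OF subspace_ann ann_free_piece rank_one_ann[OF assms] dim_ann])
  obtain F where F: "finite F" "multiples (t + 2 - j) w \<subseteq> pairs.span F" using multiples_fd by blast
  have dimT: "pairs.dim ?T \<le> t + 2 - j"
    using pairs.dim_mono_fd[OF w(5) F(2,1)] by (simp add: dim_multiples[OF w(1)])
  \<comment> \<open>If \<open>i < t\<close>, then \<open>k\<close> more shifts reach degree
    \<open>2 * t\<close>, where all multiples of \<open>w\<close> lie in the annihilator, so
    \<open>w\<close> does too. Its \<open>t - j + 1\<close> independent multiples in degree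
    \<open>t\<close> make \<open>ann t\<close> too large.\<close>
  have it: "i = t"
  proof (rule ccontr)
    assume "i \<noteq> t"
    then have i: "i < t" using w(3) by simp
    define k where "k = t - 1 - i"
    have e: "Suc (t + 1 + i - j) = t + 2 + i - j" "Suc (t + 1 + i - j) + k = 2 * t + 1 - j"
      "Suc t + (k + i) = 2 * t" using i w(3) by (simp_all add: k_def)
    have "multiples (2 * t + 1 - j) w \<subseteq> (shift ^^ k) ((shift ^^ i) ?T)"
      using multiples_subset_shift_power[of "t + 1 + i - j" k w] unfolding e(2) unfolding e(1) w(4) .
    also have "\<dots> = (shift ^^ (k + i)) ?T" by (simp add: funpow_add)
    also have "\<dots> \<subseteq> ann (2 * t)"
      using shift_power_ann[of "Suc t" "k + i"] unfolding e(3) by simp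
    finally have "w \<in> ann j" using w(3) by (intro ann_of_multiples[OF w(2)]) auto
    then have "multiples (Suc (t - j)) w \<subseteq> ann t" using w(3) by (intro multiples_subset_ann) auto
    moreover obtain G :: "('k poly \<times> 'k poly) set" where "finite G" "free_piece t \<subseteq> pairs.span G"
      by (rule free_piece_fd)
    ultimately have "Suc (t - j) \<le> ?n"
      using pairs.dim_mono_fd[of "multiples (Suc (t - j)) w" "ann t" G] ann_free_piece[of t]
        dim_multiples[OF w(1)] by fastforce
    then show False using dimT dim_ann w(3) by linarith
  qed
  have n0: "?n = 0" "j = 0" using w(3) it by simp_all
  have "ann t = {0}"
  proof -
    obtain G :: "('k poly \<times> 'k poly) set" where G: "finite G" "free_piece t \<subseteq> pairs.span G"
      by (rule free_piece_fd)
    obtain B where "B \<subseteq> ann t" "pairs.independent B" "ann t \<subseteq> pairs.span B" "finite B" "card B = ?n"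
      by (rule pairs.finite_basis_exists[OF order_trans[OF ann_free_piece G(2)] G(1)])
    then have "ann t \<subseteq> pairs.span {}" using n0 by simp
    then show ?thesis using pairs.subspace_0[OF subspace_ann] by auto
  qed
  moreover have "pairs.dim ?T = 2" using w(6) it n0 dim_ann by simp
  \<comment> \<open>Here \<open>j = 0\<close>, so \<open>w\<close> lies in
    \<open>free_piece 0\<close>, whose second coordinate is zero.\<close>
  moreover have "snd s = 0" if "s \<in> ?T" for s
    using that w(2,5) n0 by (auto simp: multiples_def free_piece_def)
  ultimately show ?thesis by (rule that)
qed

text \<open>
  In the remaining case the annihilator in degree \<open>t + 1\<close> is spanned by two forms \<open>u, v\<close> in
  \<open>\<xi>, \<eta>\<close> only. The form \<open>\<xi> - r\<eta> + c\<zeta>\<close> acts through the polynomial \<open>Q c\<close>, up to sign its norm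
  over \<open>k[\<xi>,\<eta>]\<close>, which specialises to \<open>-(\<xi> - r\<eta>)\<^sup>2\<close> at \<open>c = 0\<close>. A double root \<open>r\<close> of a
  combination of \<open>u\<close> and \<open>v\<close> is a root of their Wronskian, so a general \<open>r\<close> makes
  multiplication by \<open>Q 0\<close>, hence by \<open>Q c\<close> for general \<open>c\<close>, injective modulo \<open>u, v\<close>.
\<close>

lemma good_exists: "\<exists>a. good a"
proof (rule ccontr)
  assume bad: "\<nexists>a. good a"
  obtain N: "ann t = {0}" and dim2: "pairs.dim (ann (Suc t)) = 2"
    and snd0: "\<And>s. s \<in> ann (Suc t) \<Longrightarrow> snd s = 0"
    by (rule not_good_structure[OF bad]) (rule that)
  obtain F :: "('k poly \<times> 'k poly) set" where F: "finite F" "free_piece (Suc t) \<subseteq> pairs.span F"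
    by (rule free_piece_fd)
  obtain B where B: "B \<subseteq> ann (Suc t)" "pairs.independent B" "ann (Suc t) \<subseteq> pairs.span B" "finite B"
      "card B = pairs.dim (ann (Suc t))"
    by (rule pairs.finite_basis_exists[OF order_trans[OF ann_free_piece F(2)] F(1)])
  then obtain x y where xy: "B = {x, y}" "x \<noteq> y" using dim2 by (metis card_2_iff)
  define u where "u = fst x"
  define v where "v = fst y"
  have x: "x = (u, 0)" and y: "y = (v, 0)"
    using B(1) snd0 unfolding xy u_def v_def by (auto simp: prod_eq_iff)
  have x_notin: "x \<notin> pairs.span {y}" and "y \<noteq> 0"
    using B(2) pairs.independent_insert[of x "{y}"] xy by auto
  then have v0: "v \<noteq> 0" by (simp add: y zero_prod_def)
  have "u \<noteq> smult c v" for c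
  proof
    assume "u = smult c v"
    then have "x = pmul [:c:] y" by (simp add: x y pmul_def)
    then have "x \<in> pairs.span {y}" using pairs.span_scale[OF pairs.span_base[of y "{y}"]] by simp
    then show False using x_notin by blast
  qed
  from wronskian_nonzero[OF v0 this] have "u * pderiv v - v * pderiv u \<noteq> 0" by simp
  then have "\<not> (\<forall>r. poly (u * pderiv v - v * pderiv u) r = 0)" by (simp only: poly_all_0_iff_0) simp
  then obtain r where r: "poly (u * pderiv v - v * pderiv u) r \<noteq> 0" by blast
  define \<rho> where "\<rho> = [:- r, 1:]"
  have \<rho>: "poly \<rho> r = 0" "\<rho> \<noteq> 0" by (simp_all add: \<rho>_def)
  have double_root: "p = 0" if "(\<rho> * \<rho> * p, 0) \<in> ann (Suc t)" for p
  proof -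
    have "(\<rho> * \<rho> * p, 0) \<in> pairs.span {x, y}" using that B(3) xy by blast
    then obtain \<alpha> where "(\<rho> * \<rho> * p, 0) - pmul [:\<alpha>:] x \<in> pairs.span {y}"
      unfolding pairs.span_breakdown_eq[of _ x] by blast
    then obtain \<beta> where "(\<rho> * \<rho> * p, 0) - pmul [:\<alpha>:] x - pmul [:\<beta>:] y \<in> pairs.span {}"
      unfolding pairs.span_breakdown_eq[of _ y] by blast
    then have eq: "\<rho> * \<rho> * p = smult \<alpha> u + smult \<beta> v"
      by (simp add: x y pmul_def prod_eq_iff algebra_simps)
    have "poly (\<rho> * \<rho> * p) r = 0" "poly (pderiv (\<rho> * \<rho> * p)) r = 0"
      by (simp_all add: \<rho> pderiv_mult)
    then have e: "\<alpha> * poly u r + \<beta> * poly v r = 0" "\<alpha> * poly (pderiv u) r + \<beta> * poly (pderiv v) r = 0"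
      unfolding eq by (simp_all add: pderiv_add pderiv_smult)
    \<comment> \<open>The two equations in \<open>e\<close> form a linear system for
      \<open>\<alpha>\<close> and \<open>\<beta>\<close> with the Wronskian at \<open>r\<close> as
      determinant.\<close>
    have "\<alpha> * (poly u r * poly (pderiv v) r - poly v r * poly (pderiv u) r)
        = poly (pderiv v) r * (\<alpha> * poly u r + \<beta> * poly v r)
          - poly v r * (\<alpha> * poly (pderiv u) r + \<beta> * poly (pderiv v) r)"
      by (simp add: algebra_simps)
    then have "\<alpha> = 0" unfolding e using r by simp
    moreover have "\<beta> * (poly u r * poly (pderiv v) r - poly v r * poly (pderiv u) r)
        = poly u r * (\<alpha> * poly (pderiv u) r + \<beta> * poly (pderiv v) r)
          - poly (pderiv u) r * (\<alpha> * poly u r + \<beta> * poly v r)"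
      by (simp add: algebra_simps)
    then have "\<beta> = 0" unfolding e using r by simp
    ultimately show "p = 0" using eq \<rho>(2) by simp
  qed
  define bb where "bb = [:b0, b1:]"
  define gg where "gg = [:g0, g1, g2:]"
  define Q where "Q c = - (\<rho> * \<rho>) + smult c (\<rho> * bb) - smult (c\<^sup>2) gg" for c
  define \<Phi> where "\<Phi> p w = \<phi> (H (Suc t) (p, 0) * H t w)" for p w
  \<comment> \<open>A polynomial of degree at most two whose value at \<open>c\<close> is
    \<open>\<Phi> (Q c * fst s) w\<close>. This is the shape that \<open>open_nondegenerate\<close>
    expects, with \<open>c\<close> as parameter.\<close>
  define M where "M s w = [:\<Phi> (- (\<rho> * \<rho>) * fst s) w, \<Phi> (\<rho> * bb * fst s) w, \<Phi> (- gg * fst s) w:]"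
    for s w :: "'k poly \<times> 'k poly"
  have H_pair_add: "H (Suc t) (p + p', 0) = H (Suc t) (p, 0) + H (Suc t) (p', 0)"
    and H_pair_smult: "H (Suc t) (smult c p, 0) = const c * H (Suc t) (p, 0)" for p p' c
    by (simp_all add: H_def hom_add hom_smult)
  have \<Phi>_add: "\<Phi> (p + p') w = \<Phi> p w + \<Phi> p' w" "\<Phi> p (w + w') = \<Phi> p w + \<Phi> p w'" for p p' w w'
    by (simp_all add: \<Phi>_def H_pair_add H_add distrib_left distrib_right \<phi>_add)
  have \<Phi>_smult: "\<Phi> (smult c p) w = c * \<Phi> p w" "\<Phi> p (pmul [:c:] w) = c * \<Phi> p w" for c p w
    by (simp_all add: \<Phi>_def H_pair_smult H_scale mult.assoc mult.left_commute[of _ "const c"] \<phi>_scale)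
  have poly_M: "poly (M s w) c = \<Phi> (Q c * fst s) w" for s w c
  proof -
    have "Q c * fst s = - (\<rho> * \<rho>) * fst s + (smult c (\<rho> * bb * fst s) + smult (c\<^sup>2) (- gg * fst s))"
      by (simp add: Q_def algebra_simps)
    then show ?thesis
      unfolding M_def by (simp only: \<Phi>_add \<Phi>_smult) (simp add: algebra_simps power2_eq_square)
  qed
  have deg: "2 * t + 1 - Suc t = t" by simp
  have \<Phi>_ann: "(p, 0) \<in> ann (Suc t)" if "p \<in> lowdeg (Suc (Suc t))" "\<And>w. w \<in> free_piece t \<Longrightarrow> \<Phi> p w = 0" for p
    using that by (intro annI) (simp_all add: free_piece_def \<Phi>_def deg)
  have rr: "\<rho> * \<rho> \<in> lowdeg (Suc (Suc (Suc 0)))"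
    by (simp add: \<rho>_def)
  \<comment> \<open>At \<open>c = 0\<close> the polynomial \<open>Q c\<close> is the negative square
    of \<open>\<rho>\<close>, so a radical element gives an annihilator with a double root at
    \<open>r\<close>.\<close>
  have at_0: "fst s = 0" if s: "fst s \<in> lowdeg t" "\<And>w. w \<in> free_piece t \<Longrightarrow> poly (M s w) 0 = 0" for s
  proof -
    have "\<rho> * \<rho> * fst s \<in> lowdeg (Suc (Suc 0) + t)" by (rule lowdeg_mult[OF rr s(1)])
    moreover have "\<Phi> (\<rho> * \<rho> * fst s) w = 0" if "w \<in> free_piece t" for w
      using s(2)[OF that] \<Phi>_smult(1)[of "-1" "\<rho> * \<rho> * fst s" w] unfolding poly_M by (simp add: Q_def)
    ultimately show ?thesis by (intro double_root \<Phi>_ann) simp_all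
  qed
  \<comment> \<open>Single polynomials are viewed as pairs with second coordinate in
    \<open>lowdeg 0\<close>, hence zero, so that the vector space \<open>pairs\<close> can be
    used.\<close>
  obtain G :: "('k poly \<times> 'k poly) set" where G: "finite G" "lowdeg t \<times> lowdeg 0 \<subseteq> pairs.span G"
    using free_fd by blast
  obtain D where D: "poly D 0 = 1" "\<And>c s w. poly D c \<noteq> 0 \<Longrightarrow> s \<in> lowdeg t \<times> lowdeg 0 \<Longrightarrow>
      (\<And>w. w \<in> free_piece t \<Longrightarrow> poly (M s w) c = 0) \<Longrightarrow> w \<in> free_piece t \<Longrightarrow> poly (M s w) 0 = 0"
  proof (rule pairs.open_nondegenerate[of "lowdeg t \<times> lowdeg 0" G "free_piece t" "\<lambda>c P. poly P c" M 0])
    fix c s w assume s: "s \<in> lowdeg t \<times> lowdeg 0" "\<And>w. w \<in> free_piece t \<Longrightarrow> poly (M s w) 0 = 0"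
    then have "fst s = 0" by (intro at_0) auto
    then show "poly (M s w) c = 0" using \<Phi>_smult(1)[of 0 0 w] by (simp add: poly_M)
  qed (simp_all add: G subspace_free subspace_free_piece poly_M distrib_left \<Phi>_add \<Phi>_smult that)
  have "D \<noteq> 0" using D(1) by auto
  \<comment> \<open>The additional factor makes \<open>c\<close> nonzero, as the division by
    \<open>c\<close> in the definition of \<open>m\<close> requires.\<close>
  then have "D * [:0, 1:] \<noteq> 0" by simp
  then have "\<not> (\<forall>c. poly (D * [:0, 1:]) c = 0)" by (simp only: poly_all_0_iff_0) simp
  then obtain c where c: "poly D c \<noteq> 0" "c \<noteq> 0" by auto
  obtain a0 where a0: "linear_form a0 = const 1 * \<xi> + const (- r) * \<eta> + const c * \<zeta>"
    using linear_form_exists by blast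
  have "good a0"
    unfolding good_def
  proof (intro ballI impI)
    fix f h :: "('v, 'k) mpol"
    assume f: "f \<in> forms t" "\<forall>b\<in>forms t. \<phi> (linear_form a0 * f * b) = 0"
    obtain a g where a: "a \<in> free_piece t" "f = H t a + q * g" using H_surj[OF f(1)] by blast
    define a' where "a' = pmul \<rho> a + pmul [:c:] (zmul a)"
    have "\<rho> \<in> lowdeg (Suc 1)" by (simp add: \<rho>_def)
    then have a'_piece: "a' \<in> free_piece (Suc t)"
      unfolding a'_def using pmul_free_piece[of \<rho> 1 a t] a(1)
      by (intro free_piece_add free_piece_scale zmul_free_piece) simp_all
    have "linear_form a0 * H t a = (const (- r) * \<eta> + const 1 * \<xi>) * H t a + const c * (\<zeta> * H t a)"
      unfolding a0 by (simp add: algebra_simps)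
    also have "\<dots> = H (Suc t) a' + q * (const c * (const \<kappa> * hom t (snd a)))"
      unfolding a'_def \<rho>_def H_add H_scale H_linear_mult[OF a(1)] H_zmul[OF a(1)]
      by (simp add: algebra_simps)
    finally have L: "linear_form a0 * f
        = H (Suc t) a' + q * (const c * (const \<kappa> * hom t (snd a)) + linear_form a0 * g)"
      unfolding a(2) by (simp add: algebra_simps)
    have a'_ann: "a' \<in> ann (Suc t)"
      using f(2) H_forms[of t] unfolding L \<phi>_mod_q by (intro annI[OF a'_piece]) (simp add: deg)
    \<comment> \<open>Since \<open>a'\<close> lies in the annihilator, its second coordinate is
      zero. This expresses \<open>fst a\<close> through \<open>m\<close>, and the first coordinate
      of \<open>a'\<close> becomes \<open>Q c * m\<close>.\<close>
    define m where "m = smult (1 / c) (snd a)"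
    have snd_a: "snd a = smult c m" using c(2) by (simp add: m_def)
    have m: "m \<in> lowdeg t" using a(1) by (auto simp: m_def free_piece_def intro: lowdeg_smult)
    have "smult c (\<rho> * m + fst a - smult c (bb * m)) = snd a'"
      unfolding a'_def zmul_def snd_add pmul_simps snd_conv snd_a bb_def[symmetric]
      by (simp add: algebra_simps smult_diff_right smult_add_right)
    then have "\<rho> * m + fst a - smult c (bb * m) = 0" using snd0[OF a'_ann] c(2) by simp
    then have fst_a: "fst a = smult c (bb * m) - \<rho> * m" by (simp add: algebra_simps)
    have "fst a' = Q c * m"
      unfolding a'_def zmul_def fst_add pmul_simps fst_conv snd_a fst_a gg_def[symmetric] Q_def
      by (simp add: algebra_simps power2_eq_square)
    then have a'_eq: "a' = (Q c * m, 0)" using snd0[OF a'_ann] by (simp add: prod_eq_iff)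
    have "poly (M (m, 0) w) c = 0" for w
      using annD[OF a'_ann, of "H t w"] H_forms[of t w] unfolding a'_eq poly_M \<Phi>_def by (simp add: deg)
    then have "poly (M (m, 0) w) 0 = 0" if "w \<in> free_piece t" for w
      by (intro D(2)[OF c(1) _ _ that]) (simp_all add: m)
    then have "m = 0" using at_0[of "(m, 0)"] m by simp
    then have "a = 0" using snd_a fst_a by (simp add: prod_eq_iff)
    then show "\<phi> (f * h) = 0" by (simp add: a(2) \<phi>_q')
  qed
  then show False using bad by blast
qed

end

lemma quadratic_form_expansion:
  assumes "q \<in> forms 2"
  shows "\<exists>c. q = (\<Sum>v\<in>UNIV. \<Sum>w\<in>UNIV. const (c v w) * (var v * var w))"
  using assms unfolding numeral_2_eq_2
proof (induction rule: forms_Suc_induct)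
  case zero
  show ?case by (intro exI[of _ "\<lambda>_ _. 0"]) simp
next
  case (var_mult v g)
  then obtain b where b: "g = linear_form b" using forms_1_linear_form by fastforce
  have "(\<Sum>v'\<in>UNIV. \<Sum>w\<in>UNIV. const (if v' = v then b w else 0) * (var v' * var w))
      = (\<Sum>v'\<in>UNIV. if v' = v then \<Sum>w\<in>UNIV. const (b w) * (var v * var w) else 0)"
    by (intro sum.cong) auto
  also have "\<dots> = var v * g"
    unfolding b linear_form_eq sum_distrib_left by (simp add: mult.left_commute)
  finally show ?case by (intro exI[of _ "\<lambda>v' w. if v' = v then b w else 0"]) (rule sym)
next
  case (add f g)
  then obtain c d where cd: "f = (\<Sum>v\<in>UNIV. \<Sum>w\<in>UNIV. const (c v w) * (var v * var w))"
    "g = (\<Sum>v\<in>UNIV. \<Sum>w\<in>UNIV. const (d v w) * (var v * var w))" by blast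
  have "f + g = (\<Sum>v\<in>UNIV. \<Sum>w\<in>UNIV. const (c v w + d v w) * (var v * var w))"
    unfolding cd const_add distrib_right sum.distrib ..
  then show ?case by (rule exI[of _ "\<lambda>v w. c v w + d v w"])
qed

text \<open>Coordinates are chosen to fit \<open>conic\<close>. If some square occurs in
  \<open>q\<close>, its variable serves as \<open>\<zeta>\<close>; otherwise a mixed product of
  variables \<open>v\<close> and \<open>w\<close> occurs, and substituting
  \<open>w = \<xi> + v\<close> creates the square of \<open>v\<close>.\<close>

theorem odd_socle_degree:
  fixes q :: "('v::finite, 'k::field_char_0) mpol" and \<phi> :: "('v, 'k) mpol \<Rightarrow> 'k"
  assumes card: "CARD('v) = 3" and q: "q \<in> forms 2" "q \<noteq> 0"
    and \<phi>_add: "\<And>f g. \<phi> (f + g) = \<phi> f + \<phi> g"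
    and \<phi>_scale: "\<And>c f. \<phi> (const c * f) = c * \<phi> f"
    and \<phi>_q: "\<And>r. \<phi> (q * r) = 0"
  shows "\<exists>a. \<forall>f\<in>forms t. (\<forall>b\<in>forms t. \<phi> (linear_form a * f * b) = 0) \<longrightarrow>
    (\<forall>c\<in>forms (Suc t). \<phi> (f * c) = 0)"
proof -
  obtain c where c: "q = (\<Sum>v\<in>UNIV. \<Sum>w\<in>UNIV. const (c v w) * (var v * var w))"
    using quadratic_form_expansion[OF q(1)] by blast
  have third: "\<exists>z. v \<noteq> z \<and> w \<noteq> z \<and> (UNIV :: 'v set) = {v, w, z}" if "v \<noteq> w" for v w :: 'v
  proof -
    have "card (UNIV - {v, w}) = 1" using card that by (simp add: card_Diff_subset)
    then obtain z where "UNIV - {v, w} = {z}" by (auto simp: card_1_singleton_iff)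
    then show ?thesis by (intro exI[of _ z]) auto
  qed
  have main: "?thesis" if "\<xi> \<in> forms 1" "\<eta> \<in> forms 1" "\<zeta> \<in> forms 1"
    "\<And>v. \<exists>x y z. var v = const x * \<xi> + const y * \<eta> + const z * \<zeta>"
    "\<zeta> * \<zeta> + (const b0 * \<eta> + const b1 * \<xi>) * \<zeta>
      + (const g0 * \<eta> * \<eta> + const g1 * \<xi> * \<eta> + const g2 * \<xi> * \<xi>) = const \<kappa> * q"
    for \<xi> \<eta> \<zeta> b0 b1 g0 g1 g2 \<kappa>
  proof -
    interpret conic \<xi> \<eta> \<zeta> q b0 b1 g0 g1 g2 \<kappa> \<phi> t
      by unfold_locales (fact that \<phi>_add \<phi>_scale \<phi>_q)+
    show ?thesis using good_exists unfolding good_def .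
  qed
  show ?thesis
  proof (cases "\<exists>v. c v v \<noteq> 0")
    case True
    then obtain v where v: "c v v \<noteq> 0" by blast
    have "card (UNIV - {v}) = 2" using card by simp
    then obtain x where "x \<in> UNIV - {v}" by (metis card.empty ex_in_conv zero_neq_numeral)
    then have vx: "v \<noteq> x" by blast
    obtain y where y: "v \<noteq> y" "x \<noteq> y" "UNIV = {v, x, y}" using third[OF vx] by blast
    show ?thesis
    proof (rule main)
      show "\<exists>p r s. (var w :: ('v, 'k) mpol) = const p * var x + const r * var y + const s * var v" for w
      proof -
        have "w = v \<or> w = x \<or> w = y" using y(3) by blast
        moreover have "var v = const 0 * var x + const 0 * var y + const 1 * (var v :: ('v, 'k) mpol)"
          "var x = const 1 * var x + const 0 * var y + const 0 * (var v :: ('v, 'k) mpol)"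
          "var y = const 0 * var x + const 1 * var y + const 0 * (var v :: ('v, 'k) mpol)" by simp_all
        ultimately show ?thesis by blast
      qed
      let ?k = "1 / c v v"
      have qe: "q = const (c v v) * (var v * var v) + const (c v x + c x v) * (var v * var x)
          + const (c v y + c y v) * (var v * var y) + const (c x x) * (var x * var x)
          + const (c x y + c y x) * (var x * var y) + const (c y y) * (var y * var y)"
        unfolding c y(3) using vx y(1,2) by (simp add: const_add algebra_simps)
      have k: "const ?k * const (c v v) = 1" using v by (simp add: const_mult[symmetric])
      have "const ?k * q = (const ?k * const (c v v)) * (var v * var v)
          + const (?k * (c v x + c x v)) * (var v * var x)
          + const (?k * (c v y + c y v)) * (var v * var y) + const (?k * c x x) * (var x * var x)
          + const (?k * (c x y + c y x)) * (var x * var y) + const (?k * c y y) * (var y * var y)"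
        unfolding qe const_mult by (simp only: distrib_left mult.assoc)
      then show "var v * var v + (const (?k * (c v y + c y v)) * var y + const (?k * (c v x + c x v)) * var x) * var v
          + (const (?k * c y y) * var y * var y + const (?k * (c x y + c y x)) * var x * var y
            + const (?k * c x x) * var x * var x) = const ?k * q"
        unfolding k by (simp only: mult_1_left distrib_left distrib_right ac_simps)
    qed (rule forms_var)+
  next
    case False
    then have diag: "c v v = 0" for v by blast
    \<comment> \<open>If the symmetrised coefficients vanished as well, swapping the two summation
      indices would give \<open>q = - q\<close>, impossible for nonzero \<open>q\<close> in
      characteristic zero.\<close>
    have "\<exists>v w. v \<noteq> w \<and> c v w + c w v \<noteq> 0"
    proof (rule ccontr)
      assume "\<not> ?thesis"
      then have anti: "c w v = - c v w" for v w
        using diag by (cases "v = w") (auto simp: eq_neg_iff_add_eq_0 add.commute)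
      have "q = (\<Sum>w\<in>UNIV. \<Sum>v\<in>UNIV. const (c v w) * (var v * var w))"
        unfolding c by (rule sum.swap)
      also have "\<dots> = - q"
        unfolding c sum_negf[symmetric]
        by (intro sum.cong refl) (subst anti, simp add: const_uminus mult.commute)
      finally have "lookup q m = - lookup q m" for m by (metis lookup_uminus)
      then have "2 * lookup q m = 0" for m unfolding mult_2 eq_neg_iff_add_eq_0 .
      then show False using q(2) by (simp add: poly_mapping_eq_iff fun_eq_iff)
    qed
    then obtain v w where vw: "v \<noteq> w" "c v w + c w v \<noteq> 0" by blast
    obtain y where y: "v \<noteq> y" "w \<noteq> y" "UNIV = {v, w, y}" using third[OF vw(1)] by blast
    let ?C = "c v w + c w v"
    let ?\<xi> = "var w - var v :: ('v, 'k) mpol"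
    show ?thesis
    proof (rule main)
      show "?\<xi> \<in> forms 1" by (intro forms_diff forms_var)
      show "\<exists>p r s. var u = const p * ?\<xi> + const r * var y + const s * var v" for u
      proof -
        have "u = v \<or> u = w \<or> u = y" using y(3) by blast
        moreover have "var v = const 0 * ?\<xi> + const 0 * var y + const 1 * var v"
          "var w = const 1 * ?\<xi> + const 0 * var y + const 1 * var v"
          "var y = const 0 * ?\<xi> + const 1 * var y + const 0 * var v" by simp_all
        ultimately show ?thesis by blast
      qed
      let ?d = "c v y + c y v" and ?e = "c w y + c y w"
      have qe: "q = const ?C * (var v * var w) + const ?d * (var v * var y) + const ?e * (var w * var y)"
        unfolding c y(3) using vw(1) y(1,2) diag by (simp add: const_add algebra_simps)
      have k: "const (1 / ?C) * const ?C = 1" using vw(2) by (simp add: const_mult[symmetric])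
      have "const (1 / ?C) * q = (const (1 / ?C) * const ?C) * (var v * var w)
          + const (1 / ?C * ?d) * (var v * var y) + const (1 / ?C * ?e) * (var w * var y)"
        unfolding qe const_mult by (simp only: distrib_left mult.assoc)
      then have qe': "const (1 / ?C) * q
          = var v * var w + const (?d / ?C) * (var v * var y) + const (?e / ?C) * (var w * var y)"
        unfolding k by simp
      have w: "var w = ?\<xi> + var v" by simp
      show "var v * var v + (const ((?d + ?e) / ?C) * var y + const 1 * ?\<xi>) * var v
          + (const 0 * var y * var y + const (?e / ?C) * ?\<xi> * var y + const 0 * ?\<xi> * ?\<xi>)
          = const (1 / ?C) * q"
        unfolding qe' add_divide_distrib const_add by (simp add: algebra_simps)
    qed (rule forms_var)+
  qed
qed

section \<open>Gorenstein quotients\<close>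

context
  fixes I :: "('v::finite, 'k::field) mpol set"
  assumes hom_ideal: "homogeneous_ideal I"
begin

section \<open>Homogeneous ideals and residue classes\<close>

lemma ideal_I: "ideal I poly_ring"
  using hom_ideal by (simp add: homogeneous_ideal_def)

lemma component_in_ideal: "f \<in> I \<Longrightarrow> component d f \<in> I"
  using hom_ideal by (simp add: homogeneous_ideal_def)

lemma poly_ring_simps: "carrier poly_ring = UNIV" "x \<otimes>\<^bsub>poly_ring\<^esub> y = x * y" "x \<oplus>\<^bsub>poly_ring\<^esub> y = x + y"
  "\<zero>\<^bsub>poly_ring\<^esub> = 0" "\<one>\<^bsub>poly_ring\<^esub> = 1" for x y :: "('v, 'k) mpol"
  by (simp_all add: ring_of_type_algebra_def)

lemma ideal_zero: "0 \<in> I"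
  and ideal_add: "f \<in> I \<Longrightarrow> g \<in> I \<Longrightarrow> f + g \<in> I"
  and ideal_mult: "f \<in> I \<Longrightarrow> g * f \<in> I"
  and ideal_mult_right: "f \<in> I \<Longrightarrow> f * g \<in> I"
  using additive_subgroup.zero_closed[OF ideal.axioms(1)[OF ideal_I]]
    additive_subgroup.a_closed[OF ideal.axioms(1)[OF ideal_I], of f g]
    ideal.I_l_closed[OF ideal_I, of f g] ideal.I_r_closed[OF ideal_I, of f g]
  by (simp_all add: poly_ring_simps)

lemma ideal_uminus: "f \<in> I \<Longrightarrow> - f \<in> I"
  using ideal_mult[of f "- 1"] by simp

lemma ideal_diff: "f \<in> I \<Longrightarrow> g \<in> I \<Longrightarrow> f - g \<in> I"
  using ideal_add[of f "- g"] ideal_uminus[of g] by simp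

lemma residue_class_eq: "residue_class I f = residue_class I g \<longleftrightarrow> f - g \<in> I"
proof -
  have rc: "residue_class I h = (\<lambda>i. i + h) ` I" for h
    unfolding residue_class_def a_r_coset_def' poly_ring_simps by blast
  show ?thesis
  proof
    assume "residue_class I f = residue_class I g"
    then have "0 + f \<in> (\<lambda>i. i + g) ` I" using ideal_zero unfolding rc by blast
    then show "f - g \<in> I" by force
  next
    assume fg: "f - g \<in> I"
    have "i + f = (i + (f - g)) + g" "i + g = (i - (f - g)) + f" for i by simp_all
    then show "residue_class I f = residue_class I g"
      unfolding rc using ideal_add[OF _ fg] ideal_diff[OF _ fg] by (auto simp: image_iff; metis)
  qed
qed

lemma residue_class_mult: "residue_class I f \<otimes>\<^bsub>quot I\<^esub> residue_class I g = residue_class I (f * g)"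
  using ideal.rcoset_mult_add[OF ideal_I, of f g]
  by (simp add: residue_class_def FactRing_def poly_ring_simps)

lemma residue_class_add: "residue_class I f \<oplus>\<^bsub>quot I\<^esub> residue_class I g = residue_class I (f + g)"
  using ideal.a_rcos_sum[OF ideal_I, of f g]
  by (simp add: residue_class_def FactRing_def poly_ring_simps)

lemma residue_class_zero: "\<zero>\<^bsub>quot I\<^esub> = residue_class I 0"
proof -
  have "residue_class I 0 = I"
    unfolding residue_class_def a_r_coset_def' poly_ring_simps by simp
  then show ?thesis by (simp add: FactRing_def)
qed

lemma carrier_quot: "carrier (quot I) = range (residue_class I)"
  by (auto simp: FactRing_def A_RCOSETS_def' residue_class_def poly_ring_simps)

text \<open>The classes of polynomials of order at least \<open>n\<close> form a descending chain of
  ideals. Once it is stationary at \<open>N\<close>, a form of degree \<open>N\<close> agrees modulo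
  \<open>I\<close> with a polynomial of higher order, and the degree \<open>N\<close> component of
  the difference is the form itself.\<close>

lemma artinian_imp_forms_subset:
  assumes "artinian_ring (quot I)"
  shows "\<exists>N. forms N \<subseteq> I"
proof -
  interpret Q: ring "quot I" by (rule ideal.quotient_is_ring[OF ideal_I])
  define high :: "nat \<Rightarrow> ('v, 'k) mpol set" where "high n = {f. \<forall>m\<in>keys f. n \<le> mon_degree m}" for n
  have high_0: "0 \<in> high n" for n by (simp add: high_def)
  have high_uminus: "- f \<in> high n" if "f \<in> high n" for f n
    using that by (simp add: high_def)
  have high_add: "f + g \<in> high n" if "f \<in> high n" "g \<in> high n" for f g n
    using that keys_add[of f g] by (auto simp: high_def)
  have high_mult: "g * f \<in> high n" if "f \<in> high n" for f g n
    unfolding high_def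
  proof (intro CollectI ballI)
    fix m assume "m \<in> keys (g * f)"
    then obtain a b where "m = a + b" "b \<in> keys f" using keys_mult[of g f] by blast
    then show "n \<le> mon_degree m" using that by (auto simp: high_def mon_degree_add trans_le_add2)
  qed
  define J where "J n = residue_class I ` high n" for n
  have "ideal (J n) (quot I)" for n
  proof (rule idealI[OF Q.ring_axioms])
    show "subgroup (J n) (add_monoid (quot I))"
    proof
      show "J n \<subseteq> carrier (add_monoid (quot I))" by (auto simp: J_def carrier_quot)
    next
      fix x y assume "x \<in> J n" "y \<in> J n"
      then show "x \<otimes>\<^bsub>add_monoid (quot I)\<^esub> y \<in> J n"
        by (auto simp: J_def residue_class_add high_add)
    next
      show "\<one>\<^bsub>add_monoid (quot I)\<^esub> \<in> J n" by (auto simp: J_def residue_class_zero high_0)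
    next
      fix x assume "x \<in> J n"
      then obtain f where f: "f \<in> high n" "x = residue_class I f" by (auto simp: J_def)
      have "\<ominus>\<^bsub>quot I\<^esub> x = residue_class I (- f)"
        by (rule Q.minus_equality)
          (simp_all add: f residue_class_add residue_class_zero carrier_quot)
      then show "inv\<^bsub>add_monoid (quot I)\<^esub> x \<in> J n"
        using high_uminus[OF f(1)] by (auto simp: J_def a_inv_def)
    qed
  next
    fix a x assume "a \<in> J n" "x \<in> carrier (quot I)"
    then obtain f g where fg: "f \<in> high n" "a = residue_class I f" "x = residue_class I g"
      by (auto simp: J_def carrier_quot)
    show "x \<otimes>\<^bsub>quot I\<^esub> a \<in> J n" "a \<otimes>\<^bsub>quot I\<^esub> x \<in> J n"
      using high_mult[OF fg(1), of g] by (auto simp: fg(2,3) residue_class_mult J_def mult.commute)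
  qed
  moreover have "J (Suc n) \<subseteq> J n" for n
    unfolding J_def by (intro image_mono) (auto simp: high_def)
  ultimately have "\<exists>N. \<forall>n\<ge>N. J n = J N" using assms unfolding artinian_ring_def by blast
  then obtain N where N: "\<forall>n\<ge>N. J n = J N" by blast
  have "f \<in> I" if f: "f \<in> forms N" for f
  proof -
    have "residue_class I f \<in> J N" using f by (auto simp: J_def high_def forms_def)
    also have "J N = J (Suc N)" using N[rule_format, of "Suc N"] by simp
    finally obtain g where g: "g \<in> high (Suc N)" "f - g \<in> I" by (auto simp: J_def residue_class_eq)
    have "component N g = 0"
    proof (rule poly_mapping_eqI)
      fix k
      have "k \<notin> keys g \<or> mon_degree k \<noteq> N" using g(1) by (auto simp: high_def)
      then show "lookup (component N g) k = lookup 0 k" by (auto simp: lookup_component in_keys_iff)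
    qed
    then have "component N (f - g) = f" using component_of_form[OF f, of N] by (simp add: component_diff)
    then show ?thesis using component_in_ideal[OF g(2), of N] by simp
  qed
  then show ?thesis by blast
qed

lemma forms_Suc_subset:
  assumes "forms n \<subseteq> I"
  shows "forms (Suc n) \<subseteq> I"
proof
  fix f :: "('v, 'k) mpol" assume "f \<in> forms (Suc n)"
  then show "f \<in> I"
    using assms by (induction rule: forms_Suc_induct) (auto intro: ideal_zero ideal_mult ideal_add)
qed

lemma socle_iff: "residue_class I f \<in> socle I \<longleftrightarrow> (\<forall>l\<in>forms 1. l * f \<in> I)"
  by (auto simp: socle_def carrier_quot graded_piece_def residue_class_mult residue_class_zero residue_class_eq)

lemma socle_generator:
  assumes "ring.dimension (quot I) 1 (scalars I) (socle I)"
  obtains g where "g \<notin> I" "\<And>f. (\<forall>l\<in>forms 1. l * f \<in> I) \<Longrightarrow> \<exists>c. f - const c * g \<in> I"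
proof -
  interpret Q: ring "quot I" by (rule ideal.quotient_is_ring[OF ideal_I])
  obtain v where v: "v \<in> carrier (quot I)" "v \<noteq> \<zero>\<^bsub>quot I\<^esub>"
    "socle I = Q.line_extension (scalars I) v {\<zero>\<^bsub>quot I\<^esub>}"
    using assms
  proof (cases rule: Q.dimension.cases)
    case (Suc_dim v E)
    then have "Q.dimension 0 (scalars I) E" by simp
    then have "E = {\<zero>\<^bsub>quot I\<^esub>}" by (cases rule: Q.dimension.cases) simp_all
    then show ?thesis using that[of v] Suc_dim by simp
  qed simp
  obtain g where g: "v = residue_class I g" using v(1) by (auto simp: carrier_quot)
  show ?thesis
  proof (rule that)
    show "g \<notin> I" using v(2) by (simp add: g residue_class_zero residue_class_eq)
  next
    fix f assume "\<forall>l\<in>forms 1. l * f \<in> I"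
    then have "residue_class I f \<in> Q.line_extension (scalars I) v {\<zero>\<^bsub>quot I\<^esub>}"
      using socle_iff v(3) by simp
    then obtain c where "residue_class I f = residue_class I (const c * g + 0)"
      unfolding Q.line_extension_mem_iff
      by (auto simp: scalars_def g residue_class_zero residue_class_mult residue_class_add)
    then have "f - const c * g \<in> I" by (simp add: residue_class_eq)
    then show "\<exists>c. f - const c * g \<in> I" by (rule exI)
  qed
qed

text \<open>\<open>e\<close> is the last degree in which \<open>I\<close> does not contain all
  forms, so forms of degree \<open>e\<close> lie in the socle and are multiples of one form
  \<open>h\<close> modulo \<open>I\<close>; \<open>\<phi>\<close> reads off the factor.
  Nondegeneracy goes by descending induction on \<open>m\<close>: all \<open>l * f\<close> lie in
  \<open>I\<close>, so \<open>f\<close> is in the socle, which is spanned by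
  \<open>h\<close>.\<close>

lemma gorenstein_duality:
  assumes "artinian_gorenstein I"
  obtains e \<phi> where "\<And>f g. \<phi> (f + g) = \<phi> f + \<phi> g" "\<And>c f. \<phi> (const c * f) = c * \<phi> f"
    "\<And>f. f \<in> I \<Longrightarrow> \<phi> f = 0" "\<And>m. e < m \<Longrightarrow> forms m \<subseteq> I"
    "\<And>m f. m \<le> e \<Longrightarrow> f \<in> forms m \<Longrightarrow> (\<forall>g\<in>forms (e - m). \<phi> (f * g) = 0) \<Longrightarrow> f \<in> I"
proof -
  have dim: "ring.dimension (quot I) 1 (scalars I) (socle I)"
    using assms by (simp only: artinian_gorenstein_def)
  obtain g0 where g0: "g0 \<notin> I" "\<And>f. (\<forall>l\<in>forms 1. l * f \<in> I) \<Longrightarrow> \<exists>c. f - const c * g0 \<in> I"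
    by (rule socle_generator[OF dim]) (rule that)
  obtain N where N: "forms N \<subseteq> I"
    using artinian_imp_forms_subset assms by (auto simp: artinian_gorenstein_def)
  have beyond: "forms (N + k) \<subseteq> I" for k
    by (induction k) (use N forms_Suc_subset in auto)
  define P where "P m \<longleftrightarrow> \<not> forms m \<subseteq> I" for m
  have bound: "\<forall>m. P m \<longrightarrow> m \<le> N"
  proof (intro allI impI)
    fix m assume "P m"
    then show "m \<le> N" using beyond[of "m - N"] by (cases "N \<le> m") (auto simp: P_def)
  qed
  have "1 \<notin> I" using g0(1) ideal_mult[of 1 g0] by auto
  then have "P 0" using forms_1 by (auto simp: P_def)
  define e where "e = Greatest P"
  have "P e" unfolding e_def using GreatestI_nat[of P 0 N] \<open>P 0\<close> bound by blast
  have e_max: "forms m \<subseteq> I" if "e < m" for m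
    using that Greatest_le_nat[of P m N] bound unfolding e_def[symmetric] P_def by fastforce
  obtain h where h: "h \<in> forms e" "h \<notin> I" using \<open>P e\<close> by (auto simp: P_def)
  have top_socle: "\<forall>l\<in>forms 1. l * f \<in> I" if "f \<in> forms e" for f
    using e_max[of "Suc e"] forms_mult[OF _ that, of _ 1] by auto
  \<comment> \<open>The generator \<open>g0\<close> need not be homogeneous; it is exchanged for the
    form \<open>h\<close>, a nonzero multiple of it modulo \<open>I\<close>.\<close>
  have socle: "\<exists>c. f - const c * h \<in> I" if f: "\<forall>l\<in>forms 1. l * f \<in> I" for f
  proof -
    obtain d where d: "h - const d * g0 \<in> I" using g0(2)[OF top_socle[OF h(1)]] by blast
    have d0: "d \<noteq> 0" using d h(2) by auto
    obtain c where c: "f - const c * g0 \<in> I" using g0(2)[OF f] by blast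
    have "f - const c * g0 - const (c / d) * (h - const d * g0) \<in> I"
      by (rule ideal_diff[OF c ideal_mult[OF d]])
    also have "f - const c * g0 - const (c / d) * (h - const d * g0) = f - const (c / d) * h"
      using d0 by (simp add: right_diff_distrib mult.assoc[symmetric] const_mult[symmetric])
    finally show ?thesis by blast
  qed
  have unique: "c = d" if "f - const c * h \<in> I" "f - const d * h \<in> I" for f c d
  proof (rule ccontr)
    assume "c \<noteq> d"
    have "(f - const d * h) - (f - const c * h) \<in> I" by (rule ideal_diff[OF that(2,1)])
    then have "const (1 / (c - d)) * ((f - const d * h) - (f - const c * h)) \<in> I" by (rule ideal_mult)
    also have "const (1 / (c - d)) * ((f - const d * h) - (f - const c * h)) = const (1 / (c - d)) * const (c - d) * h"
      by (simp add: const_diff algebra_simps)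
    also have "\<dots> = h" using \<open>c \<noteq> d\<close> by (simp add: const_mult[symmetric])
    finally show False using h(2) by blast
  qed
  define \<phi> where "\<phi> f = (THE c. component e f - const c * h \<in> I)" for f
  have \<phi>: "component e f - const (\<phi> f) * h \<in> I" for f
  proof -
    obtain c where c: "component e f - const c * h \<in> I"
      using socle[OF top_socle[OF component_forms]] by blast
    show ?thesis unfolding \<phi>_def by (rule theI, rule c, rule unique[OF _ c])
  qed
  have \<phi>_eq: "\<phi> f = c" if "component e f - const c * h \<in> I" for f c
    using unique[OF \<phi> that] .
  have dual: "f \<in> I" if "m \<le> e" "f \<in> forms m" "\<And>g. g \<in> forms (e - m) \<Longrightarrow> \<phi> (f * g) = 0" for m f
    using that
  proof (induction "e - m" arbitrary: m f)
    case 0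
    then have m: "m = e" by simp
    have "\<phi> f = 0" using "0.prems"(3)[of 1] forms_1 by (simp add: m)
    then show ?case using \<phi>[of f] "0.prems"(2) component_of_form[of f e e] by (simp add: m)
  next
    case (Suc k)
    have "l * f \<in> I" if l: "l \<in> forms 1" for l
    proof (rule Suc.hyps(1)[of "Suc m"])
      show "k = e - Suc m" "Suc m \<le> e" using Suc.hyps(2) by simp_all
      show "l * f \<in> forms (Suc m)" using forms_mult[OF l Suc.prems(2)] by simp
      fix g :: "('v, 'k) mpol" assume "g \<in> forms (e - Suc m)"
      then have "l * g \<in> forms (1 + (e - Suc m))" by (rule forms_mult[OF l])
      moreover have "1 + (e - Suc m) = e - m" using Suc.hyps(2) by simp
      ultimately show "\<phi> (l * f * g) = 0"
        using Suc.prems(3)[of "l * g"] by (simp add: algebra_simps)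
    qed
    then obtain c where "f - const c * h \<in> I" using socle by blast
    \<comment> \<open>\<open>h\<close> has degree \<open>e\<close>, different from \<open>m\<close>,
      so passing to the degree \<open>m\<close> component removes it.\<close>
    then have "component m (f - const c * h) \<in> I" by (rule component_in_ideal)
    moreover have "m \<noteq> e" using Suc.hyps(2) by auto
    ultimately show ?case
      using component_of_form[OF Suc.prems(2), of m] component_of_form[OF h(1), of m]
      by (simp add: component_diff component_const_mult)
  qed
  show ?thesis
  proof (rule that[of \<phi> e])
    fix f g
    have "component e (f + g) - const (\<phi> f + \<phi> g) * h
        = (component e f - const (\<phi> f) * h) + (component e g - const (\<phi> g) * h)"
      by (simp add: component_add const_add algebra_simps)
    then show "\<phi> (f + g) = \<phi> f + \<phi> g" by (intro \<phi>_eq) (simp add: ideal_add \<phi>)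
  next
    fix c f
    have "component e (const c * f) - const (c * \<phi> f) * h = const c * (component e f - const (\<phi> f) * h)"
      unfolding component_const_mult const_mult by (simp only: right_diff_distrib mult.assoc)
    then show "\<phi> (const c * f) = c * \<phi> f" by (intro \<phi>_eq) (simp add: ideal_mult \<phi>)
  next
    fix f assume "f \<in> I"
    then show "\<phi> f = 0" by (intro \<phi>_eq) (simp add: component_in_ideal)
  qed (use e_max dual in blast)+
qed

section \<open>Maximal rank in terms of representatives\<close>

lemma max_rank_at_injective:
  assumes "\<And>f. f \<in> forms i \<Longrightarrow> l * f \<in> I \<Longrightarrow> f \<in> I"
  shows "max_rank_at I (residue_class I l) i"
  unfolding max_rank_at_def
proof (intro disjI1 inj_onI)
  fix x y assume "x \<in> graded_piece I i" "y \<in> graded_piece I i"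
  then obtain f g where fg: "f \<in> forms i" "g \<in> forms i" "x = residue_class I f" "y = residue_class I g"
    by (auto simp: graded_piece_def)
  assume "residue_class I l \<otimes>\<^bsub>quot I\<^esub> x = residue_class I l \<otimes>\<^bsub>quot I\<^esub> y"
  then have "l * (f - g) \<in> I" by (simp add: fg residue_class_mult residue_class_eq right_diff_distrib)
  then show "x = y" using assms[OF forms_diff[OF fg(1,2)]] by (simp add: fg residue_class_eq)
qed

lemma max_rank_at_surjective:
  assumes "l \<in> forms 1" "\<And>h. h \<in> forms (Suc i) \<Longrightarrow> \<exists>f\<in>forms i. h - l * f \<in> I"
  shows "max_rank_at I (residue_class I l) i"
  unfolding max_rank_at_def
proof (intro disjI2 equalityI subsetI)
  fix x assume "x \<in> (\<lambda>a. residue_class I l \<otimes>\<^bsub>quot I\<^esub> a) ` graded_piece I i"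
  then obtain f where f: "f \<in> forms i" "x = residue_class I (l * f)"
    by (auto simp: graded_piece_def residue_class_mult)
  then show "x \<in> graded_piece I (i + 1)"
    using forms_mult[OF assms(1) f(1)] by (auto simp: graded_piece_def)
next
  fix x assume "x \<in> graded_piece I (i + 1)"
  then obtain h where h: "h \<in> forms (Suc i)" "x = residue_class I h" by (auto simp: graded_piece_def)
  obtain f where f: "f \<in> forms i" "h - l * f \<in> I" using assms(2)[OF h(1)] by blast
  have "x = residue_class I l \<otimes>\<^bsub>quot I\<^esub> residue_class I f"
    using f(2) by (simp add: h(2) residue_class_mult residue_class_eq)
  then show "x \<in> (\<lambda>a. residue_class I l \<otimes>\<^bsub>quot I\<^esub> a) ` graded_piece I i"
    using f(1) by (auto simp: graded_piece_def)
qed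

end

section \<open>Open sets of good linear forms\<close>

lemma functional_linear_form:
  assumes "\<And>f g. \<phi> (f + g) = \<phi> f + \<phi> g" "\<And>c f. \<phi> (const c * f) = c * \<phi> f"
  shows "\<phi> (linear_form a * f) = (\<Sum>v\<in>UNIV. a v * \<phi> (var v * f))"
proof -
  have \<phi>_0: "\<phi> 0 = 0" using assms(2)[of 0 0] by simp
  have sum: "\<phi> (sum g A) = (\<Sum>v\<in>A. \<phi> (g v))" if "finite A" for g A
    using that by (induction A rule: finite_induct) (simp_all add: assms(1) \<phi>_0)
  show ?thesis
    unfolding linear_form_eq sum_distrib_right mult.assoc by (simp add: sum assms(2))
qed

text \<open>The values \<open>\<phi> (linear_form a * f * b)\<close> are linear in \<open>a\<close>,
  so \<open>open_nondegenerate\<close> spreads the one form from \<open>odd_socle_degree\<close> to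
  an open set. Its radical condition holds because an \<open>f\<close> in the radical at
  \<open>a0\<close> pairs to zero with all forms of degree \<open>t + 1\<close>.\<close>

lemma odd_socle_degree_open:
  fixes q :: "('v::finite, 'k::field_char_0) mpol" and \<phi> :: "('v, 'k) mpol \<Rightarrow> 'k"
  assumes card: "CARD('v) = 3" and q: "q \<in> forms 2" "q \<noteq> 0"
    and \<phi>_add: "\<And>f g. \<phi> (f + g) = \<phi> f + \<phi> g"
    and \<phi>_scale: "\<And>c f. \<phi> (const c * f) = c * \<phi> f"
    and \<phi>_q: "\<And>r. \<phi> (q * r) = 0"
  shows "\<exists>D a0. eval_at a0 D \<noteq> 0 \<and> (\<forall>a. eval_at a D \<noteq> 0 \<longrightarrow> (\<forall>f\<in>forms t.
    (\<forall>b\<in>forms t. \<phi> (linear_form a * f * b) = 0) \<longrightarrow> (\<forall>c\<in>forms (Suc t). \<phi> (f * c) = 0)))"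
proof -
  obtain a0 where a0: "\<And>f c. f \<in> forms t \<Longrightarrow> (\<And>b. b \<in> forms t \<Longrightarrow> \<phi> (linear_form a0 * f * b) = 0) \<Longrightarrow>
      c \<in> forms (Suc t) \<Longrightarrow> \<phi> (f * c) = 0"
    using odd_socle_degree[of q \<phi> t, OF card q \<phi>_add \<phi>_scale \<phi>_q] by blast
  define B where "B f b = linear_form (\<lambda>v. \<phi> (var v * (f * b)))" for f b
  have B: "eval_at a (B f b) = \<phi> (linear_form a * f * b)" for a f b
    unfolding B_def eval_at_linear_form mult.assoc[of "linear_form a"]
      functional_linear_form[of \<phi> a "f * b", OF \<phi>_add \<phi>_scale] by (intro sum.cong refl mult.commute)
  obtain F :: "('v, 'k) mpol set" where F: "finite F" "forms t \<subseteq> mpol.span F" by (rule forms_fd)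
  obtain D where D: "eval_at a0 D = 1" "\<And>a f b. eval_at a D \<noteq> 0 \<Longrightarrow> f \<in> forms t \<Longrightarrow>
      (\<And>b. b \<in> forms t \<Longrightarrow> eval_at a (B f b) = 0) \<Longrightarrow> b \<in> forms t \<Longrightarrow> eval_at a0 (B f b) = 0"
  proof (rule mpol.open_nondegenerate[of "forms t" F "forms t" eval_at B a0])
    fix a :: "'v \<Rightarrow> 'k" and f b :: "('v, 'k) mpol"
    assume f: "f \<in> forms t" "\<And>b. b \<in> forms t \<Longrightarrow> eval_at a0 (B f b) = 0" and b: "b \<in> forms t"
    have "linear_form a * b \<in> forms (Suc t)" using forms_mult[OF linear_form_forms b] by simp
    then have "\<phi> (f * (linear_form a * b)) = 0" using a0[OF f(1)] f(2) unfolding B by blast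
    then show "eval_at a (B f b) = 0" unfolding B by (simp add: ac_simps)
  next
    show "eval_at a (B (const c * f) b) = c * eval_at a (B f b)" for a c f b
      unfolding B \<phi>_scale[symmetric] by (simp add: ac_simps)
    show "eval_at a (B f (const c * b)) = c * eval_at a (B f b)" for a c f b
      unfolding B \<phi>_scale[symmetric] by (simp add: ac_simps)
  qed (simp_all add: subspace_forms F eval_at_mult eval_at_diff B distrib_left distrib_right \<phi>_add that)
  show ?thesis
  proof (intro exI[of _ D] exI[of _ a0] conjI allI impI ballI)
    show "eval_at a0 D \<noteq> 0" using D(1) by simp
    fix a :: "'v \<Rightarrow> 'k" and f c :: "('v, 'k) mpol"
    assume a: "eval_at a D \<noteq> 0" and f: "f \<in> forms t" "\<forall>b\<in>forms t. \<phi> (linear_form a * f * b) = 0"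
      and c: "c \<in> forms (Suc t)"
    show "\<phi> (f * c) = 0"
    proof (rule a0[OF f(1) _ c])
      fix b :: "('v, 'k) mpol" assume "b \<in> forms t"
      then show "\<phi> (linear_form a0 * f * b) = 0" using D(2)[OF a f(1), of b] f(2) unfolding B by blast
    qed
  qed
qed

lemma common_nonzero:
  fixes P :: "'i \<Rightarrow> ('v::finite \<Rightarrow> 'k::field_char_0) \<Rightarrow> bool"
  assumes "finite A" "\<And>v. v \<in> A \<Longrightarrow> \<exists>D a0. eval_at a0 D \<noteq> 0 \<and> (\<forall>a. eval_at a D \<noteq> 0 \<longrightarrow> P v a)"
  shows "\<exists>D a0. eval_at a0 D \<noteq> 0 \<and> (\<forall>a. eval_at a D \<noteq> 0 \<longrightarrow> (\<forall>v\<in>A. P v a))"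
  using assms
proof (induction A rule: finite_induct)
  case empty
  show ?case by (intro exI[of _ 1]) simp
next
  case (insert w A)
  obtain D a where D: "eval_at a D \<noteq> 0" "\<forall>a. eval_at a D \<noteq> 0 \<longrightarrow> (\<forall>v\<in>A. P v a)"
    using insert by blast
  obtain E b where E: "eval_at b E \<noteq> 0" "\<forall>a. eval_at a E \<noteq> 0 \<longrightarrow> P w a"
    using insert.prems[of w] by blast
  obtain c where "eval_at c (D * E) \<noteq> 0" by (rule eval_at_mult_nonzero[OF D(1) E(1)])
  moreover have "\<forall>a. eval_at a (D * E) \<noteq> 0 \<longrightarrow> (\<forall>v\<in>insert w A. P v a)"
    using D(2) E(2) by (simp add: eval_at_mult)
  ultimately show ?case by blast
qed

text \<open>An open set of linear forms acts injectively in the single degree \<open>i0\<close>.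
  Injectivity passes down because the socle sits in degree \<open>e\<close>, and duality turns it
  into surjectivity in the degrees above \<open>i0\<close>.\<close>

theorem quadric_imp_weak_lefschetz:
  fixes I :: "('v::finite, 'k::field_char_0) mpol set"
  assumes card: "CARD('v) = 3" and hom: "homogeneous_ideal I" and gor: "artinian_gorenstein I"
    and q: "q \<in> I" "q \<in> forms 2" "q \<noteq> 0" and linear: "\<And>l. l \<in> I \<Longrightarrow> l \<in> forms 1 \<Longrightarrow> l = 0"
  shows "weak_lefschetz I"
proof -
  obtain e \<phi> where \<phi>_add: "\<And>f g. \<phi> (f + g) = \<phi> f + \<phi> g" and \<phi>_scale: "\<And>c f. \<phi> (const c * f) = c * \<phi> f"
    and \<phi>_I: "\<And>f. f \<in> I \<Longrightarrow> \<phi> f = 0" and beyond: "\<And>m. e < m \<Longrightarrow> forms m \<subseteq> I"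
    and dual: "\<And>m f. m \<le> e \<Longrightarrow> f \<in> forms m \<Longrightarrow> (\<forall>g\<in>forms (e - m). \<phi> (f * g) = 0) \<Longrightarrow> f \<in> I"
    by (rule gorenstein_duality[OF hom gor]) (rule that)
  have "e \<noteq> 0"
  proof
    assume "e = 0"
    then have "var v \<in> I" for v using beyond[of 1] forms_var by auto
    then have "var v = (0 :: ('v, 'k) mpol)" for v using linear forms_var by blast
    then show False by (metis single_zero inj_single lookup_single_eq lookup_zero zero_neq_one)
  qed
  \<comment> \<open>For odd \<open>e = 2 * i0 + 1\<close> the middle degrees are \<open>i0\<close>
    and \<open>i0 + 1\<close>; for even \<open>e = 2 * i0 + 2\<close> the middle degree is
    \<open>i0 + 1\<close>.\<close>
  define i0 where "i0 = (e - 1) div 2"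
  define inj where "inj i a \<longleftrightarrow> (\<forall>f\<in>forms i. linear_form a * f \<in> I \<longrightarrow> f \<in> I)" for i a
  \<comment> \<open>The factor \<open>x\<close> is 1 when \<open>e\<close> is odd; when
    \<open>e\<close> is even it runs through the variables and lowers the socle degree to an odd
    number. Each such functional is still killed by \<open>q\<close>.\<close>
  have \<phi>_v: "\<exists>D a0. eval_at a0 D \<noteq> 0 \<and> (\<forall>a. eval_at a D \<noteq> 0 \<longrightarrow> (\<forall>f\<in>forms t.
      (\<forall>b\<in>forms t. \<phi> (x * (linear_form a * f * b)) = 0) \<longrightarrow> (\<forall>c\<in>forms (Suc t). \<phi> (x * (f * c)) = 0)))"
    for x t
  proof (rule odd_socle_degree_open[OF card q(2,3)])
    show "\<phi> (x * (f + g)) = \<phi> (x * f) + \<phi> (x * g)" for f g by (simp add: distrib_left \<phi>_add)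
    show "\<phi> (x * (const c * f)) = c * \<phi> (x * f)" for c f
      unfolding \<phi>_scale[symmetric] by (simp add: ac_simps)
    show "\<phi> (x * (q * r)) = 0" for r
      by (intro \<phi>_I ideal_mult[OF hom] ideal_mult_right[OF hom] q(1))
  qed
  have "\<exists>D a0. eval_at a0 D \<noteq> 0 \<and> (\<forall>a. eval_at a D \<noteq> 0 \<longrightarrow> inj i0 a)"
  proof (cases "odd e")
    case True
    then have e: "e = 2 * i0 + 1" by (auto simp: i0_def elim!: oddE)
    obtain D a0 where D: "eval_at a0 D \<noteq> 0" "\<And>a f c. eval_at a D \<noteq> 0 \<Longrightarrow> f \<in> forms i0 \<Longrightarrow>
        (\<forall>b\<in>forms i0. \<phi> (1 * (linear_form a * f * b)) = 0) \<Longrightarrow> c \<in> forms (Suc i0) \<Longrightarrow> \<phi> (1 * (f * c)) = 0"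
      using \<phi>_v[of i0 1] by blast
    have "inj i0 a" if a: "eval_at a D \<noteq> 0" for a
      unfolding inj_def
    proof (intro ballI impI)
      fix f :: "('v, 'k) mpol" assume f: "f \<in> forms i0" "linear_form a * f \<in> I"
      have "\<forall>b\<in>forms i0. \<phi> (1 * (linear_form a * f * b)) = 0"
        using ideal_mult_right[OF hom f(2)] \<phi>_I by simp
      then have "\<phi> (f * g) = 0" if "g \<in> forms (Suc i0)" for g using D(2)[OF a f(1) _ that] by simp
      moreover have "e - i0 = Suc i0" using e by simp
      ultimately show "f \<in> I" using e by (intro dual[of i0 f] f(1)) auto
    qed
    then show ?thesis using D(1) by blast
  next
    case False
    define t where "t = i0"
    have e: "e = 2 * t + 2" using False \<open>e \<noteq> 0\<close> by (auto simp: t_def i0_def elim!: evenE)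
    obtain D a0 where D: "eval_at a0 D \<noteq> 0" "\<And>a v f c. eval_at a D \<noteq> 0 \<Longrightarrow> f \<in> forms t \<Longrightarrow>
        (\<forall>b\<in>forms t. \<phi> (var v * (linear_form a * f * b)) = 0) \<Longrightarrow> c \<in> forms (Suc t) \<Longrightarrow>
        \<phi> (var v * (f * c)) = 0"
      using common_nonzero[of "UNIV :: 'v set" "\<lambda>v a. \<forall>f\<in>forms t.
        (\<forall>b\<in>forms t. \<phi> (var v * (linear_form a * f * b)) = 0) \<longrightarrow>
        (\<forall>c\<in>forms (Suc t). \<phi> (var v * (f * c)) = 0)", OF finite \<phi>_v] by blast
    have "inj t a" if a: "eval_at a D \<noteq> 0" for a
      unfolding inj_def
    proof (intro ballI impI)
      fix f :: "('v, 'k) mpol" assume f: "f \<in> forms t" "linear_form a * f \<in> I"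
      have zero: "\<phi> (var v * (f * c)) = 0" if "c \<in> forms (Suc t)" for v c
        using D(2)[OF a f(1) _ that] ideal_mult[OF hom ideal_mult_right[OF hom f(2)]] \<phi>_I by blast
      \<comment> \<open>A form of degree \<open>t + 2\<close> is a sum of variables times forms of
        degree \<open>t + 1\<close>, so the facts \<open>zero\<close> for the single variables
        combine to the vanishing of \<open>\<phi>\<close> itself.\<close>
      have "\<phi> (f * g) = 0" if "g \<in> forms (Suc (Suc t))" for g
        using that
      proof (induction rule: forms_Suc_induct)
        case zero
        show ?case using \<phi>_scale[of 0 0] by simp
      next
        case (var_mult v c)
        then show ?case using zero[of c v] by (simp add: ac_simps)
      qed (simp add: distrib_left \<phi>_add)
      moreover have "e - t = Suc (Suc t)" using e by simp
      ultimately show "f \<in> I" using e by (intro dual[of t f] f(1)) auto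
    qed
    then show ?thesis using D(1) unfolding t_def by blast
  qed
  then obtain D a0 where D: "eval_at a0 D \<noteq> 0" "\<And>a. eval_at a D \<noteq> 0 \<Longrightarrow> inj i0 a" by blast
  \<comment> \<open>If the linear form sends \<open>f\<close> into \<open>I\<close>, it does the
    same to each \<open>var v * f\<close>. Injectivity one degree up puts these into
    \<open>I\<close>, and \<open>f\<close> follows by duality since \<open>i < e\<close>.\<close>
  have inj_below: "inj i a" if "inj i0 a" "i \<le> i0" for i a
    using that(2)
  proof (induction rule: inc_induct)
    case (step i)
    show ?case
      unfolding inj_def
    proof (intro ballI impI)
      fix f :: "('v, 'k) mpol" assume f: "f \<in> forms i" "linear_form a * f \<in> I"
      have i: "i \<le> e" "e - i = Suc (e - Suc i)" using step(2) by (auto simp: i0_def)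
      have "var v * f \<in> I" for v
        using step(3) forms_var_mult[OF f(1)] ideal_mult[OF hom f(2), of "var v"]
        unfolding inj_def by (simp add: mult.left_commute)
      then have zero: "\<phi> (f * (var v * g)) = 0" for v g
        using ideal_mult[OF hom, of "var v * f" g] \<phi>_I by (simp add: ac_simps)
      show "f \<in> I"
      proof (rule dual[OF i(1) f(1)], rule ballI)
        fix g :: "('v, 'k) mpol" assume "g \<in> forms (e - i)"
        then show "\<phi> (f * g) = 0"
          unfolding i(2)
        proof (induction rule: forms_Suc_induct)
          case zero
          show ?case using \<phi>_scale[of 0 0] by simp
        next
          case (var_mult v g)
          show ?case by (rule zero)
        qed (simp add: distrib_left \<phi>_add)
      qed
    qed
  qed (rule that(1))
  \<comment> \<open>Under the duality, multiplication by \<open>L\<close> in degree \<open>i\<close>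
    is the transpose of multiplication in degree \<open>k = e - Suc i\<close>, which is injective as
    \<open>k \<le> i0\<close>. Dual bases turn this into an explicit preimage of
    \<open>h\<close>.\<close>
  have surj_above: "\<exists>f\<in>forms i. h - linear_form a * f \<in> I"
    if a: "inj i0 a" and i: "i0 < i" and h: "h \<in> forms (Suc i)" for i a h
  proof (cases "e \<le> i")
    case True
    then have "h \<in> I" using beyond[of "Suc i"] h by auto
    then show ?thesis by (intro bexI[of _ 0]) simp_all
  next
    case False
    define k where "k = e - Suc i"
    have k: "k \<le> i0" "k \<le> e" "e - Suc i = k" "Suc i \<le> e" "e - k = Suc i"
      using i False by (auto simp: k_def i0_def)
    define L :: "('v, 'k) mpol" where "L = linear_form a"
    obtain F :: "('v, 'k) mpol set" where F: "finite F" "forms k \<subseteq> mpol.span F" by (rule forms_fd)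
    have add1: "\<phi> (L * (x + y) * z) = \<phi> (L * x * z) + \<phi> (L * y * z)"
      and add2: "\<phi> (L * z * (x + y)) = \<phi> (L * z * x) + \<phi> (L * z * y)" for x y z
      by (simp_all add: distrib_left distrib_right \<phi>_add)
    have scale1: "\<phi> (L * (const c * x) * z) = c * \<phi> (L * x * z)"
      and scale2: "\<phi> (L * z * (const c * x)) = c * \<phi> (L * z * x)" for c x z
      unfolding \<phi>_scale[symmetric] by (simp_all add: ac_simps)
    obtain n :: nat and g f where gf: "\<And>j. j < n \<Longrightarrow> g j \<in> forms k" "\<And>j. j < n \<Longrightarrow> f j \<in> forms i"
      "\<And>j l. j < n \<Longrightarrow> l < n \<Longrightarrow> \<phi> (L * g j * f l) = (if j = l then 1 else 0)"
      "\<And>u w. u \<in> forms k \<Longrightarrow> w \<in> forms i \<Longrightarrow> \<phi> (L * u * w) = (\<Sum>j<n. \<phi> (L * u * f j) * \<phi> (L * g j * w))"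
    by (rule mpol.dual_bases[of "forms k" F "forms i" "\<lambda>u w. \<phi> (L * u * w)",
          OF subspace_forms F(2,1) subspace_forms add1 scale1 add2 scale2]) (rule that)
    have \<phi>_0: "\<phi> 0 = 0" using \<phi>_scale[of 0 0] by simp
    have \<phi>_diff: "\<phi> (x - y) = \<phi> x - \<phi> y" for x y using \<phi>_add[of "x - y" y] by simp
    have \<phi>_sum: "\<phi> (\<Sum>j<m. x j) = (\<Sum>j<m. \<phi> (x j))" for x and m :: nat
      by (induction m) (simp_all add: \<phi>_0 \<phi>_add)
    \<comment> \<open>\<open>w\<close> is chosen so that \<open>L * w\<close> and \<open>h\<close>
      pair equally with every \<open>g j\<close>.\<close>
    define w where "w = (\<Sum>j<n. const (\<phi> (g j * h)) * f j)"
    have w: "w \<in> forms i" unfolding w_def by (intro forms_sum forms_const_mult gf(2)) simp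
    have pair_w: "\<phi> (L * u * w) = (\<Sum>j<n. \<phi> (g j * h) * \<phi> (L * u * f j))" for u
    proof -
      have "L * u * w = (\<Sum>j<n. const (\<phi> (g j * h)) * (L * u * f j))"
        unfolding w_def sum_distrib_left by (simp add: ac_simps)
      then show ?thesis by (simp add: \<phi>_sum \<phi>_scale)
    qed
    have "h - L * w \<in> I"
    proof (rule dual[OF k(4)], goal_cases)
      case 1
      show ?case
        using forms_mult[OF linear_form_forms w, of a] h unfolding L_def by (intro forms_diff) simp_all
    next
      case 2
      show ?case
      proof
        fix u :: "('v, 'k) mpol" assume "u \<in> forms (e - Suc i)"
        then have u: "u \<in> forms k" by (simp add: k(3))
        \<comment> \<open>\<open>u'\<close> is \<open>u\<close> without its components along the
          \<open>g j\<close>. It lies in the radical of the pairing, so \<open>L * u'\<close> is in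
          \<open>I\<close>, and by injectivity so is \<open>u'\<close>.\<close>
        define u' where "u' = u - (\<Sum>j<n. const (\<phi> (L * u * f j)) * g j)"
        have u': "u' \<in> forms k"
          unfolding u'_def by (intro forms_diff u forms_sum forms_const_mult gf(1)) simp
        have zero: "\<phi> (L * u' * x) = 0" if x: "x \<in> forms i" for x
        proof -
          have "L * u' * x = L * u * x - (\<Sum>j<n. const (\<phi> (L * u * f j)) * (L * g j * x))"
            unfolding u'_def by (simp add: left_diff_distrib right_diff_distrib sum_distrib_left
                sum_distrib_right ac_simps)
          then show ?thesis using gf(4)[OF u x] by (simp add: \<phi>_diff \<phi>_sum \<phi>_scale)
        qed
        have "L * u' \<in> I"
        proof (intro dual[of "Suc k" "L * u'"])
          show "Suc k \<le> e" using i False by (auto simp: k_def i0_def)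
          show "L * u' \<in> forms (Suc k)" using forms_mult[OF linear_form_forms u', of a] by (simp add: L_def)
          have "e - Suc k = i" using k(5) by simp
          then show "\<forall>x\<in>forms (e - Suc k). \<phi> (L * u' * x) = 0" using zero by simp
        qed
        then have "u' \<in> I" using inj_below[OF a k(1)] u' by (simp add: inj_def L_def)
        then have "\<phi> (u' * h) = 0" by (intro \<phi>_I ideal_mult_right[OF hom])
        moreover have "u' * h = u * h - (\<Sum>j<n. const (\<phi> (L * u * f j)) * (g j * h))"
          unfolding u'_def left_diff_distrib sum_distrib_right mult.assoc ..
        ultimately have "\<phi> (u * h) = (\<Sum>j<n. \<phi> (L * u * f j) * \<phi> (g j * h))"
          by (simp add: \<phi>_diff \<phi>_sum \<phi>_scale)
        also have "\<dots> = \<phi> (L * u * w)" unfolding pair_w by (simp add: mult.commute)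
        also have "L * u * w = L * w * u" by (simp only: ac_simps)
        finally show "\<phi> ((h - L * w) * u) = 0"
          unfolding left_diff_distrib \<phi>_diff mult.commute[of u h] by simp
      qed
    qed
    then show ?thesis using w unfolding L_def by blast
  qed
  define U where "U = (\<lambda>a. residue_class I (linear_form a)) ` {a. eval_at a D \<noteq> 0}"
  \<comment> \<open>As \<open>I\<close> contains no nonzero linear form, a class has only one
    coefficient vector, and the preimage of \<open>U\<close> is exactly the set where
    \<open>D\<close> does not vanish.\<close>
  have class_inj: "a = b" if "residue_class I (linear_form a) = residue_class I (linear_form b)" for a b
  proof -
    have "linear_form a - linear_form b \<in> I" using that residue_class_eq[OF hom] by blast
    then have "linear_form a - linear_form b = 0"
      by (rule linear) (intro forms_diff linear_form_forms)
    then show "a = b" by (intro linear_form_inj) simp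
  qed
  have "zariski_open_piece1 I U"
    unfolding zariski_open_piece1_def
  proof
    show "U \<subseteq> graded_piece I 1" 
      unfolding U_def graded_piece_def by (intro image_subsetI imageI linear_form_forms)
    have "{a. residue_class I (linear_form a) \<in> U} = - {a. \<forall>p\<in>{D}. eval_at a p = 0}"
      using class_inj by (auto simp: U_def)
    then show "zariski_open {a. residue_class I (linear_form a) \<in> U}"
      unfolding zariski_open_def by blast
  qed
  moreover have "U \<noteq> {}" using D(1) by (auto simp: U_def)
  moreover have "max_rank_at I l i" if l: "l \<in> U" for l i
  proof -
    obtain a where a: "eval_at a D \<noteq> 0" "l = residue_class I (linear_form a)" using l by (auto simp: U_def)
    note inj = D(2)[OF a(1)]
    show ?thesis
    proof (cases "i \<le> i0")
      case True
      then show ?thesis unfolding a(2)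
        using inj_below[OF inj] by (intro max_rank_at_injective[OF hom]) (auto simp: inj_def)
    next
      case False
      then show ?thesis unfolding a(2)
        by (intro max_rank_at_surjective[OF hom] linear_form_forms surj_above[OF inj]) simp_all
    qed
  qed
  ultimately show ?thesis unfolding weak_lefschetz_def by blast
qed

theorem corollary3p2:
  fixes I :: "(3, 'k::field_char_0) mpol set"
  assumes "homogeneous_ideal I"
    and "artinian_gorenstein I"
    and "initial_degree I = 2"
  shows "weak_lefschetz I"
proof -
  let ?P = "\<lambda>t. \<exists>f\<in>I \<inter> forms t. f \<noteq> 0"
  obtain N where N: "forms N \<subseteq> I"
    using artinian_imp_forms_subset[OF assms(1)] assms(2) by (auto simp: artinian_gorenstein_def)
  \<comment> \<open>The \<open>LEAST\<close> in \<open>initial_degree\<close> is meaningful only if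
    \<open>I\<close> contains a nonzero form; the \<open>N\<close>-th power of the variable with
    index \<open>0\<close> is one.\<close>
  have "Poly_Mapping.single (Poly_Mapping.single 0 N) 1 \<in> I \<inter> forms N"
    using N forms_single[of "Poly_Mapping.single 0 N" N] by auto
  moreover have "Poly_Mapping.single (Poly_Mapping.single 0 N) 1 \<noteq> (0 :: (3, 'k) mpol)"
    by (metis lookup_single_eq lookup_zero zero_neq_one)
  ultimately have "?P N" by blast
  then have "?P (LEAST t. ?P t)" by (rule LeastI)
  then obtain q where q: "q \<in> I" "q \<in> forms 2" "q \<noteq> 0"
    using assms(3) unfolding initial_degree_def by auto
  have "\<not> ?P 1" using not_less_Least[of 1 ?P] assms(3) unfolding initial_degree_def by simp
  then have "\<And>l. l \<in> I \<Longrightarrow> l \<in> forms 1 \<Longrightarrow> l = 0" by blast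
  then show ?thesis
    using quadric_imp_weak_lefschetz[OF _ assms(1,2) q] by simp
qed

end
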